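(* Let $\mathfrak g$ be a finite dimensional Lie algebra over a field of characteristic zero and let $\mathfrak p$ and $\mathfrak q$ be parabolic subalgebras of $\mathfrak g$. Then $\mathfrak r:=\mathfrak p\cap\mathfrak q+\mathrm{nil}(\mathfrak q)$ is a parabolic subalgebra of $\mathfrak g$, and $\mathrm{nil}(\mathfrak r)=\mathrm{nil}(\mathfrak p)\cap\mathfrak q+\mathrm{nil}(\mathfrak q)$.
   Context: All representations are finite dimensional. The nilpotent radical $\mathrm{nil}(\mathfrak h)$ of a Lie algebra $\mathfrak h$ is the intersection of the kernels of all simple representations of $\mathfrak h$. The nilpotent cone $\mathcal N(\mathfrak g)$ is the set of $x\in\mathfrak g$ such that $\rho(x)$ is nilpotent for every representation $\rho$ of $\mathfrak g$. A nil subalgebra of $\mathfrak g$ is a Lie subalgebra contained in $\mathcal N(\mathfrak g)$. A subalgebra of $\mathfrak g$ is \emph{parabolic in $\mathfrak g$} if it contains the normalizer in $\mathfrak g$ of some maximal nil subalgebra of $\mathfrak g$. *)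

theory Defs
  imports
    Complex_Main
    "HOL-Library.Function_Algebras"
    "HOL-Library.Set_Algebras"
begin

text \<open>
  Vector spaces are subspaces of an ambient type carrying a \<^locale>\<open>vector_space\<close> structure,
  and subalgebras of a Lie algebra \<open>g\<close> are Lie algebras for the same bracket and a smaller
  carrier. The bracket is unconstrained outside the carrier.
\<close>

locale lie_algebra = vector_space scale
  for scale :: "'k::field \<Rightarrow> 'a::ab_group_add \<Rightarrow> 'a" +
  fixes bracket :: "'a \<Rightarrow> 'a \<Rightarrow> 'a"
    and g :: "'a set"
  assumes subspace_carrier: "subspace g"
    and bracket_closed: "\<lbrakk>x \<in> g; y \<in> g\<rbrakk> \<Longrightarrow> bracket x y \<in> g"
    and bracket_add_left:
      "\<lbrakk>x \<in> g; y \<in> g; z \<in> g\<rbrakk> \<Longrightarrow> bracket (x + y) z = bracket x z + bracket y z"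
    and bracket_add_right:
      "\<lbrakk>x \<in> g; y \<in> g; z \<in> g\<rbrakk> \<Longrightarrow> bracket x (y + z) = bracket x y + bracket x z"
    and bracket_scale_left:
      "\<lbrakk>x \<in> g; y \<in> g\<rbrakk> \<Longrightarrow> bracket (scale c x) y = scale c (bracket x y)"
    and bracket_scale_right:
      "\<lbrakk>x \<in> g; y \<in> g\<rbrakk> \<Longrightarrow> bracket x (scale c y) = scale c (bracket x y)"
    and bracket_self: "x \<in> g \<Longrightarrow> bracket x x = 0"
    and jacobi:
      "\<lbrakk>x \<in> g; y \<in> g; z \<in> g\<rbrakk> \<Longrightarrow>
        bracket x (bracket y z) + bracket y (bracket z x) + bracket z (bracket x y) = 0"

definition fin_dim :: "('k::field \<Rightarrow> 'a::ab_group_add \<Rightarrow> 'a) \<Rightarrow> 'a set \<Rightarrow> bool" where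
  "fin_dim scale V \<longleftrightarrow> (\<exists>B. finite B \<and> V = module.span scale B)"

definition lie_subalgebra ::
    "('k::field \<Rightarrow> 'a::ab_group_add \<Rightarrow> 'a) \<Rightarrow> ('a \<Rightarrow> 'a \<Rightarrow> 'a) \<Rightarrow> 'a set \<Rightarrow> 'a set \<Rightarrow> bool" where
  "lie_subalgebra scale bracket g h \<longleftrightarrow>
     h \<subseteq> g \<and> module.subspace scale h \<and> (\<forall>x\<in>h. \<forall>y\<in>h. bracket x y \<in> h)"

locale lie_representation =
  lie_algebra scale bracket h + V: vector_space scaleV
  for scale :: "'k::field \<Rightarrow> 'a::ab_group_add \<Rightarrow> 'a"
    and bracket :: "'a \<Rightarrow> 'a \<Rightarrow> 'a"
    and h :: "'a set"
    and scaleV :: "'k \<Rightarrow> 'v::ab_group_add \<Rightarrow> 'v" +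
  fixes V :: "'v set"
    and \<rho> :: "'a \<Rightarrow> 'v \<Rightarrow> 'v"
  assumes V_fin_dim: "fin_dim scaleV V"
    and rho_closed: "\<lbrakk>x \<in> h; v \<in> V\<rbrakk> \<Longrightarrow> \<rho> x v \<in> V"
    and rho_add_right: "\<lbrakk>x \<in> h; v \<in> V; w \<in> V\<rbrakk> \<Longrightarrow> \<rho> x (v + w) = \<rho> x v + \<rho> x w"
    and rho_scale_right: "\<lbrakk>x \<in> h; v \<in> V\<rbrakk> \<Longrightarrow> \<rho> x (scaleV c v) = scaleV c (\<rho> x v)"
    and rho_add_left: "\<lbrakk>x \<in> h; y \<in> h; v \<in> V\<rbrakk> \<Longrightarrow> \<rho> (x + y) v = \<rho> x v + \<rho> y v"
    and rho_scale_left: "\<lbrakk>x \<in> h; v \<in> V\<rbrakk> \<Longrightarrow> \<rho> (scale c x) v = scaleV c (\<rho> x v)"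
    and rho_bracket:
      "\<lbrakk>x \<in> h; y \<in> h; v \<in> V\<rbrakk> \<Longrightarrow> \<rho> (bracket x y) v = \<rho> x (\<rho> y v) - \<rho> y (\<rho> x v)"

definition simple_representation ::
    "('k::field \<Rightarrow> 'a::ab_group_add \<Rightarrow> 'a) \<Rightarrow> ('a \<Rightarrow> 'a \<Rightarrow> 'a) \<Rightarrow> 'a set \<Rightarrow>
     ('k \<Rightarrow> 'v::ab_group_add \<Rightarrow> 'v) \<Rightarrow> 'v set \<Rightarrow> ('a \<Rightarrow> 'v \<Rightarrow> 'v) \<Rightarrow> bool" where
  "simple_representation scale bracket h scaleV V \<rho> \<longleftrightarrow>
     lie_representation scale bracket h scaleV V \<rho> \<and> V \<noteq> {0} \<and>
     (\<forall>W. module.subspace scaleV W \<and> W \<subseteq> V \<and> (\<forall>x\<in>h. \<forall>w\<in>W. \<rho> x w \<in> W) \<longrightarrow> W = {0} \<or> W = V)"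

text \<open>
  HOL cannot quantify over types inside a definition. A finite dimensional vector space over
  \<open>'k\<close> is isomorphic to a subspace of \<open>nat \<Rightarrow> 'k\<close> with the pointwise operations, so
  ``every representation'' below means every representation on a finite dimensional subspace of
  \<open>nat \<Rightarrow> 'k\<close>. The lemmas \<open>nilpotent_cone_any\<close> and \<open>nil_radical_any\<close> show that
  representations on arbitrary types are then covered as well.
\<close>

definition fun_scale :: "'k::field \<Rightarrow> (nat \<Rightarrow> 'k) \<Rightarrow> nat \<Rightarrow> 'k" where
  "fun_scale c f = (\<lambda>i. c * f i)"

definition nil_radical ::
    "('k::field \<Rightarrow> 'a::ab_group_add \<Rightarrow> 'a) \<Rightarrow> ('a \<Rightarrow> 'a \<Rightarrow> 'a) \<Rightarrow> 'a set \<Rightarrow> 'a set" where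
  "nil_radical scale bracket h =
     {x \<in> h. \<forall>V \<rho>. simple_representation scale bracket h fun_scale V \<rho> \<longrightarrow> (\<forall>v\<in>V. \<rho> x v = 0)}"

definition nilpotent_cone ::
    "('k::field \<Rightarrow> 'a::ab_group_add \<Rightarrow> 'a) \<Rightarrow> ('a \<Rightarrow> 'a \<Rightarrow> 'a) \<Rightarrow> 'a set \<Rightarrow> 'a set" where
  "nilpotent_cone scale bracket g =
     {x \<in> g. \<forall>V \<rho>. lie_representation scale bracket g fun_scale V \<rho> \<longrightarrow>
        (\<exists>m. \<forall>v\<in>V. (\<rho> x ^^ m) v = 0)}"

definition nil_subalgebra ::
    "('k::field \<Rightarrow> 'a::ab_group_add \<Rightarrow> 'a) \<Rightarrow> ('a \<Rightarrow> 'a \<Rightarrow> 'a) \<Rightarrow> 'a set \<Rightarrow> 'a set \<Rightarrow> bool" where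
  "nil_subalgebra scale bracket g m \<longleftrightarrow>
     lie_subalgebra scale bracket g m \<and> m \<subseteq> nilpotent_cone scale bracket g"

definition maximal_nil_subalgebra ::
    "('k::field \<Rightarrow> 'a::ab_group_add \<Rightarrow> 'a) \<Rightarrow> ('a \<Rightarrow> 'a \<Rightarrow> 'a) \<Rightarrow> 'a set \<Rightarrow> 'a set \<Rightarrow> bool" where
  "maximal_nil_subalgebra scale bracket g m \<longleftrightarrow>
     nil_subalgebra scale bracket g m \<and>
     (\<forall>n. nil_subalgebra scale bracket g n \<and> m \<subseteq> n \<longrightarrow> n = m)"

definition lie_normalizer :: "('a \<Rightarrow> 'a \<Rightarrow> 'a) \<Rightarrow> 'a set \<Rightarrow> 'a set \<Rightarrow> 'a set" where
  "lie_normalizer bracket g m = {x \<in> g. \<forall>y\<in>m. bracket x y \<in> m}"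

definition parabolic_subalgebra ::
    "('k::field \<Rightarrow> 'a::ab_group_add \<Rightarrow> 'a) \<Rightarrow> ('a \<Rightarrow> 'a \<Rightarrow> 'a) \<Rightarrow> 'a set \<Rightarrow> 'a set \<Rightarrow> bool" where
  "parabolic_subalgebra scale bracket g p \<longleftrightarrow>
     lie_subalgebra scale bracket g p \<and>
     (\<exists>m. maximal_nil_subalgebra scale bracket g m \<and> lie_normalizer bracket g m \<subseteq> p)"


subsection \<open>Independence of the ambient type of the representation\<close>

lemma vector_space_fun_scale: "vector_space (fun_scale :: 'k::field \<Rightarrow> _)"
  by standard (auto simp: fun_scale_def fun_eq_iff algebra_simps)

lemma coordinates_exist:
  fixes scaleV :: "'k::field \<Rightarrow> 'v::ab_group_add \<Rightarrow> 'v"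
  assumes "vector_space scaleV" and "fin_dim scaleV V"
  obtains \<phi> :: "'v \<Rightarrow> nat \<Rightarrow> 'k" where
    "inj_on \<phi> V"
    "\<And>v w. \<lbrakk>v \<in> V; w \<in> V\<rbrakk> \<Longrightarrow> \<phi> (v + w) = \<phi> v + \<phi> w"
    "\<And>c v. v \<in> V \<Longrightarrow> \<phi> (scaleV c v) = fun_scale c (\<phi> v)"
proof -
  interpret V: vector_space scaleV by fact
  obtain F where F: "finite F" "V = V.span F"
    using assms(2) unfolding fin_dim_def by blast
  obtain B where B: "B \<subseteq> F" "V.independent B" "F \<subseteq> V.span B"
    by (rule V.maximal_independent_subset)
  have fB: "finite B" using B(1) F(1) finite_subset by blast
  have sB: "V = V.span B"
    using B F V.span_mono[of B F] V.span_minimal[OF B(3)] by auto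
  obtain e where e: "bij_betw e {0..<card B} B"
    using ex_bij_betw_nat_finite[OF fB] by blast
  define \<phi> where "\<phi> v = (\<lambda>i. if i < card B then V.representation B v (e i) else 0)" for v
  show thesis
  proof
    show "inj_on \<phi> V"
    proof (rule inj_onI)
      fix v w assume vw: "v \<in> V" "w \<in> V" "\<phi> v = \<phi> w"
      have "V.representation B v b = V.representation B w b" for b
      proof (cases "b \<in> B")
        case True
        then obtain i where "i < card B" "e i = b"
          using e unfolding bij_betw_def by (metis atLeastLessThan_iff imageE)
        then show ?thesis using fun_cong[OF vw(3), of i] by (simp add: \<phi>_def)
      next
        case False
        then show ?thesis using V.representation_ne_zero by metis
      qed
      then have eq: "V.representation B v = V.representation B w" by (rule ext)
      have repr: "(\<Sum>b\<in>B. scaleV (V.representation B u b) b) = u" if "u \<in> V" for u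
        using V.sum_representation_eq[OF B(2) _ fB order_refl, of u] that sB by blast
      show "v = w" using repr[OF vw(1)] repr[OF vw(2)] unfolding eq by (rule trans[OF sym])
    qed
  next
    fix v w assume "v \<in> V" "w \<in> V"
    then have "V.representation B (v + w) = (\<lambda>b. V.representation B v b + V.representation B w b)"
      using sB V.representation_add[OF B(2), of w v] by blast
    then show "\<phi> (v + w) = \<phi> v + \<phi> w" by (simp add: \<phi>_def fun_eq_iff)
  next
    fix c v assume "v \<in> V"
    then have "V.representation B (scaleV c v) = (\<lambda>b. c * V.representation B v b)"
      using sB V.representation_scale[OF B(2), of v c] by blast
    then show "\<phi> (scaleV c v) = fun_scale c (\<phi> v)"
      by (simp add: \<phi>_def fun_scale_def fun_eq_iff)
  qed
qed

lemma representation_transfer: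
  fixes scaleV :: "'k::field \<Rightarrow> 'v::ab_group_add \<Rightarrow> 'v"
  assumes "lie_representation scale bracket h scaleV V \<rho>"
  obtains V' \<rho>' and \<phi> :: "'v \<Rightarrow> nat \<Rightarrow> 'k" where
    "lie_representation scale bracket h fun_scale V' \<rho>'"
    "bij_betw \<phi> V V'" "\<phi> 0 = 0"
    "\<And>v w. \<lbrakk>v \<in> V; w \<in> V\<rbrakk> \<Longrightarrow> \<phi> (v + w) = \<phi> v + \<phi> w"
    "\<And>c v. v \<in> V \<Longrightarrow> \<phi> (scaleV c v) = fun_scale c (\<phi> v)"
    "\<And>x v. \<lbrakk>x \<in> h; v \<in> V\<rbrakk> \<Longrightarrow> \<rho>' x (\<phi> v) = \<phi> (\<rho> x v)"
proof -
  interpret lie_representation scale bracket h scaleV V \<rho> by fact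
  interpret F: vector_space "fun_scale :: 'k \<Rightarrow> _" by (rule vector_space_fun_scale)
  obtain \<phi> where inj: "inj_on \<phi> V"
    and add: "\<And>v w. \<lbrakk>v \<in> V; w \<in> V\<rbrakk> \<Longrightarrow> \<phi> (v + w) = \<phi> v + \<phi> w"
    and scl: "\<And>c v. v \<in> V \<Longrightarrow> \<phi> (scaleV c v) = fun_scale c (\<phi> v)"
    using coordinates_exist[OF V.vector_space_axioms V_fin_dim] by blast
  obtain B where B: "finite B" "V = V.span B" using V_fin_dim unfolding fin_dim_def by blast
  have sV: "V.subspace V" using B(2) V.subspace_span by simp
  have z: "\<phi> 0 = 0" using scl[of 0 0] V.subspace_0[OF sV] by (simp add: F.scale_zero_left)
  have minus: "\<phi> (v - w) = \<phi> v - \<phi> w" if "v \<in> V" "w \<in> V" for v w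
    using add[of "v - w" w] that V.subspace_diff[OF sV] by (simp add: eq_diff_eq)
  define \<psi> where "\<psi> = inv_into V \<phi>"
  have psi [simp]: "\<psi> (\<phi> v) = v" if "v \<in> V" for v
    using inv_into_f_f[OF inj that] by (simp add: \<psi>_def)
  define \<rho>' where "\<rho>' x f = \<phi> (\<rho> x (\<psi> f))" for x f
  have "F.subspace (\<phi> ` V)"
    unfolding F.subspace_def
  proof (intro conjI ballI allI)
    show "0 \<in> \<phi> ` V" using z V.subspace_0[OF sV] by (metis imageI)
    show "a + b \<in> \<phi> ` V" if "a \<in> \<phi> ` V" "b \<in> \<phi> ` V" for a b
      using that add V.subspace_add[OF sV] by (smt (verit) imageE imageI)
    show "fun_scale c a \<in> \<phi> ` V" if "a \<in> \<phi> ` V" for c a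
      using that scl V.subspace_scale[OF sV] by (smt (verit) imageE imageI)
  qed
  moreover have BV: "B \<subseteq> V" using B(2) V.span_superset by blast
  moreover have "\<phi> v \<in> F.span (\<phi> ` B)" if "v \<in> V" for v
  proof -
    have "v \<in> V.span B" using that B(2) by simp
    then have "v \<in> V \<and> \<phi> v \<in> F.span (\<phi> ` B)"
    proof (induction rule: V.span_induct_alt)
      case base
      then show ?case using z V.subspace_0[OF sV] F.span_zero by metis
    next
      case (step c x y)
      then have x: "x \<in> V" using BV by blast
      have cx: "scaleV c x \<in> V" by (rule V.subspace_scale[OF sV x])
      have "\<phi> (scaleV c x + y) = fun_scale c (\<phi> x) + \<phi> y"
        using add[OF cx] scl[OF x, of c] step by metis
      moreover have "fun_scale c (\<phi> x) + \<phi> y \<in> F.span (\<phi> ` B)"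
        using step by (intro F.span_add F.span_scale F.span_base[of "\<phi> x"]) auto
      ultimately show ?case using V.subspace_add[OF sV cx, of y] step by metis
    qed
    then show ?thesis by simp
  qed
  ultimately have "\<phi> ` V = F.span (\<phi> ` B)"
    using F.span_minimal[of "\<phi> ` B" "\<phi> ` V"] by blast
  then have fd: "fin_dim fun_scale (\<phi> ` V)" unfolding fin_dim_def using B(1) by blast
  have "lie_representation scale bracket h fun_scale (\<phi> ` V) \<rho>'"
  proof (unfold_locales)
    fix x y f f' c
    assume x: "x \<in> h" and f: "f \<in> \<phi> ` V"
    from f obtain v where v: "v \<in> V" "f = \<phi> v" by blast
    show "\<rho>' x f \<in> \<phi> ` V" using x v rho_closed by (simp add: \<rho>'_def)
    show "\<rho>' x (fun_scale c f) = fun_scale c (\<rho>' x f)"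
      using x v V.subspace_scale[OF sV] rho_closed rho_scale_right
      by (simp add: \<rho>'_def scl[symmetric])
    show "\<rho>' (scale c x) f = fun_scale c (\<rho>' x f)"
      using x v rho_closed rho_scale_left by (simp add: \<rho>'_def scl[symmetric])
    show "\<rho>' x (f + f') = \<rho>' x f + \<rho>' x f'" if "f' \<in> \<phi> ` V"
    proof -
      from that obtain w where w: "w \<in> V" "f' = \<phi> w" by blast
      show ?thesis using x v w V.subspace_add[OF sV] rho_closed rho_add_right
        by (simp add: \<rho>'_def add[symmetric])
    qed
    assume y: "y \<in> h"
    show "\<rho>' (x + y) f = \<rho>' x f + \<rho>' y f"
      using x y v rho_closed rho_add_left by (simp add: \<rho>'_def add[symmetric])
    show "\<rho>' (bracket x y) f = \<rho>' x (\<rho>' y f) - \<rho>' y (\<rho>' x f)"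
      using x y v rho_closed rho_bracket by (simp add: \<rho>'_def minus[symmetric])
  qed (rule fd)
  moreover have "bij_betw \<phi> V (\<phi> ` V)" using inj by (simp add: bij_betw_def)
  ultimately show thesis
    using that[of "\<phi> ` V" \<rho>' \<phi>] z add scl by (simp add: \<rho>'_def)
qed

lemma nilpotent_cone_any:
  fixes scaleV :: "'k::field \<Rightarrow> 'v::ab_group_add \<Rightarrow> 'v"
  assumes "x \<in> nilpotent_cone scale bracket g"
    and rep: "lie_representation scale bracket g scaleV V \<rho>"
  shows "\<exists>m. \<forall>v\<in>V. (\<rho> x ^^ m) v = 0"
proof -
  interpret lie_representation scale bracket g scaleV V \<rho> by fact
  have x: "x \<in> g" using assms(1) by (simp add: nilpotent_cone_def)
  obtain V' \<rho>' and \<phi> :: "'v \<Rightarrow> nat \<Rightarrow> 'k" where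
    r: "lie_representation scale bracket g fun_scale V' \<rho>'"
    and bij: "bij_betw \<phi> V V'" and z: "\<phi> 0 = 0"
    and eq: "\<And>x v. \<lbrakk>x \<in> g; v \<in> V\<rbrakk> \<Longrightarrow> \<rho>' x (\<phi> v) = \<phi> (\<rho> x v)"
    by (rule representation_transfer[OF rep]) blast
  obtain m where m: "\<forall>v\<in>V'. (\<rho>' x ^^ m) v = 0"
    using assms(1) r unfolding nilpotent_cone_def by blast
  have V0: "0 \<in> V"
    using V_fin_dim V.span_zero unfolding fin_dim_def by blast
  have "(\<rho> x ^^ m) v = 0" if v: "v \<in> V" for v
  proof -
    have "(\<rho> x ^^ n) v \<in> V \<and> (\<rho>' x ^^ n) (\<phi> v) = \<phi> ((\<rho> x ^^ n) v)" for n
      by (induction n) (use v x eq rho_closed in auto)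
    then show ?thesis
      using m bij v z V0 unfolding bij_betw_def by (metis imageI inj_onD)
  qed
  then show ?thesis by blast
qed

lemma nil_radical_any:
  fixes scaleV :: "'k::field \<Rightarrow> 'v::ab_group_add \<Rightarrow> 'v"
  assumes "x \<in> nil_radical scale bracket h"
    and simple: "simple_representation scale bracket h scaleV V \<rho>"
    and v: "v \<in> V"
  shows "\<rho> x v = 0"
proof -
  have rep: "lie_representation scale bracket h scaleV V \<rho>"
    using simple by (simp add: simple_representation_def)
  interpret lie_representation scale bracket h scaleV V \<rho> by fact
  interpret F: vector_space "fun_scale :: 'k \<Rightarrow> _" by (rule vector_space_fun_scale)
  have x: "x \<in> h" using assms(1) by (simp add: nil_radical_def)
  obtain V' \<rho>' and \<phi> :: "'v \<Rightarrow> nat \<Rightarrow> 'k" where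
    r: "lie_representation scale bracket h fun_scale V' \<rho>'"
    and bij: "bij_betw \<phi> V V'" and z: "\<phi> 0 = 0"
    and add: "\<And>v w. \<lbrakk>v \<in> V; w \<in> V\<rbrakk> \<Longrightarrow> \<phi> (v + w) = \<phi> v + \<phi> w"
    and scl: "\<And>c v. v \<in> V \<Longrightarrow> \<phi> (scaleV c v) = fun_scale c (\<phi> v)"
    and eq: "\<And>x v. \<lbrakk>x \<in> h; v \<in> V\<rbrakk> \<Longrightarrow> \<rho>' x (\<phi> v) = \<phi> (\<rho> x v)"
    by (rule representation_transfer[OF rep]) blast
  have sV: "V.subspace V"
    using V_fin_dim V.subspace_span unfolding fin_dim_def by blast
  then have V0: "0 \<in> V" by (rule V.subspace_0)
  have inj: "inj_on \<phi> V" and img: "\<phi> ` V = V'" using bij by (auto simp: bij_betw_def)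
  have "simple_representation scale bracket h fun_scale V' \<rho>'"
    unfolding simple_representation_def
  proof (intro conjI allI impI)
    show "V' \<noteq> {0}"
    proof
      assume "V' = {0}"
      then have "v = 0" if "v \<in> V" for v
        using inj_onD[OF inj _ that V0] that img z by auto
      then have "V = {0}" using V0 by blast
      then show False using simple by (simp add: simple_representation_def)
    qed
  next
    fix W
    assume W: "F.subspace W \<and> W \<subseteq> V' \<and> (\<forall>x\<in>h. \<forall>w\<in>W. \<rho>' x w \<in> W)"
    define U where "U = {u \<in> V. \<phi> u \<in> W}"
    have UW: "\<phi> ` U = W" using W img by (auto simp: U_def)
    have "V.subspace U"
      unfolding V.subspace_def
    proof (intro conjI ballI allI)
      show "0 \<in> U" using V0 z W F.subspace_0 by (auto simp: U_def)
      show "a + b \<in> U" if "a \<in> U" "b \<in> U" for a b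
        using that W add V.subspace_add[OF sV] F.subspace_add by (auto simp: U_def)
      show "scaleV c a \<in> U" if "a \<in> U" for c a
        using that W scl V.subspace_scale[OF sV] F.subspace_scale by (auto simp: U_def)
    qed
    moreover have "U \<subseteq> V" by (auto simp: U_def)
    moreover have "\<forall>x\<in>h. \<forall>u\<in>U. \<rho> x u \<in> U"
      using W eq rho_closed by (force simp: U_def)
    ultimately have "U = {0} \<or> U = V"
      using simple unfolding simple_representation_def by blast
    then show "W = {0} \<or> W = V'" using UW img z by auto
  qed (rule r)
  then have "\<rho>' x (\<phi> v) = 0"
    using assms(1) v img unfolding nil_radical_def by blast
  then show ?thesis using eq[OF x v] z inj V0 rho_closed[OF x v] by (metis inj_onD)
qed

end

theory Submission
  imports Defs "HOL-Algebra.Algebraic_Closure_Type"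
begin

text \<open>
  Let \<open>D = [g, g]\<close>, let \<open>Q\<close> be the solvable radical of \<open>g\<close>, and let \<open>\<kappa>\<close> be the trace form of \<open>g\<close> on
  \<open>g / Q\<close>. Its radical is \<open>Q\<close>, so it pairs \<open>D / (D \<inter> Q)\<close> perfectly with \<open>g / Q\<close>. For a subspace \<open>Y\<close>
  above \<open>Q\<close> let \<open>Y'\<close> be the orthogonal of \<open>Y\<close> in \<open>D\<close>. If \<open>m\<close> is a maximal nil subalgebra with
  normalizer \<open>N\<close>, then \<open>N' = m\<close>: every element of \<open>N \<inter> N'\<close> is a sum of brackets \<open>[a, b]\<close> with \<open>a\<close> in
  \<open>m\<close> and \<open>b\<close> orthogonal to \<open>m\<close>, hence nilpotent by Cartan's argument, and Engel's theorem gives the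
  rest. It follows that a subalgebra \<open>p\<close> above \<open>Q\<close> is parabolic iff \<open>p'\<close> consists of nilpotent
  elements of \<open>p\<close>, and then \<open>p' = nil(p)\<close>. For \<open>r = p \<inter> q + q'\<close> linear algebra yields
  \<open>r' = p' \<inter> q + q'\<close>, which is again a nil subalgebra contained in \<open>r\<close>.

  The inclusion of \<open>p'\<close> in \<open>nil(p)\<close> rests on \<open>D \<inter> Q \<subseteq> [p, p]\<close>: a functional on \<open>g\<close> that kills \<open>[p, p]\<close>
  kills \<open>[g, Q]\<close> because a vector fixed by \<open>p\<close> is fixed by \<open>g\<close>, and then kills \<open>D \<inter> Q\<close> because
  derivations of \<open>g / Q\<close> are inner.
\<close>

text \<open>The obstacle is that nil(p) and the cone of p refer to representations of p, which need
  not extend to g. Two facts control them. An element that is nilpotent in every representation lies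
  in the derived algebra, because one-dimensional representations detect everything else.
  Conversely, an ad-nilpotent element of the derived algebra is nilpotent in every representation.
  So an element of \<open>perp p\<close> (the orthogonal p') has to be shown to lie in [p, p], and
  its part in \<open>D \<inter> Q\<close>, which \<open>\<kappa>\<close> does not see, is the hard
  one.

  Cartan's argument is used in this form: z = sum of [a_i, b_i] is nilpotent once the sum of tr(b_i
  (ad z)^j a_i) vanishes for all large j. If ad z keeps every a_i inside a space orthogonal to all
  b_i, the condition is automatic. It involves traces only, so it survives extension of scalars, and
  the algebraic closure enters nowhere else. No roots, Levi complements or Cartan subalgebras occur,
  so nothing has to be split over the ground field.\<close>

subsection \<open>Finite dimensional subspaces\<close>

text \<open>
  A locale of its own: constants defined in \<^locale>\<open>vector_space\<close> itself would be shadowed by their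
  instances for the global interpretation at real vector spaces.
\<close>
locale vspace = vector_space scale for scale :: "'a::field \<Rightarrow> 'b::ab_group_add \<Rightarrow> 'b"
begin

definition lin_on :: "'b set \<Rightarrow> ('b \<Rightarrow> 'b) \<Rightarrow> bool" where
  "lin_on V T \<longleftrightarrow> (\<forall>v\<in>V. \<forall>w\<in>V. T (v + w) = T v + T w) \<and> (\<forall>c. \<forall>v\<in>V. T (scale c v) = scale c (T v))"

definition functional :: "('b \<Rightarrow> 'a) \<Rightarrow> bool" where
  "functional f \<longleftrightarrow> (\<forall>v w. f (v + w) = f v + f w) \<and> (\<forall>c v. f (scale c v) = c * f v)"

lemma lin_onD:
  fixes v w :: 'b
  assumes "lin_on V T" "v \<in> V"
  shows "w \<in> V \<Longrightarrow> T (v + w) = T v + T w" "T (scale c v) = scale c (T v)"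
  using assms by (auto simp: lin_on_def)

lemma functionalD:
  fixes v w :: 'b
  assumes "functional f"
  shows "f (v + w) = f v + f w" "f (scale c v) = c * f v" "f 0 = 0" "f (v - w) = f v - f w"
    "f (- v) = - f v"
proof -
  show a: "f (v + w) = f v + f w" for v w using assms by (simp add: functional_def)
  show s: "f (scale c v) = c * f v" for c v using assms by (simp add: functional_def)
  show z: "f 0 = 0" using s[of 0 0] by simp
  show m: "f (- v) = - f v" for v using s[of "-1" v] by simp
  show "f (v - w) = f v - f w" using a[of v "- w"] m[of w] by simp
qed

lemma functional_sum:
  assumes "functional f" shows "f (sum h I) = (\<Sum>i\<in>I. f (h i))"
  by (induction I rule: infinite_finite_induct) (auto simp: functionalD[OF assms])

lemma lin_on_0: "lin_on V T \<Longrightarrow> 0 \<in> V \<Longrightarrow> T 0 = 0"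
  using lin_onD(2)[of V T 0 0] by simp

lemma lin_on_subset: "lin_on V T \<Longrightarrow> W \<subseteq> V \<Longrightarrow> lin_on W T"
  unfolding lin_on_def by blast

lemma lin_on_diff:
  assumes "lin_on V T" "subspace V" "v \<in> V" "w \<in> V"
  shows "T (v - w) = T v - T w"
  using lin_onD(1)[OF assms(1), of "v - w" w] assms by (simp add: subspace_diff eq_diff_eq)

lemma lin_on_sum:
  assumes "lin_on V T" "subspace V" "\<And>i. i \<in> I \<Longrightarrow> h i \<in> V"
  shows "T (sum h I) = (\<Sum>i\<in>I. T (h i))"
  using assms(3)
proof (induction I rule: infinite_finite_induct)
  case (insert x F)
  then have "T (h x + sum h F) = T (h x) + T (sum h F)"
    by (intro lin_onD(1)[OF assms(1)]) (auto intro: subspace_sum assms(2))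
  then show ?case using insert by simp
qed (auto simp: lin_on_0[OF assms(1)] subspace_0[OF assms(2)])

lemma ex_projection:
  assumes "subspace W"
  shows "\<exists>P. lin_on UNIV P \<and> range P \<subseteq> W \<and> (\<forall>w\<in>W. P w = w)"
proof -
  interpret p: vector_space_pair scale scale ..
  have "Vector_Spaces.linear scale scale (\<lambda>v. v)" by (rule linear_id[unfolded id_def])
  from p.linear_exists_left_inverse_on[OF this assms]
  show ?thesis by (auto simp: Vector_Spaces.linear_iff lin_on_def)
qed

lemma ex_functional:
  assumes "subspace W" "y \<notin> W"
  shows "\<exists>f. functional f \<and> (\<forall>w\<in>W. f w = 0) \<and> f y = 1"
proof -
  interpret p: vector_space_pair scale "(*)" by unfold_locales (auto simp: algebra_simps)
  obtain C where C: "C \<subseteq> W" "independent C" "W \<subseteq> span C"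
    by (rule maximal_independent_subset)
  have W: "W = span C" using C span_minimal[OF C(1) assms(1)] by auto
  have "independent (insert y C)" using C(2) assms(2) W by (intro independent_insertI) auto
  from p.linear_independent_extend[OF this, of "\<lambda>x. if x = y then 1 else 0"]
  obtain f where f: "Vector_Spaces.linear scale (*) f" "\<forall>x\<in>insert y C. f x = (if x = y then 1 else 0)"
    by blast
  have fn: "functional f" using f(1) by (auto simp: Vector_Spaces.linear_iff functional_def)
  have "f w = 0" if "w \<in> span C" for w
    using that
  proof (induction rule: span_induct_alt)
    case (step c x z)
    then have "x \<noteq> y" using assms(2) C(1) by auto
    then show ?case using step f(2) by (simp add: functionalD[OF fn])
  qed (simp add: functionalD[OF fn])
  then show ?thesis using fn f(2) W by auto
qed

lemma fin_dim_basis: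
  assumes "fin_dim scale V"
  shows "\<exists>B. finite B \<and> independent B \<and> span B = V"
proof -
  obtain F where F: "finite F" "V = span F" using assms by (auto simp: fin_dim_def)
  obtain B where "B \<subseteq> F" "independent B" "F \<subseteq> span B" by (rule maximal_independent_subset)
  then show ?thesis using F span_mono[of B F] span_minimal[of F "span B"] finite_subset by blast
qed

lemma fin_dim_subspace_carrier: "fin_dim scale V \<Longrightarrow> subspace V"
  using fin_dim_basis subspace_span by metis

lemma fin_dim_subspace:
  assumes "fin_dim scale V" "subspace W" "W \<subseteq> V"
  shows "fin_dim scale W"
proof -
  obtain B where B: "finite B" "span B = V" using fin_dim_basis[OF assms(1)] by blast
  obtain C where C: "C \<subseteq> W" "independent C" "W \<subseteq> span C"
    by (rule maximal_independent_subset)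
  have "W = span C" using C span_minimal[OF C(1) assms(2)] by auto
  moreover have "finite C" using independent_span_bound[OF B(1) C(2)] C(1) assms(3) B(2) by auto
  ultimately show ?thesis unfolding fin_dim_def by blast
qed

lemma dim_subspace_mono:
  assumes "fin_dim scale V" "subspace W" "W \<subseteq> V"
  shows "dim W \<le> dim V"
proof -
  obtain B where B: "finite B" "independent B" "span B = W"
    using fin_dim_basis fin_dim_subspace assms by metis
  obtain F where F: "finite F" "independent F" "span F = V" using fin_dim_basis[OF assms(1)] by blast
  have "card B \<le> card F" using independent_span_bound[OF F(1) B(2)] F B assms(3) span_superset by blast
  then show ?thesis
    using B F by (simp flip: F(3) B(3) add: dim_eq_card_independent)
qed

lemma subspace_dim_less:
  assumes "fin_dim scale V" "subspace W" "subspace W'" "W \<subset> W'" "W' \<subseteq> V"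
  shows "dim W < dim W'"
proof -
  obtain B where B: "finite B" "independent B" "span B = W"
    using fin_dim_basis fin_dim_subspace assms by (metis psubset_imp_subset subset_trans)
  obtain B' where B': "finite B'" "independent B'" "span B' = W'"
    using fin_dim_basis fin_dim_subspace assms by metis
  obtain y where y: "y \<in> W'" "y \<notin> W" using assms(4) by blast
  have "independent (insert y B)" using B y by (intro independent_insertI) auto
  moreover have "insert y B \<subseteq> span B'" using B' B y assms(4) span_superset by blast
  ultimately have "card (insert y B) \<le> card B'" using independent_span_bound[OF B'(1)] by blast
  moreover have "y \<notin> B" using y B span_superset by blast
  ultimately show "dim W < dim W'"
    using B B' by (simp flip: B(3) B'(3) add: dim_eq_card_independent)
qed

text \<open>Dimensions of subspaces of V are bounded, so a member of largest dimension above W is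
  maximal. This serves for nil subalgebras, for ideals, for invariant subspaces and in Engel's
  theorem.\<close>

lemma ex_maximal_subspace:
  assumes V: "fin_dim scale V" and PW: "P W" and P: "\<And>W. P W \<Longrightarrow> subspace W \<and> W \<subseteq> V"
  shows "\<exists>M. P M \<and> W \<subseteq> M \<and> (\<forall>N. P N \<longrightarrow> M \<subseteq> N \<longrightarrow> N = M)"
proof -
  have "dim W \<le> dim V" if "P W" for W
    using dim_subspace_mono[OF V] P[OF that] by blast
  then have "\<forall>M. (P M \<and> W \<subseteq> M) \<longrightarrow> dim M < Suc (dim V)" by (simp add: less_Suc_eq_le)
  from ex_has_greatest_nat[OF conjI[OF PW order_refl] this]
  obtain M where M: "P M" "W \<subseteq> M" "\<And>N. P N \<Longrightarrow> W \<subseteq> N \<Longrightarrow> dim N \<le> dim M" by auto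
  have "N = M" if "P N" "M \<subseteq> N" for N
    using subspace_dim_less[OF V, of M N] M that P by (metis leD psubsetI subset_trans)
  then show ?thesis using M by blast
qed

lemma subspace_lin_image:
  assumes "lin_on V T" "subspace V" shows "subspace (T ` V)"
  unfolding subspace_def
proof (intro conjI ballI allI)
  show "0 \<in> T ` V" using lin_on_0[OF assms(1)] subspace_0[OF assms(2)] by (metis imageI)
next
  fix x y assume "x \<in> T ` V" "y \<in> T ` V"
  then obtain v w where "v \<in> V" "w \<in> V" "x = T v" "y = T w" by blast
  then show "x + y \<in> T ` V"
    using lin_onD(1)[OF assms(1), of v w] subspace_add[OF assms(2)] by (metis imageI)
next
  fix c x assume "x \<in> T ` V"
  then obtain v where "v \<in> V" "x = T v" by blast
  then show "scale c x \<in> T ` V"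
    using lin_onD(2)[OF assms(1), of v c] subspace_scale[OF assms(2)] by (metis imageI)
qed

text \<open>The map that T induces on g / h is injective, hence surjective by dimension. The
  quotient is realised on a complement \<open>U\<close> of h, with \<open>\<pi>\<close> as the
  quotient map.\<close>

lemma inj_imp_surj_mod:
  assumes g: "fin_dim scale g" and h: "subspace h" "h \<subseteq> g" and T: "lin_on g T"
    and Tg: "\<And>x. x \<in> g \<Longrightarrow> T x \<in> g" and Th: "\<And>x. x \<in> h \<Longrightarrow> T x \<in> h"
    and inj: "\<And>x. x \<in> g \<Longrightarrow> T x \<in> h \<Longrightarrow> x \<in> h" and y: "y \<in> g"
  shows "\<exists>x\<in>g. y - T x \<in> h"
proof -
  have sg: "subspace g" using fin_dim_subspace_carrier[OF g] .
  obtain P where P: "lin_on UNIV P" "range P \<subseteq> h" "\<forall>w\<in>h. P w = w"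
    using ex_projection[OF h(1)] by blast
  obtain Pg where Pg: "lin_on UNIV Pg" "range Pg \<subseteq> g" "\<forall>w\<in>g. Pg w = w"
    using ex_projection[OF sg] by blast
  define \<pi> where "\<pi> x = x - P x" for x
  \<comment> \<open>T is linear on g only; precomposing with the projection \<open>Pg\<close> gives
    a map that is linear on the whole type.\<close>
  define S where "S x = \<pi> (T (Pg x))" for x
  have P': "P x \<in> h" "P x \<in> g" "Pg x \<in> g" for x using P(2) Pg(2) h by auto
  have lin_\<pi>: "\<pi> (x + y) = \<pi> x + \<pi> y" "\<pi> (scale c x) = scale c (\<pi> x)" for c x y
    using lin_onD[OF P(1)] by (auto simp: \<pi>_def algebra_simps)
  have \<pi>g: "\<pi> x \<in> g" if "x \<in> g" for x
    unfolding \<pi>_def using that P' by (intro subspace_diff[OF sg])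
  have \<pi>0: "\<pi> x = 0 \<longleftrightarrow> x \<in> h" for x
    unfolding \<pi>_def using P'(1)[of x] P(3) by (metis right_minus_eq)
  have \<pi>\<pi>: "\<pi> (\<pi> x) = \<pi> x" for x
    unfolding \<pi>_def using P'(1)[of x] P(3) lin_on_diff[OF P(1) subspace_UNIV] by auto
  interpret p: vector_space_pair scale scale ..
  have linS: "Vector_Spaces.linear scale scale S"
    unfolding Vector_Spaces.linear_iff S_def
    using lin_onD[OF Pg(1)] lin_onD[OF T] P' lin_\<pi> by (auto simp: vector_space_axioms)
  interpret S: module_hom scale scale S using linS by (simp add: linear_iff_module_hom)
  define U where "U = \<pi> ` g"
  have "lin_on g \<pi>" using lin_\<pi> by (simp add: lin_on_def)
  then have sU: "subspace U" unfolding U_def by (rule subspace_lin_image[OF _ sg])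
  have Ug: "U \<subseteq> g" using \<pi>g by (auto simp: U_def)
  have \<pi>U: "\<pi> u = u" if "u \<in> U" for u using that \<pi>\<pi> by (auto simp: U_def)
  have SU: "S u \<in> U" for u unfolding S_def U_def using Tg P' by auto
  obtain B where B: "finite B" "independent B" "span B = U"
    using fin_dim_basis fin_dim_subspace[OF g sU Ug] by blast
  have "inj_on S (span B)" unfolding B(3)
    unfolding S.inj_on_iff_eq_0[OF sU]
  proof (intro ballI impI)
    fix u assume u: "u \<in> U" "S u = 0"
    then have "u \<in> h" using Ug Pg inj unfolding S_def \<pi>0 by (metis subsetD)
    then show "u = 0" using \<pi>U[OF u(1)] \<pi>0 by metis
  qed
  then have ind: "independent (S ` B)" and injB: "inj_on S B"
    using S.independent_injective_image[OF B(2)] inj_on_subset span_superset by blast+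
  have "\<pi> y \<in> span (S ` B)"
  proof (rule ccontr)
    assume n: "\<pi> y \<notin> span (S ` B)"
    then have "independent (insert (\<pi> y) (S ` B))" by (intro independent_insertI ind)
    moreover have "insert (\<pi> y) (S ` B) \<subseteq> span B" using B(3) SU y by (auto simp: U_def)
    ultimately have "card (insert (\<pi> y) (S ` B)) \<le> card B"
      using independent_span_bound[OF B(1)] by blast
    moreover have "\<pi> y \<notin> S ` B" using n span_superset by blast
    ultimately show False using B(1) injB by (simp add: card_image)
  qed
  then have "\<pi> y \<in> S ` span B" by (simp add: S.span_image)
  then obtain u where u: "u \<in> U" "\<pi> y = S u" using B(3) by auto
  then have "\<pi> y = \<pi> (T u)" using Ug Pg by (auto simp: S_def)
  then have "\<pi> (y - T u) = 0"
    using lin_\<pi>(1)[of "y - T u" "T u"] by simp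
  then show ?thesis using \<pi>0 u Ug by blast
qed

text \<open>The second assumption lets the coefficient of a linear combination be absorbed into the
  first argument. For brackets this writes an element as a plain sum of brackets, the shape that
  Cartan's criterion asks for.\<close>

lemma span_pair_sum:
  assumes "x \<in> span {f a b | a b. a \<in> A \<and> b \<in> B}"
    and "\<And>a c. a \<in> A \<Longrightarrow> \<exists>a'\<in>A. \<forall>b\<in>B. f a' b = scale c (f a b)"
  shows "\<exists>(n::nat) h k. (\<forall>i<n. h i \<in> A \<and> k i \<in> B) \<and> x = (\<Sum>i<n. f (h i) (k i))"
  using assms(1)
proof (induction rule: span_induct_alt)
  case base
  show ?case by (intro exI[of _ 0]) auto
next
  case (step c y z)
  then obtain n h k where *: "\<forall>i<(n::nat). h i \<in> A \<and> k i \<in> B" "z = (\<Sum>i<n. f (h i) (k i))" by blast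
  obtain a b where ab: "a \<in> A" "b \<in> B" "y = f a b" using step by blast
  obtain a' where a': "a' \<in> A" "\<forall>b\<in>B. f a' b = scale c (f a b)" using assms(2)[OF ab(1)] by blast
  show ?case
    by (rule exI[of _ "Suc n"], rule exI[of _ "h(n := a')"], rule exI[of _ "k(n := b)"])
      (use * ab a' in \<open>auto simp: less_Suc_eq add.commute\<close>)
qed


subsection \<open>The trace\<close>

definition trace :: "'b set \<Rightarrow> ('b \<Rightarrow> 'b) \<Rightarrow> 'a" where
  "trace V T = (let B = (SOME B. finite B \<and> independent B \<and> span B = V)
     in \<Sum>b\<in>B. representation B (T b) b)"

lemma representation_lin:
  assumes "finite B" "independent B" "span B = V" "lin_on V T" "\<And>v. v \<in> V \<Longrightarrow> T v \<in> V"
    and C: "\<And>c. c \<in> C \<Longrightarrow> c \<in> V"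
  shows "representation B (T (\<Sum>c\<in>C. scale (u c) c)) b = (\<Sum>c\<in>C. u c * representation B (T c) b)"
proof -
  have V: "subspace V" using assms(3) subspace_span by metis
  have cV: "scale (u c) c \<in> V" if "c \<in> C" for c
    using C[OF that] subspace_scale[OF V] by blast
  have "T (\<Sum>c\<in>C. scale (u c) c) = (\<Sum>c\<in>C. scale (u c) (T c))"
    using lin_on_sum[OF assms(4) V cV, of C] lin_onD(2)[OF assms(4) C] by simp
  moreover have "T c \<in> span B" if "c \<in> C" for c using C[OF that] assms(3,5) by simp
  ultimately show ?thesis
    using representation_sum[OF assms(2), of C "\<lambda>c. scale (u c) (T c)"]
    by (simp add: span_scale representation_scale[OF assms(2)])
qed

lemma representation_sum_all:
  assumes "finite B" "independent B" "v \<in> span B"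
  shows "(\<Sum>b\<in>B. scale (representation B v b) b) = v"
  using sum_representation_eq[OF assms(2,3) assms(1) order_refl] .

text \<open>Expand b in the basis C on the left and T c in the basis B on the right: both sides
  become the same double sum over B and C.\<close>

lemma trace_basis_indep:
  assumes B: "finite B" "independent B" "span B = V"
    and C: "finite C" "independent C" "span C = V"
    and T: "lin_on V T" "\<And>v. v \<in> V \<Longrightarrow> T v \<in> V"
  shows "(\<Sum>b\<in>B. representation B (T b) b) = (\<Sum>c\<in>C. representation C (T c) c)"
proof -
  have inV: "b \<in> V" if "b \<in> B \<union> C" for b using that B C span_superset by blast
  have id: "lin_on V (\<lambda>v. v)" by (simp add: lin_on_def)
  have "(\<Sum>b\<in>B. representation B (T b) b)
      = (\<Sum>b\<in>B. \<Sum>c\<in>C. representation C b c * representation B (T c) b)"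
  proof (rule sum.cong[OF refl])
    fix b assume b: "b \<in> B"
    have "b = (\<Sum>c\<in>C. scale (representation C b c) c)"
      using representation_sum_all[OF C(1,2), of b] inV b C by auto
    then have "representation B (T b) b
       = representation B (T (\<Sum>c\<in>C. scale (representation C b c) c)) b" by simp
    also have "\<dots> = (\<Sum>c\<in>C. representation C b c * representation B (T c) b)"
      by (rule representation_lin[OF B T]) (use inV in auto)
    finally show "representation B (T b) b = \<dots>" .
  qed
  also have "\<dots> = (\<Sum>c\<in>C. \<Sum>b\<in>B. representation B (T c) b * representation C b c)"
    by (subst sum.swap) (simp add: mult.commute)
  also have "\<dots> = (\<Sum>c\<in>C. representation C (T c) c)"
  proof (rule sum.cong[OF refl])
    fix c assume c: "c \<in> C"
    have "T c = (\<Sum>b\<in>B. scale (representation B (T c) b) b)"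
      using representation_sum_all[OF B(1,2), of "T c"] inV T c B by auto
    then have "representation C (T c) c
      = representation C ((\<lambda>v. v) (\<Sum>b\<in>B. scale (representation B (T c) b) b)) c" by simp
    also have "\<dots> = (\<Sum>b\<in>B. representation B (T c) b * representation C b c)"
      by (rule representation_lin[OF C id]) (use inV in auto)
    finally show "(\<Sum>b\<in>B. representation B (T c) b * representation C b c) = representation C (T c) c"
      by simp
  qed
  finally show ?thesis .
qed

lemma trace_eq:
  assumes "finite B" "independent B" "span B = V" "lin_on V T" "\<And>v. v \<in> V \<Longrightarrow> T v \<in> V"
  shows "trace V T = (\<Sum>b\<in>B. representation B (T b) b)"
proof -
  let ?P = "\<lambda>B. finite B \<and> independent B \<and> span B = V"
  have "?P (SOME B. ?P B)" using assms by (intro someI[of ?P B]) auto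
  then show ?thesis unfolding trace_def Let_def
    using trace_basis_indep[of "SOME B. ?P B" V B T] assms by blast
qed

lemma trace_basis:
  assumes "fin_dim scale V"
  obtains B where "finite B" "independent B" "span B = V"
    "\<And>T. trace V T = (\<Sum>b\<in>B. representation B (T b) b)"
proof -
  let ?P = "\<lambda>B. finite B \<and> independent B \<and> span B = V"
  have "?P (SOME B. ?P B)" using fin_dim_basis[OF assms] by (rule someI_ex)
  then show ?thesis using that[of "SOME B. ?P B"] by (auto simp: trace_def Let_def)
qed

lemma trace_cong:
  assumes "fin_dim scale V" "\<And>v. v \<in> V \<Longrightarrow> T v = S v"
  shows "trace V T = trace V S"
proof -
  obtain B where B: "finite B" "independent B" "span B = V"
    and tr: "\<And>T. trace V T = (\<Sum>b\<in>B. representation B (T b) b)"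
    by (rule trace_basis[OF assms(1)]) (rule that, assumption+)
  have "T b = S b" if "b \<in> B" for b using assms(2) that B(3) span_base by blast
  then show ?thesis unfolding tr by simp
qed

lemma trace_add:
  assumes "fin_dim scale V" "\<And>v. v \<in> V \<Longrightarrow> T v \<in> V" "\<And>v. v \<in> V \<Longrightarrow> S v \<in> V"
  shows "trace V (\<lambda>v. T v + S v) = trace V T + trace V S"
proof -
  obtain B where B: "finite B" "independent B" "span B = V"
    and tr: "\<And>T. trace V T = (\<Sum>b\<in>B. representation B (T b) b)"
    by (rule trace_basis[OF assms(1)]) (rule that, assumption+)
  have "T b \<in> span B" "S b \<in> span B" if "b \<in> B" for b
    using assms(2,3) that B(3) span_base by blast+
  then show ?thesis unfolding tr sum.distrib[symmetric]
    by (intro sum.cong refl) (simp add: representation_add[OF B(2)])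
qed

lemma trace_scale:
  assumes "fin_dim scale V" "\<And>v. v \<in> V \<Longrightarrow> T v \<in> V"
  shows "trace V (\<lambda>v. scale c (T v)) = c * trace V T"
proof -
  obtain B where B: "finite B" "independent B" "span B = V"
    and tr: "\<And>T. trace V T = (\<Sum>b\<in>B. representation B (T b) b)"
    by (rule trace_basis[OF assms(1)]) (rule that, assumption+)
  have "T b \<in> span B" if "b \<in> B" for b
    using assms(2) that B(3) span_base by blast
  then show ?thesis unfolding tr sum_distrib_left
    by (intro sum.cong refl) (simp add: representation_scale[OF B(2)])
qed

lemma trace_comp_commute:
  assumes V: "fin_dim scale V" and T: "lin_on V T" "\<And>v. v \<in> V \<Longrightarrow> T v \<in> V"
    and S: "lin_on V S" "\<And>v. v \<in> V \<Longrightarrow> S v \<in> V"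
  shows "trace V (\<lambda>v. T (S v)) = trace V (\<lambda>v. S (T v))"
proof -
  obtain B where B: "finite B" "independent B" "span B = V" using fin_dim_basis[OF V] by blast
  have inV: "b \<in> V" if "b \<in> B" for b using that B span_superset by blast
  have key: "(\<Sum>b\<in>B. representation B (T (S b)) b)
      = (\<Sum>b\<in>B. \<Sum>c\<in>B. representation B (S b) c * representation B (T c) b)"
    if "lin_on V T" "\<And>v. v \<in> V \<Longrightarrow> T v \<in> V" "\<And>v. v \<in> V \<Longrightarrow> S v \<in> V" for T S
  proof (rule sum.cong[OF refl])
    fix b assume b: "b \<in> B"
    have "S b = (\<Sum>c\<in>B. scale (representation B (S b) c) c)"
      using representation_sum_all[OF B(1,2), of "S b"] inV that b B by auto
    then have "representation B (T (S b)) b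
       = representation B (T (\<Sum>c\<in>B. scale (representation B (S b) c) c)) b" by simp
    also have "\<dots> = (\<Sum>c\<in>B. representation B (S b) c * representation B (T c) b)"
      by (rule representation_lin[OF B that(1,2)]) (use inV in auto)
    finally show "representation B (T (S b)) b = \<dots>" .
  qed
  have lin: "lin_on V (\<lambda>v. T (S v))" if "lin_on V T" "lin_on V S" "\<And>v. v \<in> V \<Longrightarrow> S v \<in> V" for T S
    using that by (auto simp: lin_on_def)
  have "trace V (\<lambda>v. T (S v)) = (\<Sum>b\<in>B. \<Sum>c\<in>B. representation B (S b) c * representation B (T c) b)"
    by (subst trace_eq[OF B lin]) (use T S key in auto)
  also have "\<dots> = (\<Sum>b\<in>B. \<Sum>c\<in>B. representation B (T b) c * representation B (S c) b)"
    by (subst sum.swap) (simp add: mult.commute)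
  also have "\<dots> = trace V (\<lambda>v. S (T v))"
    by (subst trace_eq[OF B lin]) (use T S key in auto)
  finally show ?thesis .
qed

lemma trace_restrict:
  assumes V: "fin_dim scale V" and T: "lin_on V T" "\<And>v. v \<in> V \<Longrightarrow> T v \<in> W"
    and W: "subspace W" "W \<subseteq> V"
  shows "trace V T = trace W T"
proof -
  obtain C where C: "finite C" "independent C" "span C = W"
    using fin_dim_basis[OF fin_dim_subspace[OF V W]] by blast
  have CV: "C \<subseteq> V" using C W span_superset by blast
  obtain B where B: "C \<subseteq> B" "B \<subseteq> V" "independent B" "V \<subseteq> span B"
    by (rule maximal_independent_subset_extend[OF CV C(2)])
  have sV: "subspace V" using fin_dim_subspace_carrier[OF V] .
  have BV: "span B = V" using B span_minimal[OF B(2) sV] by auto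
  obtain F where F: "finite F" "span F = V" using fin_dim_basis[OF V] by blast
  have fB: "finite B" using independent_span_bound[OF F(1) B(3)] B(2) F(2) by blast
  have rep: "representation B (T b) = representation C (T b)" if "b \<in> B" for b
  proof -
    have "T b \<in> span C" using T B C that by auto
    then show ?thesis using representation_extend[OF B(3) _ B(1)] by blast
  qed
  have "trace V T = (\<Sum>b\<in>B. representation B (T b) b)"
    by (rule trace_eq[OF fB B(3) BV T(1)]) (use T W in auto)
  also have "\<dots> = (\<Sum>b\<in>B. representation C (T b) b)" by (intro sum.cong) (simp_all add: rep)
  also have "\<dots> = (\<Sum>b\<in>C. representation C (T b) b)"
    by (rule sum.mono_neutral_right[OF fB B(1)]) (use representation_ne_zero in blast)
  also have "\<dots> = trace W T"
    by (rule trace_eq[OF C(1,2,3), symmetric]) (use lin_on_subset[OF T(1) W(2)] T W in auto)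
  finally show ?thesis .
qed

lemma trace_nilpotent:
  assumes V: "fin_dim scale V" and T: "lin_on V T" "\<And>v. v \<in> V \<Longrightarrow> T v \<in> V"
    and nil: "\<And>v. v \<in> V \<Longrightarrow> (T ^^ m) v = 0"
  shows "trace V T = 0"
  using assms
proof (induction m arbitrary: V)
  case 0
  then have "V = {0}" using fin_dim_subspace_carrier[OF "0.prems"(1)] subspace_0 by force
  then have "finite {} \<and> independent {} \<and> span {} = V" by (simp add: independent_empty)
  then show ?case using trace_eq[of "{}" V T] 0 by simp
next
  case (Suc m)
  have sV: "subspace V" using fin_dim_subspace_carrier[OF Suc.prems(1)] .
  have s: "subspace (T ` V)" "T ` V \<subseteq> V"
    using subspace_lin_image[OF Suc.prems(2) sV] Suc.prems(3) by auto
  have "trace V T = trace (T ` V) T"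
    by (rule trace_restrict[OF Suc.prems(1,2) _ s]) auto
  also have "\<dots> = 0"
  proof (rule Suc.IH)
    show "fin_dim scale (T ` V)" by (rule fin_dim_subspace[OF Suc.prems(1) s])
    show "lin_on (T ` V) T" by (rule lin_on_subset[OF Suc.prems(2) s(2)])
    show "T v \<in> T ` V" if "v \<in> T ` V" for v using that s(2) by auto
    show "(T ^^ m) v = 0" if "v \<in> T ` V" for v
      using that Suc.prems(4) by (auto simp: funpow_Suc_right simp del: funpow.simps)
  qed
  finally show ?case .
qed

text \<open>T is the identity on its image, so its trace is the dimension of the image. That this is
  a natural number supplies the nonnegative weights in the sum of squares behind Cartan's
  criterion.\<close>

lemma trace_idempotent:
  assumes V: "fin_dim scale V" and T: "lin_on V T" "\<And>v. v \<in> V \<Longrightarrow> T v \<in> V"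
    and id: "\<And>v. v \<in> V \<Longrightarrow> T (T v) = T v"
  shows "\<exists>n. trace V T = of_nat n \<and> (n = 0 \<longrightarrow> (\<forall>v\<in>V. T v = 0))"
proof -
  have sV: "subspace V" using fin_dim_subspace_carrier[OF V] .
  have s: "subspace (T ` V)" "T ` V \<subseteq> V"
    using subspace_lin_image[OF T(1) sV] T(2) by auto
  have f: "fin_dim scale (T ` V)" by (rule fin_dim_subspace[OF V s])
  obtain B where B: "finite B" "independent B" "span B = T ` V"
    using fin_dim_basis[OF f] by blast
  have "trace V T = trace (T ` V) T"
    by (rule trace_restrict[OF V T(1) _ s]) auto
  also have "\<dots> = trace (T ` V) (\<lambda>v. v)"
  proof (rule trace_cong[OF f])
    fix v assume "v \<in> T ` V"
    then obtain w where "w \<in> V" "v = T w" by blast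
    then show "T v = v" using id[of w] by simp
  qed
  also have "\<dots> = (\<Sum>b\<in>B. representation B b b)"
    by (rule trace_eq[OF B(1) B(2) B(3)]) (simp_all add: lin_on_def)
  also have "\<dots> = (\<Sum>b\<in>B. 1)"
    by (rule sum.cong[OF refl]) (simp add: representation_basis[OF B(2)])
  also have "\<dots> = of_nat (card B)" by simp
  finally have "trace V T = of_nat (card B)" .
  moreover have "T v = 0" if "v \<in> V" and "card B = 0" for v
  proof -
    have "span {} = T ` V" using that(2) B(1,3) by simp
    then have "T v \<in> span {}" using that(1) by blast
    then show ?thesis by (simp only: span_empty singleton_iff)
  qed
  ultimately show ?thesis by (intro exI[of _ "card B"] conjI impI ballI)
qed

end

subsection \<open>The ring of additive endomorphisms\<close>

text \<open>Linearity depends on a scale, which a type cannot mention, so the type collects all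
  additive maps. Operators on operators, such as multiplication from the left, then live in the same
  type one level up.\<close>

typedef (overloaded) ('v::ab_group_add) endo = "{f :: 'v \<Rightarrow> 'v. \<forall>x y. f (x + y) = f x + f y}"
  morphisms app Abs_endo
  by (intro exI[of _ "\<lambda>x. x"]) simp

setup_lifting type_definition_endo

lemma app_add_right: "app T (x + y) = app T x + app T y"
  using app[of T] by simp

lemma app_0_right [simp]: "app T 0 = 0"
  using app_add_right[of T 0 0] by simp

lemma app_sum_right: "app T (sum h I) = (\<Sum>i\<in>I. app T (h i))"
  by (induction I rule: infinite_finite_induct) (simp_all add: app_add_right)

lemma endo_eqI: "(\<And>v. app T v = app S v) \<Longrightarrow> T = S"
  by (metis app_inject ext)

text \<open>Not an instance of \<^class>\<open>ring_1\<close>, because the underlying group may be trivial.\<close>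
instantiation endo :: (ab_group_add) "{ring, monoid_mult}"
begin

lift_definition zero_endo :: "'a endo" is "\<lambda>_. 0" by simp
lift_definition one_endo :: "'a endo" is "\<lambda>v. v" by simp
lift_definition plus_endo :: "'a endo \<Rightarrow> 'a endo \<Rightarrow> 'a endo" is "\<lambda>f g v. f v + g v"
  by (simp add: algebra_simps)
lift_definition minus_endo :: "'a endo \<Rightarrow> 'a endo \<Rightarrow> 'a endo" is "\<lambda>f g v. f v - g v"
  by (simp add: algebra_simps)
lift_definition uminus_endo :: "'a endo \<Rightarrow> 'a endo" is "\<lambda>f v. - f v"
  by (simp add: algebra_simps)
lift_definition times_endo :: "'a endo \<Rightarrow> 'a endo \<Rightarrow> 'a endo" is "\<lambda>f g v. f (g v)"
  by simp

instance
  by standard (transfer; simp add: algebra_simps fun_eq_iff)+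

end

lemma app_simps [simp]:
  "app 0 v = 0" "app 1 v = v" "app (S + T) v = app S v + app T v"
  "app (S - T) v = app S v - app T v" "app (- S) v = - app S v"
  "app (S * T) v = app S (app T v)"
  by (transfer; simp)+

lemma app_power: "app (T ^ n) v = (app T ^^ n) v"
  by (induction n arbitrary: v) simp_all

lemma app_sum: "app (sum h I) v = (\<Sum>i\<in>I. app (h i) v)"
  by (induction I rule: infinite_finite_induct) simp_all

lemma power_swap: "(T::'v::ab_group_add endo) * T ^ n = T ^ n * T"
  by (simp add: power_commutes)

context vspace
begin

definition escale :: "'a \<Rightarrow> 'b endo \<Rightarrow> 'b endo" where
  "escale c T = Abs_endo (\<lambda>v. scale c (app T v))"

lemma app_escale [simp]: "app (escale c T) v = scale c (app T v)"
  unfolding escale_def by (subst Abs_endo_inverse) (simp_all add: app_add_right scale_right_distrib)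

lemma vspace_escale: "vspace escale"
  by unfold_locales (auto intro!: endo_eqI simp: scale_right_distrib scale_left_distrib)

lemma escale_mult_left: "escale c S * T = escale c (S * T)"
  by (rule endo_eqI) simp

text \<open>An operator on V is represented by a linear map of the whole type with values in V, for
  instance its composite with a projection onto V. The identity of the whole type is then only in
  \<open>Lin UNIV\<close>, which is where polynomials in an operator are formed.\<close>

definition Lin :: "'b set \<Rightarrow> 'b endo set" where
  "Lin V = {T. (\<forall>c v. app T (scale c v) = scale c (app T v)) \<and> (\<forall>v. app T v \<in> V)}"

lemma Lin_scale: "T \<in> Lin V \<Longrightarrow> app T (scale c v) = scale c (app T v)"
  and Lin_in: "T \<in> Lin V \<Longrightarrow> app T v \<in> V"
  by (auto simp: Lin_def)

lemma Lin_UNIV: "T \<in> Lin V \<Longrightarrow> T \<in> Lin UNIV"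
  by (auto simp: Lin_def)

lemma Lin_1: "1 \<in> Lin UNIV"
  by (simp add: Lin_def)

lemma Lin_escale_mult: "S \<in> Lin V \<Longrightarrow> S * escale c T = escale c (S * T)"
  by (rule endo_eqI) (simp add: Lin_scale)

lemma
  assumes "subspace V"
  shows Lin_0: "0 \<in> Lin V"
    and Lin_add: "S \<in> Lin V \<Longrightarrow> T \<in> Lin V \<Longrightarrow> S + T \<in> Lin V"
    and Lin_diff: "S \<in> Lin V \<Longrightarrow> T \<in> Lin V \<Longrightarrow> S - T \<in> Lin V"
    and Lin_minus: "S \<in> Lin V \<Longrightarrow> - S \<in> Lin V"
    and Lin_escale: "S \<in> Lin V \<Longrightarrow> escale c S \<in> Lin V"
  using subspace_0[OF assms] subspace_add[OF assms] subspace_diff[OF assms] subspace_neg[OF assms]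
    subspace_scale[OF assms]
  by (auto simp: Lin_def algebra_simps)

lemma Lin_mult: "S \<in> Lin V \<Longrightarrow> T \<in> Lin UNIV \<Longrightarrow> S * T \<in> Lin V"
  by (auto simp: Lin_def)

lemma Lin_mult': "S \<in> Lin V \<Longrightarrow> T \<in> Lin V \<Longrightarrow> S * T \<in> Lin V"
  by (auto simp: Lin_def)

lemma Lin_sum: "subspace V \<Longrightarrow> (\<And>i. i \<in> I \<Longrightarrow> h i \<in> Lin V) \<Longrightarrow> sum h I \<in> Lin V"
  by (induction I rule: infinite_finite_induct) (auto intro: Lin_0 Lin_add)

lemma Lin_power: "T \<in> Lin UNIV \<Longrightarrow> T ^ n \<in> Lin UNIV"
  by (induction n) (auto intro: Lin_1 Lin_mult)

lemma lin_on_app: "T \<in> Lin V \<Longrightarrow> lin_on W (app T)"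
  by (auto simp: lin_on_def app_add_right Lin_scale)

definition tr :: "'b set \<Rightarrow> 'b endo \<Rightarrow> 'a" where
  "tr V T = trace V (app T)"

lemma tr_add:
  assumes "fin_dim scale V" "S \<in> Lin V" "T \<in> Lin V"
  shows "tr V (S + T) = tr V S + tr V T"
proof -
  have "app (S + T) = (\<lambda>v. app S v + app T v)" by (rule ext) simp
  then show ?thesis unfolding tr_def
    using trace_add[OF assms(1) Lin_in[OF assms(2)] Lin_in[OF assms(3)]] by (simp only:)
qed

lemma tr_scale:
  assumes "fin_dim scale V" "S \<in> Lin V"
  shows "tr V (escale c S) = c * tr V S"
proof -
  have "app (escale c S) = (\<lambda>v. scale c (app S v))" by (rule ext) simp
  then show ?thesis unfolding tr_def
    using trace_scale[OF assms(1) Lin_in[OF assms(2)]] by (simp only:)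
qed

lemma tr_0: "fin_dim scale V \<Longrightarrow> tr V 0 = 0"
proof -
  assume V: "fin_dim scale V"
  have "0 = escale 0 (0 :: 'b endo)" by (rule endo_eqI) simp
  then show ?thesis using tr_scale[OF V Lin_0[OF fin_dim_subspace_carrier[OF V]], of 0] by simp
qed

lemma tr_minus: "fin_dim scale V \<Longrightarrow> S \<in> Lin V \<Longrightarrow> tr V (- S) = - tr V S"
proof -
  assume *: "fin_dim scale V" "S \<in> Lin V"
  have "- S = escale (-1) S" by (rule endo_eqI) simp
  then show ?thesis using tr_scale[OF *, of "-1"] by simp
qed

lemma tr_diff:
  assumes "fin_dim scale V" "S \<in> Lin V" "T \<in> Lin V"
  shows "tr V (S - T) = tr V S - tr V T"
  using tr_add[OF assms(1,2) Lin_minus[OF fin_dim_subspace_carrier[OF assms(1)] assms(3)]]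
    tr_minus[OF assms(1,3)] by simp

lemma tr_sum: "fin_dim scale V \<Longrightarrow> (\<And>i. i \<in> I \<Longrightarrow> h i \<in> Lin V) \<Longrightarrow> tr V (sum h I) = (\<Sum>i\<in>I. tr V (h i))"
proof (induction I rule: infinite_finite_induct)
  case (insert x F)
  then show ?case
    using tr_add[OF insert.prems(1), of "h x" "sum h F"] Lin_sum[OF fin_dim_subspace_carrier, of V F h]
    by simp
qed (auto simp: tr_0)

lemma tr_commute:
  assumes "fin_dim scale V" "S \<in> Lin V" "T \<in> Lin V"
  shows "tr V (S * T) = tr V (T * S)"
proof -
  have "app (S * T) = (\<lambda>v. app S (app T v))" "app (T * S) = (\<lambda>v. app T (app S v))"
    by (rule ext, simp)+
  then show ?thesis unfolding tr_def
    using trace_comp_commute[OF assms(1) lin_on_app[OF assms(2)] Lin_in[OF assms(2)]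
      lin_on_app[OF assms(3)] Lin_in[OF assms(3)]] by simp
qed

lemma tr_nilpotent:
  assumes "fin_dim scale V" "T \<in> Lin V" "T ^ m = 0"
  shows "tr V T = 0"
  unfolding tr_def
proof (rule trace_nilpotent[OF assms(1) lin_on_app[OF assms(2)] Lin_in[OF assms(2)]])
  show "(app T ^^ m) v = 0" for v
    unfolding app_power[symmetric] assms(3) by simp
qed

lemma tr_idempotent:
  assumes "fin_dim scale V" "T \<in> Lin V" "T * T = T"
  shows "\<exists>n. tr V T = of_nat n \<and> (n = 0 \<longrightarrow> T = 0)"
proof -
  have TT: "app T (app T v) = app T v" for v using arg_cong[OF assms(3), of "\<lambda>S. app S v"] by simp
  obtain n where n: "trace V (app T) = of_nat n" "n = 0 \<longrightarrow> (\<forall>v\<in>V. app T v = 0)"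
    by (rule exE[OF trace_idempotent[OF assms(1) lin_on_app[OF assms(2)] Lin_in[OF assms(2)] TT]])
      (elim conjE, rule that)
  have "T = 0" if "n = 0"
  proof (rule endo_eqI)
    fix v show "app T v = app 0 v" using n(2) that TT[of v] Lin_in[OF assms(2), of v] by simp
  qed
  then show ?thesis unfolding tr_def by (intro exI[of _ n] conjI impI n(1))
qed

section \<open>Polynomials in an operator\<close>

definition peval :: "'a poly \<Rightarrow> 'b endo \<Rightarrow> 'b endo" where
  "peval p T = (\<Sum>i\<le>degree p. escale (coeff p i) (T ^ i))"

lemma peval_eq:
  assumes "degree p \<le> n"
  shows "peval p T = (\<Sum>i\<le>n. escale (coeff p i) (T ^ i))"
proof -
  interpret E: vspace escale by (rule vspace_escale)
  show ?thesis unfolding peval_def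
    by (rule sum.mono_neutral_left) (use assms in \<open>auto simp: coeff_eq_0\<close>)
qed

lemma peval_add: "peval (p + q) T = peval p T + peval q T"
proof -
  interpret E: vspace escale by (rule vspace_escale)
  let ?n = "max (degree p) (degree q)"
  have "degree (p + q) \<le> ?n" by (rule degree_add_le_max)
  then show ?thesis
    using peval_eq[of "p + q" ?n T] peval_eq[of p ?n T] peval_eq[of q ?n T]
    by (simp add: sum.distrib E.scale_left_distrib)
qed

lemma peval_smult: "peval (smult c p) T = escale c (peval p T)"
proof -
  interpret E: vspace escale by (rule vspace_escale)
  show ?thesis
    using peval_eq[of "smult c p" "degree p" T] by (simp add: peval_def E.scale_sum_right)
qed

lemma peval_diff: "peval (p - q) T = peval p T - peval q T"
proof -
  have "peval (p - q) T = peval (p + smult (-1) q) T" by simp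
  also have "\<dots> = peval p T - peval q T" unfolding peval_add peval_smult by (rule endo_eqI) simp
  finally show ?thesis .
qed

lemma peval_pCons:
  assumes "T \<in> Lin UNIV"
  shows "peval (pCons a p) T = escale a 1 + T * peval p T"
proof -
  have "peval (pCons a p) T = (\<Sum>i\<le>Suc (degree p). escale (coeff (pCons a p) i) (T ^ i))"
    by (rule peval_eq) (rule degree_pCons_le)
  also have "\<dots> = escale a 1 + (\<Sum>i\<le>degree p. escale (coeff p i) (T ^ Suc i))"
    by (subst sum.atMost_Suc_shift) simp
  also have "(\<Sum>i\<le>degree p. escale (coeff p i) (T ^ Suc i)) = T * peval p T"
    by (simp add: peval_def sum_distrib_left Lin_escale_mult[OF assms])
  finally show ?thesis .
qed

lemma peval_0 [simp]: "peval 0 T = 0"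
  by (rule endo_eqI) (simp add: peval_def)

lemma peval_const: "T \<in> Lin UNIV \<Longrightarrow> peval [:c:] T = escale c 1"
  by (simp add: peval_pCons)

lemma peval_1: "T \<in> Lin UNIV \<Longrightarrow> peval 1 T = 1"
  using peval_const[of T 1] by (intro endo_eqI) (simp flip: one_pCons)

lemma peval_linear: "T \<in> Lin UNIV \<Longrightarrow> peval [:- c, 1:] T = T - escale c 1"
  by (rule endo_eqI) (simp add: peval_pCons Lin_scale)

lemma peval_mult: "T \<in> Lin UNIV \<Longrightarrow> peval (p * q) T = peval p T * peval q T"
proof (induction p)
  case (pCons a p)
  have "peval (pCons a p * q) T = peval (smult a q) T + peval (pCons 0 (p * q)) T"
    by (simp add: peval_add)
  also have "\<dots> = escale a 1 * peval q T + T * (peval p T * peval q T)"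
    using pCons by (intro endo_eqI) (simp add: peval_smult peval_pCons)
  finally show ?case
    using pCons.prems by (simp add: peval_pCons algebra_simps)
qed simp

lemma peval_power: "T \<in> Lin UNIV \<Longrightarrow> peval (p ^ n) T = peval p T ^ n"
  by (induction n) (simp_all add: peval_1 peval_mult)

lemma peval_sum: "peval (sum h I) T = (\<Sum>i\<in>I. peval (h i) T)"
  by (induction I rule: infinite_finite_induct) (simp_all add: peval_add)

lemma peval_commute: "T \<in> Lin UNIV \<Longrightarrow> peval p T * peval q T = peval q T * peval p T"
  by (simp add: mult.commute flip: peval_mult)

lemma peval_Lin_UNIV: "T \<in> Lin UNIV \<Longrightarrow> peval p T \<in> Lin UNIV"
  unfolding peval_def by (intro Lin_sum Lin_escale Lin_power subspace_UNIV)

lemma peval_dvd_0: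
  assumes "T \<in> Lin UNIV" "p dvd q" "peval p T = 0" shows "peval q T = 0"
  using assms by (auto simp: dvd_def peval_mult)

lemma ex_relation:
  assumes "finite B" "\<And>i. i \<le> n \<Longrightarrow> w i \<in> span B" "card B \<le> n"
  shows "\<exists>c. (\<exists>i\<le>n. c i \<noteq> 0) \<and> (\<Sum>i\<le>n. scale (c i) (w i)) = 0"
proof (cases "inj_on w {..n}")
  case True
  have "dependent (w ` {..n})"
  proof (rule ccontr)
    assume "\<not> dependent (w ` {..n})"
    from independent_span_bound[OF assms(1) this] assms(2) have "card (w ` {..n}) \<le> card B" by blast
    then show False using True assms(3) by (simp add: card_image)
  qed
  then obtain u where u: "\<exists>v\<in>w ` {..n}. u v \<noteq> 0" "(\<Sum>v\<in>w ` {..n}. scale (u v) v) = 0"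
    using dependent_finite[OF finite_imageI[OF finite_atMost], of w n] by (metis (no_types))
  show ?thesis
  proof (rule exI[of _ "\<lambda>i. u (w i)"], rule conjI)
    show "\<exists>i\<le>n. u (w i) \<noteq> 0" using u(1) by blast
    show "(\<Sum>i\<le>n. scale (u (w i)) (w i)) = 0" using u(2) by (simp add: sum.reindex[OF True])
  qed
next
  case False
  then obtain i j where ij: "i \<le> n" "j \<le> n" "w i = w j" "i \<noteq> j" by (auto simp: inj_on_def)
  have "(\<Sum>k\<le>n. scale ((if k = i then 1 else 0) - (if k = j then 1 else 0)) (w k)) =
    (\<Sum>k\<le>n. if k = i then w k else 0) - (\<Sum>k\<le>n. if k = j then w k else 0)"
    unfolding sum_subtractf[symmetric] by (intro sum.cong) (auto simp: scale_left_diff_distrib)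
  also have "\<dots> = 0" using ij by simp
  finally show ?thesis
    using ij by (intro exI[of _ "\<lambda>k. (if k = i then 1 else 0) - (if k = j then 1 else 0)"]) auto
qed

text \<open>Each basis vector is killed by some nonzero polynomial in T, because its iterates are
  linearly dependent. The product of these polynomials kills all of V.\<close>

lemma ex_annihilator:
  assumes V: "fin_dim scale V" and T: "T \<in> Lin V"
  shows "\<exists>p. p \<noteq> 0 \<and> peval p T = 0"
proof -
  obtain B where B: "finite B" "independent B" "span B = V" using fin_dim_basis[OF V] by blast
  have TU: "T \<in> Lin UNIV" by (rule Lin_UNIV[OF T])
  have T1: "peval [:0, 1:] T = T"
    using peval_linear[OF TU, of 0] by (intro endo_eqI) simp
  have "\<exists>p. p \<noteq> 0 \<and> app (peval p T) b = 0" for b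
  proof -
    \<comment> \<open>b is arbitrary here, but T b lies in V. Starting the iteration there costs one
      factor X.\<close>
    have "app (T ^ i) (app T b) \<in> span B" for i
      using Lin_in[OF T, of "app (T ^ i) b"] B(3) arg_cong[OF power_swap[of T i], of "\<lambda>S. app S b"]
      by simp
    then have "\<exists>c. (\<exists>i\<le>card B. c i \<noteq> 0) \<and>
        (\<Sum>i\<le>card B. scale (c i) (app (T ^ i) (app T b))) = 0"
      by (intro ex_relation[OF B(1)]) simp_all
    then obtain c where c: "\<exists>i\<le>card B. c i \<noteq> 0"
      "(\<Sum>i\<le>card B. scale (c i) (app (T ^ i) (app T b))) = 0" by (elim exE conjE) (rule that, auto)
    define q where "q = (\<Sum>i\<le>card B. monom (c i) i)"
    have cq: "coeff q i = (if i \<le> card B then c i else 0)" for i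
      by (simp add: q_def coeff_sum coeff_monom)
    obtain i where "i \<le> card B" "c i \<noteq> 0" using c(1) by blast
    then have q0: "q \<noteq> 0" using cq[of i] by auto
    have "degree q \<le> card B" by (rule degree_le) (simp add: cq)
    then have "app (peval q T) (app T b) = 0"
      using c(2) by (simp add: peval_eq[of q "card B"] app_sum cq)
    moreover have "peval (q * [:0, 1:]) T = peval q T * T" by (simp only: peval_mult[OF TU] T1)
    ultimately have "app (peval (q * [:0, 1:]) T) b = 0" by (simp only: app_simps)
    then have "app (peval (pCons 0 q) T) b = 0" by simp
    then show ?thesis using q0 by (intro exI[of _ "pCons 0 q"]) simp
  qed
  then have "\<forall>b. \<exists>p. p \<noteq> 0 \<and> app (peval p T) b = 0" by blast
  from choice[OF this] obtain P where P': "\<forall>b. P b \<noteq> 0 \<and> app (peval (P b) T) b = 0" by (rule exE)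
  have P: "P b \<noteq> 0" "app (peval (P b) T) b = 0" for b using P' by simp_all
  define p where "p = (\<Prod>b\<in>B. P b)"
  have p0: "p \<noteq> 0" using P(1) B(1) by (simp add: p_def)
  have kill: "app (peval p T) b = 0" if "b \<in> B" for b
  proof -
    have "p = (\<Prod>c\<in>B - {b}. P c) * P b"
      unfolding p_def using prod.remove[OF B(1) that, of P] by (simp add: mult.commute)
    then have "app (peval p T) b = app (peval (\<Prod>c\<in>B - {b}. P c) T) (app (peval (P b) T) b)"
      by (simp only: peval_mult[OF TU] app_simps)
    then show ?thesis by (simp add: P(2))
  qed
  have killV: "app (peval p T) v = 0" if "v \<in> span B" for v
    using that
    by (induction rule: span_induct_alt)
      (simp_all add: app_add_right kill Lin_scale[OF peval_Lin_UNIV[OF TU]])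
  \<comment> \<open>p kills V only; T maps every vector into V, so a further factor X makes the
    operator vanish everywhere.\<close>
  have "peval (p * [:0, 1:]) T = 0"
  proof (rule endo_eqI)
    fix v
    have "app (peval [:0, 1:] T) v = app T v" using peval_linear[OF TU, of 0] by simp
    then show "app (peval (p * [:0, 1:]) T) v = app 0 v"
      unfolding peval_mult[OF TU] using killV Lin_in[OF T] B(3) by simp
  qed
  then show ?thesis using p0 by (intro exI[of _ "p * [:0, 1:]"]) simp
qed

end

subsection \<open>A nilpotency criterion\<close>

text \<open>This is the Chinese remainder theorem, one node at a time. Multiples of the product w of
  the earlier moduli do not disturb the congruences already reached, and since w does not vanish at
  the new node a, they can correct the congruence at a one order after the other.\<close>

lemma hermite_interpolation:
  fixes f :: "'k::field \<Rightarrow> 'k"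
  assumes "finite S"
  shows "\<exists>p. \<forall>c\<in>S. [:- c, 1:] ^ M dvd p - [:f c:]"
  using assms
proof (induction S)
  case (insert a S)
  then obtain p where p: "\<And>c. c \<in> S \<Longrightarrow> [:- c, 1:] ^ M dvd p - [:f c:]" by blast
  define w where "w = (\<Prod>c\<in>S. [:- c, 1:] ^ M)"
  have w0: "poly w a \<noteq> 0"
    using insert.hyps by (auto simp: w_def poly_prod)
  have "\<exists>q. [:- a, 1:] ^ n dvd p + q * w - [:f a:]" for n
  proof (induction n)
    case (Suc n)
    then obtain q h where q: "p + q * w - [:f a:] = [:- a, 1:] ^ n * h" by (auto simp: dvd_def)
    define d where "d = poly h a / poly w a"
    define q' where "q' = q - smult d ([:- a, 1:] ^ n)"
    have "poly (h - smult d w) a = 0" using w0 by (simp add: d_def)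
    from iffD1[OF poly_eq_0_iff_dvd this]
    obtain h' where h': "h - smult d w = [:- a, 1:] * h'" by (rule dvdE)
    have "p + q' * w - [:f a:] = [:- a, 1:] ^ n * (h - smult d w)"
      using q by (simp add: q'_def algebra_simps)
    also have "\<dots> = [:- a, 1:] ^ Suc n * h'" unfolding h' by (simp add: algebra_simps)
    finally show ?case by (intro exI[of _ q']) simp
  qed simp
  then obtain q where q: "[:- a, 1:] ^ M dvd p + q * w - [:f a:]" by blast
  have "[:- c, 1:] ^ M dvd p + q * w - [:f c:]" if "c \<in> S" for c
  proof -
    have "[:- c, 1:] ^ M dvd w" unfolding w_def by (rule dvd_prodI[OF insert.hyps(1) that])
    then have "[:- c, 1:] ^ M dvd (p - [:f c:]) + q * w" using p[OF that] by simp
    then show ?thesis by (simp add: algebra_simps)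
  qed
  then show ?case using q by (intro exI[of _ "p + q * w"]) simp
qed simp

lemma prod_linear_power_dvd:
  fixes h :: "'k::field poly"
  assumes "finite S" "\<And>c. c \<in> S \<Longrightarrow> [:- c, 1:] ^ M dvd h"
  shows "(\<Prod>c\<in>S. [:- c, 1:] ^ M) dvd h"
  using assms
proof (induction S)
  case (insert a S)
  define w where "w = (\<Prod>c\<in>S. [:- c, 1:] ^ M)"
  obtain h' where h': "h = w * h'" using insert by (auto simp: w_def dvd_def)
  have "poly w a \<noteq> 0" using insert.hyps by (auto simp: w_def poly_prod)
  then have w: "order a w = 0" "w \<noteq> 0" by (auto simp: order_root)
  have "[:- a, 1:] ^ M dvd h'"
  proof (cases "h' = 0")
    case False
    have "[:- a, 1:] ^ M dvd w * h'" using insert.prems[of a] h' by simp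
    then have "M \<le> order a (w * h')" using False w by (simp add: order_divides)
    also have "order a (w * h') = order a h'" using False w by (simp add: order_mult)
    finally show ?thesis by (simp add: order_divides)
  qed simp
  then show ?case using insert.hyps h' by (simp add: mult.commute mult_dvd_mono flip: w_def)
qed simp

text \<open>It is stated for all larger sets and exponents because the application adds 0 to the
  roots and wants an exponent above a given bound.\<close>

lemma dvd_prod_linear_power:
  fixes p :: "'k::alg_closed_field poly"
  assumes "p \<noteq> 0"
  shows "\<exists>S M. finite S \<and> (\<forall>S' M'. finite S' \<longrightarrow> S \<subseteq> S' \<longrightarrow> M \<le> M' \<longrightarrow> p dvd (\<Prod>c\<in>S'. [:- c, 1:] ^ M'))"
proof -
  obtain A where A: "p = smult (lead_coeff p) (\<Prod>x\<in>#A. [:- x, 1:])"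
    using alg_closed_imp_factorization[OF assms] by auto
  have "p dvd (\<Prod>c\<in>S'. [:- c, 1:] ^ M')" if *: "finite S'" "set_mset A \<subseteq> S'" "size A \<le> M'" for S' M'
  proof -
    have "(\<Prod>x\<in>#A. [:- x, 1:]) = (\<Prod>c\<in>set_mset A. [:- c, 1:] ^ count A c)"
      by (rule image_prod_mset_multiplicity)
    also have "\<dots> dvd (\<Prod>c\<in>set_mset A. [:- c, 1:] ^ M')"
    proof (rule prod_dvd_prod)
      fix c
      have "count A c \<le> M'" using count_le_size[of A c] *(3) by linarith
      then show "[:- c, 1:] ^ count A c dvd [:- c, 1:] ^ M'" by (rule le_imp_power_dvd)
    qed
    also have "\<dots> dvd (\<Prod>c\<in>S'. [:- c, 1:] ^ M')" by (rule prod_dvd_prod_subset[OF *(1,2)])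
    finally have "smult (lead_coeff p) (\<Prod>x\<in>#A. [:- x, 1:]) dvd (\<Prod>c\<in>S'. [:- c, 1:] ^ M')"
      using assms by (simp add: smult_dvd)
    then show ?thesis using A by simp
  qed
  then show ?thesis by (intro exI[of _ "set_mset A"] exI[of _ "size A"]) auto
qed

text \<open>Every monomial in the binomial expansion contains A^M or B^M. The induction carries the
  monomial A^a B^b already split off, which avoids writing out binomial coefficients.\<close>

lemma commuting_diff_power_0:
  fixes A B :: "'v::ab_group_add endo"
  assumes AB: "A * B = B * A" and A: "app (A ^ M) Y = 0" and B: "app (B ^ M) Y = 0"
  shows "app ((A - B) ^ (2 * M)) Y = 0"
proof -
  have AnB: "A * B ^ n = B ^ n * A" for n
    using power_commuting_commutes[OF AB[symmetric], of n] by simp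
  have BnA: "B * A ^ n = A ^ n * B" for n
    using power_commuting_commutes[OF AB, of n] by simp
  have AmBn: "A ^ m * B ^ n = B ^ n * A ^ m" for m n
    by (rule power_commuting_commutes[OF AnB])
  have zeroA: "app (A ^ a * B ^ b) Y = 0" if "M \<le> a" for a b
  proof -
    have "A ^ a * B ^ b = B ^ b * (A ^ (a - M) * A ^ M)"
      unfolding power_add[symmetric] using that AmBn[of a b] by simp
    then show ?thesis using A by simp
  qed
  have zeroB: "app (A ^ a * B ^ b) Y = 0" if "M \<le> b" for a b
  proof -
    have "A ^ a * B ^ b = A ^ a * (B ^ (b - M) * B ^ M)"
      unfolding power_add[symmetric] using that by simp
    then show ?thesis using B by simp
  qed
  have "app ((A - B) ^ n * (A ^ a * B ^ b)) Y = 0" if "2 * M \<le> n + a + b" for n a b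
    using that
  proof (induction n arbitrary: a b)
    case 0
    then have "M \<le> a \<or> M \<le> b" by linarith
    then show ?case using zeroA zeroB by auto
  next
    case (Suc n)
    have "(A - B) ^ Suc n * (A ^ a * B ^ b) = (A - B) ^ n * ((A - B) * (A ^ a * B ^ b))"
      by (simp only: power_Suc2 mult.assoc)
    also have "(A - B) * (A ^ a * B ^ b) = A ^ Suc a * B ^ b - A ^ a * B ^ Suc b"
    proof -
      have "B * (A ^ a * B ^ b) = A ^ a * B ^ Suc b"
        unfolding power_Suc mult.assoc[symmetric] BnA by simp
      then show ?thesis by (simp add: left_diff_distrib mult.assoc)
    qed
    finally have "(A - B) ^ Suc n * (A ^ a * B ^ b)
      = (A - B) ^ n * (A ^ Suc a * B ^ b) - (A - B) ^ n * (A ^ a * B ^ Suc b)"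
      by (simp only: right_diff_distrib)
    then show ?case
      using Suc.IH[of "Suc a" b] Suc.IH[of a "Suc b"] Suc.prems by (simp only: app_simps) simp
  qed
  from this[of "2 * M" 0 0] show ?thesis by simp
qed

text \<open>The field is a vector space over the rationals, and c is nonzero. Such a form does what
  complex conjugation does in Cartan's criterion over the complex numbers: it turns a weighted sum
  of eigenvalues into a sum of squares.\<close>

lemma ex_rat_functional:
  fixes c :: "'k::field_char_0"
  assumes "c \<noteq> 0"
  shows "\<exists>f :: 'k \<Rightarrow> rat. (\<forall>x y. f (x + y) = f x + f y) \<and> (\<forall>r x. f (of_rat r * x) = r * f x) \<and> f c = 1"
proof -
  interpret Q: vspace "\<lambda>(r::rat) (x::'k). of_rat r * x"
    by unfold_locales (auto simp: algebra_simps of_rat_add of_rat_mult)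
  have "c \<notin> {0}" using assms by simp
  from Q.ex_functional[OF Q.subspace_single_0 this] show ?thesis
    by (auto simp: Q.functional_def)
qed

text \<open>With this encoding ad z is the difference of two commuting members of the type
  \<open>endo endo\<close>, so polynomials in ad z are instances of \<open>peval\<close> one level
  up.\<close>

definition mult_left :: "'v::ab_group_add endo \<Rightarrow> 'v endo endo" where
  "mult_left z = Abs_endo (\<lambda>x. z * x)"

definition mult_right :: "'v::ab_group_add endo \<Rightarrow> 'v endo endo" where
  "mult_right z = Abs_endo (\<lambda>x. x * z)"

lemma app_mult_left [simp]: "app (mult_left z) x = z * x"
  unfolding mult_left_def by (subst Abs_endo_inverse) (simp_all add: distrib_left)

lemma app_mult_right [simp]: "app (mult_right z) x = x * z"
  unfolding mult_right_def by (subst Abs_endo_inverse) (simp_all add: distrib_right)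

lemma app_mult_left_power: "app (mult_left z ^ n) x = z ^ n * x"
  by (induction n arbitrary: x) (simp_all add: mult.assoc)

lemma app_mult_right_power: "app (mult_right z ^ n) x = x * z ^ n"
  by (induction n arbitrary: x) (simp_all add: mult.assoc power_commutes)

definition ad :: "'v::ab_group_add endo \<Rightarrow> 'v endo \<Rightarrow> 'v endo" where
  "ad z x = z * x - x * z"

lemma app_ad_power: "app ((mult_left z - mult_right z) ^ n) x = (ad z ^^ n) x"
  by (induction n) (simp_all add: ad_def)

locale ac_vspace = vspace scale
  for scale :: "'k::{alg_closed_field, field_char_0} \<Rightarrow> 'v::ab_group_add \<Rightarrow> 'v"
begin

text \<open>The polynomials e c interpolate the indicator function of c to order M at every root of
  an annihilating polynomial. Evaluated at z they are the projections onto the generalized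
  eigenspaces.\<close>

lemma spectral_projections:
  assumes V: "fin_dim scale V" and z: "z \<in> Lin V"
  obtains S M e where "finite S" "0 \<in> S" "N < M"
    "\<And>c. peval (e c) z * peval (e c) z = peval (e c) z"
    "\<And>c d. c \<in> S \<Longrightarrow> d \<in> S \<Longrightarrow> c \<noteq> d \<Longrightarrow> peval (e c) z * peval (e d) z = 0"
    "\<And>c. c \<in> S \<Longrightarrow> (z - escale c 1) ^ M * peval (e c) z = 0"
    "(\<Sum>c\<in>S. peval (e c) z) = 1"
    "\<And>c. c \<noteq> 0 \<Longrightarrow> peval (e c) z \<in> Lin V"
proof -
  have zU: "z \<in> Lin UNIV" by (rule Lin_UNIV[OF z])
  obtain p where p: "p \<noteq> 0" "peval p z = 0"
    using ex_annihilator[OF V z] by (elim exE conjE) (rule that)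
  from dvd_prod_linear_power[OF p(1)] obtain S0 M0 where S0: "finite S0"
    "\<forall>S' M'. finite S' \<longrightarrow> S0 \<subseteq> S' \<longrightarrow> M0 \<le> M' \<longrightarrow> p dvd (\<Prod>c\<in>S'. [:- c, 1:] ^ M')"
    by (elim exE conjE) (rule that)
  \<comment> \<open>With 0 among the nodes, e c is divisible by X for nonzero c, so its value at z
    maps into V. The projection for 0 takes up all that lies outside V.\<close>
  define S where "S = insert 0 S0"
  define M where "M = Suc (N + M0)"
  define \<chi> :: "'k poly" where "\<chi> = (\<Prod>c\<in>S. [:- c, 1:] ^ M)"
  have fS: "finite S" and 0: "0 \<in> S" using S0(1) by (auto simp: S_def)
  have "p dvd \<chi>" unfolding \<chi>_def
    using S0(2) fS by (simp only: S_def M_def) (simp del: power_Suc add: subset_insertI)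
  then have \<chi>: "peval \<chi> z = 0" by (rule peval_dvd_0[OF zU _ p(2)])
  have vanish: "peval h z = 0" if "\<And>c. c \<in> S \<Longrightarrow> [:- c, 1:] ^ M dvd h" for h
    using prod_linear_power_dvd[OF fS that] by (intro peval_dvd_0[OF zU _ \<chi>]) (simp add: \<chi>_def)
  have "\<forall>c. \<exists>p. \<forall>d\<in>S. [:- d, 1:] ^ M dvd p - [:if d = c then 1 else 0:]"
  proof
    fix c :: 'k
    show "\<exists>p. \<forall>d\<in>S. [:- d, 1:] ^ M dvd p - [:if d = c then 1 else 0:]"
      by (rule hermite_interpolation[OF fS, of M "\<lambda>d. if d = c then 1 else 0"])
  qed
  from choice[OF this] obtain e where
    e': "\<forall>c. \<forall>d\<in>S. [:- d, 1:] ^ M dvd e c - [:if d = c then 1 else 0:]" by (rule exE)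
  have e1: "[:- c, 1:] ^ M dvd e c - 1" if "c \<in> S" for c
    using bspec[OF spec[OF e', of c] that] by (simp add: one_pCons)
  have e0: "[:- d, 1:] ^ M dvd e c" if "c \<noteq> d" "d \<in> S" for c d
    using bspec[OF spec[OF e', of c] that(2)] that(1) by simp
  show thesis
  proof (rule that[of S M e])
    show "N < M" by (simp add: M_def)
    show "peval (e c) z * peval (e c) z = peval (e c) z" for c
    proof -
      have "peval (e c * (e c - 1)) z = 0"
      proof (rule vanish)
        show "[:- d, 1:] ^ M dvd e c * (e c - 1)" if "d \<in> S" for d
          using e0[of c d] e1[of d] that by (cases "c = d") auto
      qed
      then show ?thesis by (simp add: peval_mult[OF zU] peval_diff peval_1[OF zU] right_diff_distrib)
    qed
    show "peval (e c) z * peval (e d) z = 0" if "c \<in> S" "d \<in> S" "c \<noteq> d" for c d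
    proof -
      have "peval (e c * e d) z = 0"
      proof (rule vanish)
        show "[:- a, 1:] ^ M dvd e c * e d" if "a \<in> S" for a
          using e0[of c a] e0[of d a] that \<open>c \<noteq> d\<close> by (cases "c = a") auto
      qed
      then show ?thesis by (simp add: peval_mult[OF zU])
    qed
    show "(z - escale c 1) ^ M * peval (e c) z = 0" if "c \<in> S" for c
    proof -
      have "peval ([:- c, 1:] ^ M * e c) z = 0"
      proof (rule vanish)
        show "[:- a, 1:] ^ M dvd [:- c, 1:] ^ M * e c" if "a \<in> S" for a
          using e0[of c a] that by (cases "c = a") auto
      qed
      then show ?thesis
        by (simp only: peval_mult[OF zU] peval_power[OF zU] peval_linear[OF zU])
    qed
    show "(\<Sum>c\<in>S. peval (e c) z) = 1"
    proof -
      have "peval ((\<Sum>c\<in>S. e c) - 1) z = 0"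
      proof (rule vanish)
        fix d assume d: "d \<in> S"
        have "(\<Sum>c\<in>S. e c) - 1 = (e d - 1) + (\<Sum>c\<in>S - {d}. e c)"
          using sum.remove[OF fS d, of e] by simp
        moreover have "[:- d, 1:] ^ M dvd (\<Sum>c\<in>S - {d}. e c)"
          by (rule dvd_sum) (use e0 d in auto)
        ultimately show "[:- d, 1:] ^ M dvd (\<Sum>c\<in>S. e c) - 1"
          using dvd_add[OF e1[OF d]] by presburger
      qed
      then show ?thesis by (simp add: peval_diff peval_sum peval_1[OF zU])
    qed
    show "peval (e c) z \<in> Lin V" if "c \<noteq> 0" for c
    proof -
      have "[:- 0, 1:] ^ Suc (N + M0) dvd e c" using e0[OF that 0] by (simp only: M_def)
      then obtain q where "e c = [:- 0, 1:] * ([:- 0, 1:] ^ (N + M0) * q)"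
        by (auto simp: dvd_def mult.assoc)
      then have "peval (e c) z = peval [:- 0, 1:] z * peval ([:- 0, 1:] ^ (N + M0) * q) z"
        by (simp only: peval_mult[OF zU])
      also have "peval [:- 0, 1:] z = z" unfolding peval_linear[OF zU] by (rule endo_eqI) simp
      finally show ?thesis using Lin_mult[OF z peval_Lin_UNIV[OF zU]] by simp
    qed
  qed (rule fS, rule 0)
qed

text \<open>
  \<open>U\<close> acts as \<open>f c\<close> on the generalized eigenspace of \<open>c\<close>. In the application \<open>f\<close> is
  \<open>\<rat>\<close>-linear with \<open>f 0 = 0\<close>, so that \<open>ad U\<close> is a polynomial in \<open>ad z\<close> without terms of low order.
\<close>

lemma replica_commutator:
  assumes z: "z \<in> Lin UNIV" and S: "finite S"
    and orth: "\<And>c d. c \<in> S \<Longrightarrow> d \<in> S \<Longrightarrow> c \<noteq> d \<Longrightarrow> E c * E d = 0"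
    and idem: "\<And>c. E c * E c = E c"
    and nil: "\<And>c. c \<in> S \<Longrightarrow> (z - escale c 1) ^ M * E c = 0"
    and nil': "\<And>c. c \<in> S \<Longrightarrow> E c * (z - escale c 1) ^ M = 0"
    and one: "(\<Sum>c\<in>S. E c) = 1" and E: "\<And>c. E c \<in> Lin UNIV"
    and f: "\<And>c d. f (c - d) = f c - (f d :: 'k)"
    and p: "\<And>c d. c \<in> S \<Longrightarrow> d \<in> S \<Longrightarrow> [:- (c - d), 1:] ^ (2 * M) dvd p - [:f (c - d):]"
    and Z: "Z \<in> Lin UNIV"
  defines "U \<equiv> (\<Sum>c\<in>S. escale (f c) (E c))"
  shows "app (vspace.peval escale p (mult_left z - mult_right z)) Z = U * Z - Z * U"
proof -
  interpret E: vspace escale by (rule vspace_escale)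
  let ?D = "mult_left z - mult_right z"
  have lin: "mult_left z \<in> E.Lin UNIV" "mult_right z \<in> E.Lin UNIV" "?D \<in> E.Lin UNIV"
    using Lin_escale_mult[OF z] by (auto simp: E.Lin_def escale_mult_left E.scale_right_diff_distrib)
  have UE: "U * E c = escale (f c) (E c)" "E c * U = escale (f c) (E c)" if "c \<in> S" for c
  proof -
    have "U * E c = (\<Sum>d\<in>S. if d = c then escale (f c) (E c) else 0)"
      unfolding U_def sum_distrib_right using orth[OF _ that]
      by (intro sum.cong refl) (auto simp: escale_mult_left idem)
    then show "U * E c = escale (f c) (E c)" using S that by simp
    have "E c * U = (\<Sum>d\<in>S. if d = c then escale (f c) (E c) else 0)"
      unfolding U_def sum_distrib_left using orth[OF that]
      by (intro sum.cong refl) (auto simp: Lin_escale_mult[OF E] idem)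
    then show "E c * U = escale (f c) (E c)" using S that by simp
  qed
  \<comment> \<open>On the block from the eigenvalue d to the eigenvalue c, ad z - (c - d) is a
    difference of commuting nilpotents of exponent M, so its power 2 M vanishes. To that order p
    agrees with the constant f (c - d).\<close>
  have block: "app (E.peval p ?D) (E c * Z * E d) = U * (E c * Z * E d) - (E c * Z * E d) * U"
    if c: "c \<in> S" and d: "d \<in> S" for c d
  proof -
    define Y where "Y = E c * Z * E d"
    define A where "A = mult_left (z - escale c 1)"
    define B where "B = mult_right (z - escale d 1)"
    have "app (A ^ M) Y = (z - escale c 1) ^ M * E c * Z * E d"
      by (simp add: A_def app_mult_left_power Y_def mult.assoc)
    then have A: "app (A ^ M) Y = 0" by (simp add: nil[OF c])
    have "app (B ^ M) Y = E c * Z * (E d * (z - escale d 1) ^ M)"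
      by (simp add: B_def app_mult_right_power Y_def mult.assoc)
    then have B: "app (B ^ M) Y = 0" by (simp add: nil'[OF d])
    have AB: "A * B = B * A"
      by (rule endo_eqI) (simp add: A_def B_def mult.assoc)
    have [simp]: "escale c 1 * W = escale c W" for c W by (rule endo_eqI) simp
    have YE: "W * escale d 1 = escale d W" if "W \<in> Lin UNIV" for W
      by (simp add: Lin_escale_mult[OF that])
    \<comment> \<open>Multiplying W by the scalar operator d from the right is scaling only when W
      is linear. The identity therefore passes to powers along with membership in
      \<open>Lin UNIV\<close>.\<close>
    have "app (A - B) W = app (?D - E.escale (c - d) 1) W" if "W \<in> Lin UNIV" for W
      by (simp add: A_def B_def YE[OF that] algebra_simps E.scale_left_diff_distrib)
    then have AB': "app ((A - B) ^ n) Y = app ((?D - E.escale (c - d) 1) ^ n) Y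
        \<and> app ((A - B) ^ n) Y \<in> Lin UNIV" for n
    proof (induction n)
      case 0
      show ?case by (simp add: Y_def Lin_mult E Z)
    next
      case (Suc n)
      have "app (?D - E.escale (c - d) 1) W \<in> Lin UNIV" if "W \<in> Lin UNIV" for W
        using that z Lin_mult[of z UNIV W] Lin_mult[of W UNIV z]
        by (auto intro!: Lin_diff Lin_escale subspace_UNIV)
      then show ?case using Suc by (simp only: power_Suc app_simps(6)) metis
    qed
    have "app ((A - B) ^ (2 * M)) Y = 0" by (rule commuting_diff_power_0[OF AB A B])
    then have D0: "app ((?D - E.escale (c - d) 1) ^ (2 * M)) Y = 0" using AB' by simp
    obtain q where "p - [:f (c - d):] = [:- (c - d), 1:] ^ (2 * M) * q"
      using p[OF c d] by (rule dvdE)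
    then have "p = q * [:- (c - d), 1:] ^ (2 * M) + [:f (c - d):]" by (simp add: algebra_simps)
    then have "E.peval p ?D
      = E.peval q ?D * (?D - E.escale (c - d) 1) ^ (2 * M) + E.escale (f (c - d)) 1"
      by (simp only: E.peval_add E.peval_mult[OF lin(3)] E.peval_power[OF lin(3)]
        E.peval_linear[OF lin(3)] E.peval_const[OF lin(3)])
    then have "app (E.peval p ?D) Y = escale (f (c - d)) Y" by (simp add: D0)
    moreover have "U * Y = escale (f c) Y"
      unfolding Y_def mult.assoc[symmetric] UE(1)[OF c] by (simp add: escale_mult_left)
    moreover have "Y * U = escale (f d) Y"
      unfolding Y_def mult.assoc UE(2)[OF d]
      by (simp add: Lin_escale_mult[OF E] Lin_escale_mult[OF Z] mult.assoc[symmetric])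
    ultimately show ?thesis unfolding Y_def[symmetric] by (simp add: f E.scale_left_diff_distrib)
  qed
  have "Z = (\<Sum>c\<in>S. E c) * Z * (\<Sum>d\<in>S. E d)" by (simp add: one)
  also have "\<dots> = (\<Sum>c\<in>S. \<Sum>d\<in>S. E c * Z * E d)"
    unfolding sum_distrib_right sum_distrib_left by (rule sum.swap)
  finally have Xs: "Z = (\<Sum>c\<in>S. \<Sum>d\<in>S. E c * Z * E d)" .
  have "app (E.peval p ?D) (\<Sum>c\<in>S. \<Sum>d\<in>S. E c * Z * E d)
      = (\<Sum>c\<in>S. \<Sum>d\<in>S. U * (E c * Z * E d) - (E c * Z * E d) * U)"
    unfolding app_sum_right by (intro sum.cong refl block)
  also have "\<dots> = U * (\<Sum>c\<in>S. \<Sum>d\<in>S. E c * Z * E d) - (\<Sum>c\<in>S. \<Sum>d\<in>S. E c * Z * E d) * U"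
    by (simp only: sum_subtractf sum_distrib_left[symmetric] sum_distrib_right[symmetric])
  finally show ?thesis unfolding Xs[symmetric] .
qed

text \<open>Let d c be the dimension of the generalized eigenspace of c, and let U act there as
  \<open>\<phi> c\<close> for a rational form \<open>\<phi>\<close>. Then tr(U z) is the sum of c
  \<open>\<phi>\<close>(c) d(c). On the other hand tr(U z) is the sum of tr(b_i [U, a_i]), and
  [U, _] is a polynomial in ad z, so the trace vanishes by assumption. Applying
  \<open>\<phi>\<close> yields a vanishing sum of \<open>\<phi>\<close>(c)^2 d(c), which forces
  d(c0) = 0 where \<open>\<phi>\<close>(c0) = 1.\<close>

lemma nilpotent_if_trace_ad:
  assumes V: "fin_dim scale V" and I: "finite I"
    and a: "\<And>i. i \<in> I \<Longrightarrow> a i \<in> Lin V" and b: "\<And>i. i \<in> I \<Longrightarrow> b i \<in> Lin V"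
    and z: "z = (\<Sum>i\<in>I. a i * b i - b i * a i)"
    and tr0: "\<And>j. N \<le> j \<Longrightarrow> (\<Sum>i\<in>I. tr V (b i * (ad z ^^ j) (a i))) = 0"
  shows "\<exists>m. z ^ m = 0"
proof -
  interpret E: vspace escale by (rule vspace_escale)
  have sV: "subspace V" by (rule fin_dim_subspace_carrier[OF V])
  have zV: "z \<in> Lin V" unfolding z by (intro Lin_sum Lin_diff Lin_mult' sV a b)
  have zU: "z \<in> Lin UNIV" by (rule Lin_UNIV[OF zV])
  obtain S M e where S: "finite S" "0 \<in> S" and M: "N < M"
    and idem: "\<And>c. peval (e c) z * peval (e c) z = peval (e c) z"
    and orth: "\<And>c d. c \<in> S \<Longrightarrow> d \<in> S \<Longrightarrow> c \<noteq> d \<Longrightarrow> peval (e c) z * peval (e d) z = 0"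
    and nil: "\<And>c. c \<in> S \<Longrightarrow> (z - escale c 1) ^ M * peval (e c) z = 0"
    and one: "(\<Sum>c\<in>S. peval (e c) z) = 1"
    and EV: "\<And>c. c \<noteq> 0 \<Longrightarrow> peval (e c) z \<in> Lin V"
    by (rule spectral_projections[OF V zV, of N]) (rule that, assumption+)
  define E where "E c = peval (e c) z" for c
  have EU: "E c \<in> Lin UNIV" for c unfolding E_def by (rule peval_Lin_UNIV[OF zU])
  have Ez: "E c * (z - escale c 1) ^ n = (z - escale c 1) ^ n * E c" for c n
    unfolding E_def peval_linear[OF zU, symmetric] peval_power[OF zU, symmetric]
    by (rule peval_commute[OF zU])
  have nil': "E c * (z - escale c 1) ^ M = 0" if "c \<in> S" for c
    unfolding Ez using nil[OF that] by (simp add: E_def)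
  obtain d where d: "\<And>c. c \<noteq> 0 \<Longrightarrow> tr V (E c) = of_nat (d c)"
    "\<And>c. c \<noteq> 0 \<Longrightarrow> d c = 0 \<Longrightarrow> E c = 0"
  proof -
    have "\<forall>c. \<exists>n. c \<noteq> 0 \<longrightarrow> (tr V (E c) = of_nat n \<and> (n = 0 \<longrightarrow> E c = 0))"
      using tr_idempotent[OF V EV idem] unfolding E_def by simp
    from choice[OF this] show thesis by (elim exE) (rule that, auto)
  qed
  have trEz: "tr V (E c * z) = c * of_nat (d c)" if c: "c \<in> S" "c \<noteq> 0" for c
  proof -
    define W where "W = E c * (z - escale c 1)"
    have EcV: "E c \<in> Lin V" unfolding E_def by (rule EV[OF c(2)])
    have zc: "z - escale c 1 \<in> Lin UNIV"
      by (intro Lin_diff Lin_escale zU Lin_1 subspace_UNIV)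
    have WV: "W \<in> Lin V" unfolding W_def by (rule Lin_mult[OF EcV zc])
    have "W ^ n = E c ^ n * (z - escale c 1) ^ n" for n
    proof (induction n)
      case (Suc n)
      have "W ^ Suc n = E c * ((z - escale c 1) * E c ^ n) * (z - escale c 1) ^ n"
        unfolding power_Suc Suc by (simp add: W_def mult.assoc)
      also have "(z - escale c 1) * E c ^ n = E c ^ n * (z - escale c 1)"
        using power_commuting_commutes[of "E c" "z - escale c 1" n] Ez[of c 1] by simp
      finally show ?case by (simp add: mult.assoc)
    qed simp
    moreover have "E c ^ M * (z - escale c 1) ^ M = 0"
    proof -
      obtain k where "M = Suc k" using M by (cases M) auto
      then have "E c ^ M * (z - escale c 1) ^ M = E c ^ k * (E c * (z - escale c 1) ^ M)"
        by (simp only: power_Suc2 mult.assoc)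
      then show ?thesis by (simp add: nil'[OF c(1)])
    qed
    ultimately have "tr V W = 0" by (intro tr_nilpotent[OF V WV, of M]) simp
    moreover have "E c * z = W + escale c (E c)"
      by (simp add: W_def right_diff_distrib Lin_escale_mult[OF EU])
    ultimately show ?thesis
      using d(1)[OF c(2)] by (simp add: tr_add[OF V WV Lin_escale[OF sV EcV]] tr_scale[OF V EcV])
  qed
  have d0: "d c0 = 0" if c0: "c0 \<in> S" "c0 \<noteq> 0" for c0
  proof -
    obtain \<phi> :: "'k \<Rightarrow> rat" where
      \<phi>': "(\<forall>x y. \<phi> (x + y) = \<phi> x + \<phi> y) \<and> (\<forall>r x. \<phi> (of_rat r * x) = r * \<phi> x) \<and> \<phi> c0 = 1"
      by (rule exE[OF ex_rat_functional[OF c0(2)]])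
    have \<phi>: "\<phi> (x + y) = \<phi> x + \<phi> y" "\<phi> (of_rat r * x) = r * \<phi> x" for x y r
      using \<phi>' by simp_all
    have \<phi>1: "\<phi> c0 = 1" using \<phi>' by simp
    have \<phi>0: "\<phi> 0 = 0" using \<phi>(1)[of 0 0] by simp
    have \<phi>s: "\<phi> (sum h J) = (\<Sum>j\<in>J. \<phi> (h j))" for h :: "'k \<Rightarrow> 'k" and J
      by (induction J rule: infinite_finite_induct) (auto simp: \<phi> \<phi>0)
    have \<phi>d: "\<phi> (c - d) = \<phi> c - \<phi> d" for c d using \<phi>(1)[of "c - d" d] by simp
    define f where "f c = (of_rat (\<phi> c) :: 'k)" for c
    have fd: "f (c - d) = f c - f d" for c d by (simp add: f_def \<phi>d of_rat_diff)
    have f0: "f 0 = 0" by (simp add: f_def \<phi>0)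
    define U where "U = (\<Sum>c\<in>S. escale (f c) (E c))"
    have "finite ((\<lambda>(c, d). c - d) ` (S \<times> S))" using S by simp
    from hermite_interpolation[OF this, of "2 * M" f]
    obtain p where p': "\<forall>c\<in>(\<lambda>(c, d). c - d) ` (S \<times> S). [:- c, 1:] ^ (2 * M) dvd p - [:f c:]"
      by (rule exE)
    have p: "[:- (c - d), 1:] ^ (2 * M) dvd p - [:f (c - d):]" if "c \<in> S" "d \<in> S" for c d
      using bspec[OF p', of "c - d"] that by force
    \<comment> \<open>0 = 0 - 0 is an interpolation node and f 0 = 0, so p has no terms of degree
      below 2 M. Those up to N, on which \<open>tr0\<close> is silent, are among them.\<close>
    have "[:- (0 - 0), 1:] ^ (2 * M) dvd p - [:f (0 - 0):]" by (rule p[OF S(2) S(2)])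
    then have "monom 1 (2 * M) dvd p" by (simp add: f0 monom_altdef)
    then have coeff0: "coeff p j = 0" if "j \<le> N" for j
      using that M by (simp add: monom_1_dvd_iff')
    have EUN: "U * Z - Z * U = app (E.peval p (mult_left z - mult_right z)) Z" if "Z \<in> Lin UNIV" for Z
      unfolding U_def
      by (rule replica_commutator[OF zU S(1) _ _ _ _ _ EU fd p that, symmetric])
        (use orth idem nil nil' one in \<open>auto simp: E_def\<close>)
    have U: "U = (\<Sum>c\<in>S - {0}. escale (f c) (E c))"
      unfolding U_def using sum.remove[OF S, of "\<lambda>c. escale (f c) (E c)"] by (simp add: f0)
    have UV: "U \<in> Lin V"
      unfolding U by (intro Lin_sum Lin_escale sV) (auto simp: E_def EV)
    have adV: "(ad z ^^ j) Z \<in> Lin V" if "Z \<in> Lin V" for Z j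
      by (induction j) (auto simp: ad_def that intro!: Lin_diff Lin_mult' sV zV)
    have "tr V (U * z) = (\<Sum>i\<in>I. tr V (U * (a i * b i) - U * (b i * a i)))"
      unfolding z sum_distrib_left right_diff_distrib
      by (rule tr_sum[OF V]) (intro Lin_diff Lin_mult' sV a b UV)
    also have "\<dots> = (\<Sum>i\<in>I. tr V (b i * (U * a i - a i * U)))"
    proof (rule sum.cong[OF refl])
      fix i assume i: "i \<in> I"
      note ab = a[OF i] b[OF i]
      have "tr V (U * (a i * b i)) = tr V (b i * (U * a i))"
        using tr_commute[OF V Lin_mult'[OF UV ab(1)] ab(2)] by (simp add: mult.assoc)
      moreover have "tr V (U * (b i * a i)) = tr V (b i * (a i * U))"
        using tr_commute[OF V UV Lin_mult'[OF ab(2,1)]] by (simp add: mult.assoc)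
      ultimately show "tr V (U * (a i * b i) - U * (b i * a i)) = tr V (b i * (U * a i - a i * U))"
        unfolding right_diff_distrib using UV ab by (simp add: tr_diff[OF V] Lin_mult')
    qed
    also have "\<dots> = (\<Sum>i\<in>I. \<Sum>j\<le>degree p. coeff p j * tr V (b i * (ad z ^^ j) (a i)))"
    proof (rule sum.cong[OF refl])
      fix i assume i: "i \<in> I"
      have "b i * (U * a i - a i * U) = (\<Sum>j\<le>degree p. escale (coeff p j) (b i * (ad z ^^ j) (a i)))"
        unfolding EUN[OF Lin_UNIV[OF a[OF i]]]
        by (simp add: E.peval_def app_sum app_ad_power sum_distrib_left Lin_escale_mult[OF b[OF i]])
      then show "tr V (b i * (U * a i - a i * U))
          = (\<Sum>j\<le>degree p. coeff p j * tr V (b i * (ad z ^^ j) (a i)))"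
        by (simp add: tr_sum[OF V] tr_scale[OF V] Lin_escale[OF sV] Lin_mult' adV a[OF i] b[OF i])
    qed
    also have "\<dots> = (\<Sum>j\<le>degree p. coeff p j * (\<Sum>i\<in>I. tr V (b i * (ad z ^^ j) (a i))))"
      by (subst sum.swap) (simp add: sum_distrib_left)
    also have "\<dots> = 0"
    proof (rule sum.neutral, rule ballI)
      fix j
      show "coeff p j * (\<Sum>i\<in>I. tr V (b i * (ad z ^^ j) (a i))) = 0"
        using coeff0[of j] tr0[of j] by (cases "j \<le> N") auto
    qed
    finally have "tr V (U * z) = 0" .
    moreover have "tr V (U * z) = (\<Sum>c\<in>S - {0}. of_rat (\<phi> c * of_nat (d c)) * c)"
    proof -
      have "U * z = (\<Sum>c\<in>S - {0}. escale (f c) (E c * z))"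
        unfolding U sum_distrib_right escale_mult_left ..
      moreover have EzV: "E c * z \<in> Lin V" if "c \<noteq> 0" for c
        using Lin_mult'[OF EV[OF that] zV] by (simp add: E_def)
      ultimately have "tr V (U * z) = (\<Sum>c\<in>S - {0}. tr V (escale (f c) (E c * z)))"
        using tr_sum[OF V, of "S - {0}" "\<lambda>c. escale (f c) (E c * z)"] Lin_escale[OF sV] by simp
      also have "\<dots> = (\<Sum>c\<in>S - {0}. f c * tr V (E c * z))"
        by (intro sum.cong refl tr_scale[OF V]) (use EzV in simp)
      also have "\<dots> = (\<Sum>c\<in>S - {0}. of_rat (\<phi> c * of_nat (d c)) * c)"
        by (intro sum.cong refl) (simp add: trEz f_def of_rat_mult mult.commute)
      finally show ?thesis .
    qed
    ultimately have "\<phi> (\<Sum>c\<in>S - {0}. of_rat (\<phi> c * of_nat (d c)) * c) = 0" by (simp add: \<phi>0)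
    then have "(\<Sum>c\<in>S - {0}. \<phi> c * of_nat (d c) * \<phi> c) = 0" unfolding \<phi>s \<phi>(2) .
    moreover have "0 \<le> \<phi> c * of_nat (d c) * \<phi> c" for c
      using mult_nonneg_nonneg[OF zero_le_square[of "\<phi> c"], of "of_nat (d c)"] by (simp add: ac_simps)
    ultimately have "\<forall>c\<in>S - {0}. \<phi> c * of_nat (d c) * \<phi> c = 0"
      using sum_nonneg_eq_0_iff[of "S - {0}" "\<lambda>c. \<phi> c * of_nat (d c) * \<phi> c"] S(1) by simp
    then show ?thesis using c0 \<phi>1 by force
  qed
  have "E c = 0" if "c \<in> S - {0}" for c using d(2) d0 that by simp
  then have "E 0 = 1" using one sum.remove[OF S, of E] by (simp add: E_def)
  moreover have "z - escale 0 1 = z" by (rule endo_eqI) simp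
  ultimately have "z ^ M = 0" using nil[OF S(2)] by (simp add: E_def)
  then show ?thesis by (rule exI)
qed

end

lemma sum_fun_apply: "sum h I x = (\<Sum>i\<in>I. h i x)" for h :: "'i \<Rightarrow> 'b \<Rightarrow> 'c::comm_monoid_add"
  by (induction I rule: infinite_finite_induct) simp_all

subsection \<open>Scalar extension to the algebraic closure\<close>

locale vspace_char_0 = vspace scale for scale :: "'k::field_char_0 \<Rightarrow> 'v::ab_group_add \<Rightarrow> 'v"
begin

definition ac_scale :: "'k alg_closure \<Rightarrow> ('v \<Rightarrow> 'k alg_closure) \<Rightarrow> 'v \<Rightarrow> 'k alg_closure" where
  "ac_scale c \<phi> = (\<lambda>x. c * \<phi> x)"

text \<open>The scalar extension of span B, in coordinates: coefficient functions supported on B.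
  \<open>ac_ext\<close> lets an operator act by the matrix it has in the basis B, so no tensor
  product is formed.\<close>

definition ac_space :: "'v set \<Rightarrow> ('v \<Rightarrow> 'k alg_closure) set" where
  "ac_space B = {\<phi>. \<forall>x. x \<notin> B \<longrightarrow> \<phi> x = 0}"

definition ac_unit :: "'v \<Rightarrow> 'v \<Rightarrow> 'k alg_closure" where
  "ac_unit b x = (if x = b then 1 else 0)"

definition ac_ext :: "'v set \<Rightarrow> 'v endo \<Rightarrow> ('v \<Rightarrow> 'k alg_closure) endo" where
  "ac_ext B T = Abs_endo (\<lambda>\<phi> x. if x \<in> B then \<Sum>b\<in>B. to_ac (representation B (app T b) x) * \<phi> b else 0)"

lemma app_ac_ext:
  "app (ac_ext B T) \<phi> x = (if x \<in> B then \<Sum>b\<in>B. to_ac (representation B (app T b) x) * \<phi> b else 0)"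
  unfolding ac_ext_def by (subst Abs_endo_inverse) (auto simp: fun_eq_iff algebra_simps sum.distrib)

lemma ac_vspace_ac_scale: "ac_vspace ac_scale"
  by unfold_locales (auto simp: ac_scale_def fun_eq_iff algebra_simps)

context
  fixes B V
  assumes B: "finite B" "independent B" "span B = V"
begin

interpretation K: ac_vspace ac_scale by (rule ac_vspace_ac_scale)

lemma inj_ac_unit: "inj_on ac_unit A"
  by (rule inj_onI) (metis ac_unit_def zero_neq_one)

lemma ac_expand:
  assumes "\<phi> \<in> ac_space B"
  shows "\<phi> = (\<Sum>b\<in>B. ac_scale (\<phi> b) (ac_unit b))"
proof
  fix x
  have "(\<Sum>b\<in>B. \<phi> b * ac_unit b x) = (\<Sum>b\<in>B. if b = x then \<phi> x else 0)"
    by (intro sum.cong refl) (auto simp: ac_unit_def)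
  also have "\<dots> = \<phi> x" using assms B(1) by (auto simp: ac_space_def)
  finally show "\<phi> x = (\<Sum>b\<in>B. ac_scale (\<phi> b) (ac_unit b)) x"
    by (simp add: sum_fun_apply ac_scale_def)
qed

lemma ac_basis:
  shows "finite (ac_unit ` B)" "K.independent (ac_unit ` B)" "K.span (ac_unit ` B) = ac_space B"
proof -
  show fin: "finite (ac_unit ` B)" using B(1) by simp
  show "K.independent (ac_unit ` B)"
  proof (rule K.independent_if_scalars_zero[OF fin])
    fix f x assume f: "(\<Sum>x\<in>ac_unit ` B. ac_scale (f x) x) = 0" and "x \<in> ac_unit ` B"
    then obtain b where b: "b \<in> B" "x = ac_unit b" by blast
    have "(\<Sum>c\<in>B. ac_scale (f (ac_unit c)) (ac_unit c)) b = 0"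
      using f by (simp add: sum.reindex[OF inj_ac_unit])
    moreover have "(\<Sum>c\<in>B. ac_scale (f (ac_unit c)) (ac_unit c)) b
      = (\<Sum>c\<in>B. if c = b then f (ac_unit b) else 0)"
      unfolding sum_fun_apply by (intro sum.cong refl) (auto simp: ac_scale_def ac_unit_def)
    ultimately show "f x = 0" using b B(1) by simp
  qed
  have sub: "K.subspace (ac_space B)"
    by (auto simp: K.subspace_def ac_space_def ac_scale_def)
  show "K.span (ac_unit ` B) = ac_space B"
  proof
    show "K.span (ac_unit ` B) \<subseteq> ac_space B"
      by (rule K.span_minimal[OF _ sub]) (auto simp: ac_space_def ac_unit_def)
    show "ac_space B \<subseteq> K.span (ac_unit ` B)"
    proof
      fix \<phi> assume "\<phi> \<in> ac_space B"
      from ac_expand[OF this] show "\<phi> \<in> K.span (ac_unit ` B)"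
        by (metis (no_types, lifting) K.span_base K.span_scale K.span_sum imageI)
    qed
  qed
qed

lemma fin_dim_ac_space: "fin_dim ac_scale (ac_space B)"
  unfolding fin_dim_def using ac_basis by metis

lemma ac_representation:
  assumes "\<phi> \<in> ac_space B" "b \<in> B"
  shows "K.representation (ac_unit ` B) \<phi> (ac_unit b) = \<phi> b"
proof -
  have "(\<Sum>x\<in>ac_unit ` B. ac_scale (K.representation (ac_unit ` B) \<phi> x) x) = \<phi>"
    by (rule K.representation_sum_all[OF ac_basis(1,2)]) (simp add: ac_basis(3) assms(1))
  then have "\<phi> b = (\<Sum>c\<in>B. ac_scale (K.representation (ac_unit ` B) \<phi> (ac_unit c)) (ac_unit c)) b"
    by (simp add: sum.reindex[OF inj_ac_unit])
  also have "\<dots> = (\<Sum>c\<in>B. if c = b then K.representation (ac_unit ` B) \<phi> (ac_unit b) else 0)"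
    unfolding sum_fun_apply by (intro sum.cong refl) (auto simp: ac_scale_def ac_unit_def)
  finally show ?thesis using assms(2) B(1) by simp
qed

lemma ac_ext_Lin: "ac_ext B T \<in> K.Lin (ac_space B)"
  by (auto simp: K.Lin_def ac_space_def ac_scale_def app_ac_ext fun_eq_iff sum_distrib_left
      mult.left_commute intro!: sum.cong)

lemma ac_ext_unit:
  assumes "b \<in> B" "x \<in> B"
  shows "app (ac_ext B T) (ac_unit b) x = to_ac (representation B (app T b) x)"
proof -
  have "(\<Sum>c\<in>B. to_ac (representation B (app T c) x) * ac_unit b c)
    = (\<Sum>c\<in>B. if c = b then to_ac (representation B (app T b) x) else 0)"
    by (intro sum.cong refl) (auto simp: ac_unit_def)
  then show ?thesis using assms B(1) by (simp add: app_ac_ext)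
qed

lemma tr_ac_ext:
  assumes "T \<in> Lin V"
  shows "K.tr (ac_space B) (ac_ext B T) = to_ac (tr V T)"
proof -
  have "K.tr (ac_space B) (ac_ext B T)
    = (\<Sum>x\<in>ac_unit ` B. K.representation (ac_unit ` B) (app (ac_ext B T) x) x)"
    unfolding K.tr_def
    by (rule K.trace_eq[OF ac_basis K.lin_on_app[OF ac_ext_Lin] K.Lin_in[OF ac_ext_Lin]])
  also have "\<dots> = (\<Sum>b\<in>B. to_ac (representation B (app T b) b))"
    unfolding sum.reindex[OF inj_ac_unit] comp_def
    by (intro sum.cong refl) (simp add: ac_representation K.Lin_in[OF ac_ext_Lin] ac_ext_unit)
  also have "\<dots> = to_ac (tr V T)"
    unfolding tr_def trace_eq[OF B lin_on_app[OF assms] Lin_in[OF assms]] by (simp add: to_ac_sum)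
  finally show ?thesis .
qed

lemma B_in: "b \<in> B \<Longrightarrow> b \<in> V"
  using B(3) span_base by blast

lemma ac_ext_add: "S \<in> Lin V \<Longrightarrow> T \<in> Lin V \<Longrightarrow> ac_ext B (S + T) = ac_ext B S + ac_ext B T"
  by (intro endo_eqI ext)
    (simp add: app_ac_ext representation_add[OF B(2)] B(3) Lin_in algebra_simps sum.distrib)

lemma ac_ext_diff: "S \<in> Lin V \<Longrightarrow> T \<in> Lin V \<Longrightarrow> ac_ext B (S - T) = ac_ext B S - ac_ext B T"
  by (intro endo_eqI ext)
    (simp add: app_ac_ext representation_diff[OF B(2)] B(3) Lin_in algebra_simps sum_subtractf)

lemma ac_ext_0: "ac_ext B 0 = 0"
  by (intro endo_eqI ext) (simp add: app_ac_ext representation_zero)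

lemma ac_ext_sum: "(\<And>i. i \<in> I \<Longrightarrow> h i \<in> Lin V) \<Longrightarrow> ac_ext B (sum h I) = (\<Sum>i\<in>I. ac_ext B (h i))"
proof (induction I rule: infinite_finite_induct)
  case (insert x F)
  then show ?case
    using ac_ext_add[of "h x" "sum h F"] Lin_sum[of V F h] subspace_span[of B] B(3) by simp
qed (auto simp: ac_ext_0)

lemma ac_ext_mult:
  assumes "S \<in> Lin V" "T \<in> Lin V"
  shows "ac_ext B (S * T) = ac_ext B S * ac_ext B T"
proof (intro endo_eqI ext)
  fix \<phi> x
  show "app (ac_ext B (S * T)) \<phi> x = app (ac_ext B S * ac_ext B T) \<phi> x"
  proof (cases "x \<in> B")
    case True
    have "representation B (app S (app T b)) x
      = (\<Sum>c\<in>B. representation B (app T b) c * representation B (app S c) x)" for b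
    proof -
      have "app T b = (\<Sum>c\<in>B. scale (representation B (app T b) c) c)"
        using representation_sum_all[OF B(1,2), of "app T b"] Lin_in[OF assms(2)] B(3) by simp
      then have "representation B (app S (app T b)) x
        = representation B (app S (\<Sum>c\<in>B. scale (representation B (app T b) c) c)) x" by simp
      also have "\<dots> = (\<Sum>c\<in>B. representation B (app T b) c * representation B (app S c) x)"
        by (rule representation_lin[OF B lin_on_app[OF assms(1)] Lin_in[OF assms(1)] B_in])
      finally show ?thesis .
    qed
    then have "app (ac_ext B (S * T)) \<phi> x
      = (\<Sum>b\<in>B. \<Sum>c\<in>B. to_ac (representation B (app T b) c) * to_ac (representation B (app S c) x) * \<phi> b)"
      using True by (simp add: app_ac_ext to_ac_sum sum_distrib_right)
    also have "\<dots> = app (ac_ext B S) (app (ac_ext B T) \<phi>) x"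
      using True by (subst sum.swap)
        (simp add: app_ac_ext sum_distrib_left mult.left_commute mult.assoc)
    finally show ?thesis by simp
  qed (simp add: app_ac_ext)
qed

text \<open>The matrix sees T on V only, so T may be nonzero outside V. As its values lie in V, its
  square is zero.\<close>

lemma ac_ext_eq_0:
  assumes T: "T \<in> Lin V" and "ac_ext B T = 0"
  shows "T * T = 0"
proof -
  have kill: "app T b = 0" if b: "b \<in> B" for b
  proof -
    have "to_ac (representation B (app T b) x) = 0" if "x \<in> B" for x
      using ac_ext_unit[OF b that, of T] assms(2) by simp
    then have "(\<Sum>x\<in>B. scale (representation B (app T b) x) x) = 0" by simp
    then show ?thesis
      using representation_sum_all[OF B(1,2), of "app T b"] Lin_in[OF T] B(3) by simp
  qed
  have "app T v = 0" if "v \<in> span B" for v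
    using that
    by (induction rule: span_induct_alt) (simp_all add: app_add_right Lin_scale[OF T] kill)
  then show ?thesis using Lin_in[OF T] B(3) by (intro endo_eqI) simp
qed

end

text \<open>
  Cartan's criterion, phrased through iterated commutators only, so that it descends from the
  algebraic closure.
\<close>
theorem nilpotent_if_trace_ad:
  assumes V: "fin_dim scale V" and I: "finite I"
    and a: "\<And>i. i \<in> I \<Longrightarrow> a i \<in> Lin V" and b: "\<And>i. i \<in> I \<Longrightarrow> b i \<in> Lin V"
    and z: "z = (\<Sum>i\<in>I. a i * b i - b i * a i)"
    and tr0: "\<And>j. N \<le> j \<Longrightarrow> (\<Sum>i\<in>I. tr V (b i * (ad z ^^ j) (a i))) = 0"
  shows "\<exists>m. z ^ m = 0"
proof -
  interpret K: ac_vspace ac_scale by (rule ac_vspace_ac_scale)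
  obtain B where B: "finite B" "independent B" "span B = V" using fin_dim_basis[OF V] by blast
  let ?e = "ac_ext B"
  have sV: "subspace V" by (rule fin_dim_subspace_carrier[OF V])
  have zV: "z \<in> Lin V" unfolding z by (intro Lin_sum Lin_diff Lin_mult' sV a b)
  have adV: "(ad z ^^ j) x \<in> Lin V" if "x \<in> Lin V" for x j
    by (induction j) (auto simp: ad_def that intro!: Lin_diff Lin_mult' sV zV)
  have ade: "?e ((ad z ^^ j) x) = (ad (?e z) ^^ j) (?e x)" if "x \<in> Lin V" for x j
  proof (induction j)
    case (Suc j)
    have "?e (ad z ((ad z ^^ j) x)) = ad (?e z) (?e ((ad z ^^ j) x))"
      using adV[OF that, of j] zV
      by (simp add: ad_def ac_ext_diff[OF B] ac_ext_mult[OF B] Lin_mult')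
    then show ?case using Suc by simp
  qed simp
  have "\<exists>m. ?e z ^ m = 0"
  proof (rule K.nilpotent_if_trace_ad[OF fin_dim_ac_space[OF B] I])
    show "?e (a i) \<in> K.Lin (ac_space B)" "?e (b i) \<in> K.Lin (ac_space B)" for i
      by (rule ac_ext_Lin[OF B])+
    show "?e z = (\<Sum>i\<in>I. ?e (a i) * ?e (b i) - ?e (b i) * ?e (a i))"
      unfolding z using a b
      by (subst ac_ext_sum[OF B]) (auto intro!: Lin_diff Lin_mult' sV sum.cong
        simp: ac_ext_diff[OF B] ac_ext_mult[OF B] Lin_mult')
    fix j assume "N \<le> j"
    have "(\<Sum>i\<in>I. K.tr (ac_space B) (?e (b i) * (ad (?e z) ^^ j) (?e (a i))))
      = (\<Sum>i\<in>I. to_ac (tr V (b i * (ad z ^^ j) (a i))))"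
    proof (rule sum.cong[OF refl])
      fix i assume i: "i \<in> I"
      have "?e (b i) * (ad (?e z) ^^ j) (?e (a i)) = ?e (b i * (ad z ^^ j) (a i))"
        using a[OF i] b[OF i] adV by (simp add: ade[symmetric] ac_ext_mult[OF B])
      then show "K.tr (ac_space B) (?e (b i) * (ad (?e z) ^^ j) (?e (a i)))
        = to_ac (tr V (b i * (ad z ^^ j) (a i)))"
        using a[OF i] b[OF i] adV by (simp add: tr_ac_ext[OF B] Lin_mult')
    qed
    also have "\<dots> = 0" using tr0[OF \<open>N \<le> j\<close>] by (simp add: to_ac_sum[symmetric])
    finally show "(\<Sum>i\<in>I. K.tr (ac_space B) (?e (b i) * (ad (?e z) ^^ j) (?e (a i)))) = 0" .
  qed
  then obtain m where m: "?e z ^ m = 0" by (rule exE)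
  \<comment> \<open>The powers start at exponent 1, because \<open>ac_ext_mult\<close> is about
    members of \<open>Lin V\<close> and the identity need not be one.\<close>
  have zp: "z ^ Suc n \<in> Lin V \<and> ?e (z ^ Suc n) = ?e z ^ Suc n" for n
  proof (induction n)
    case (Suc n)
    then have "?e (z * z ^ Suc n) = ?e z * ?e z ^ Suc n"
      using ac_ext_mult[OF B zV, of "z ^ Suc n"] by simp
    then show ?case using Lin_mult'[OF zV, of "z ^ Suc n"] Suc by simp
  qed (simp add: zV)
  have "?e (z ^ Suc m) = 0" using zp[of m] m by simp
  then have "z ^ Suc m * z ^ Suc m = 0" using ac_ext_eq_0[OF B] zp[of m] by blast
  then have "z ^ (Suc m + Suc m) = 0" unfolding power_add .
  then show ?thesis by (rule exI)
qed

end

subsection \<open>Engel's theorem\<close>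

context vspace
begin

text \<open>\<open>flag H n\<close> consists of the vectors killed by all products of n members of
  H. So \<open>nil_set H\<close> says that all products of some fixed length vanish.\<close>

primrec flag :: "'b endo set \<Rightarrow> nat \<Rightarrow> 'b set" where
  "flag H 0 = {0}"
| "flag H (Suc n) = {v. \<forall>h\<in>H. app h v \<in> flag H n}"

definition nil_set :: "'b endo set \<Rightarrow> bool" where
  "nil_set H \<longleftrightarrow> (\<exists>N. \<forall>v. v \<in> flag H N)"

definition normalizes :: "'b endo \<Rightarrow> 'b endo set \<Rightarrow> bool" where
  "normalizes z H \<longleftrightarrow> (\<forall>h\<in>H. z * h - h * z \<in> H)"

lemma flag_subspace: "H \<subseteq> Lin UNIV \<Longrightarrow> subspace (flag H n)"
proof (induction n)
  case (Suc n)
  then have s: "subspace (flag H n)" by simp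
  have L: "app h (scale c v) = scale c (app h v)" if "h \<in> H" for h c v
    using Suc.prems that by (intro Lin_scale) auto
  show ?case
    unfolding subspace_def
    by (auto simp: subspace_0[OF s] subspace_add[OF s] subspace_scale[OF s] app_add_right L)
qed (simp add: subspace_single_0)

lemma flag_mono_Suc: "v \<in> flag H n \<Longrightarrow> v \<in> flag H (Suc n)"
  by (induction n arbitrary: v) auto

lemma flag_mono: "v \<in> flag H n \<Longrightarrow> n \<le> m \<Longrightarrow> v \<in> flag H m"
  by (induction m) (auto simp: le_Suc_eq intro: flag_mono_Suc simp del: flag.simps)

lemma flag_step: "v \<in> flag H (Suc n) \<Longrightarrow> h \<in> H \<Longrightarrow> app h v \<in> flag H n"
  by simp

lemma flag_step': "v \<in> flag H n \<Longrightarrow> h \<in> H \<Longrightarrow> app h v \<in> flag H (n - 1)"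
  by (cases n) auto

lemma flag_normalized:
  assumes "H \<subseteq> Lin UNIV" "normalizes z H" "v \<in> flag H n"
  shows "app z v \<in> flag H n"
  using assms(3)
proof (induction n arbitrary: v)
  case (Suc n)
  have "app h (app z v) \<in> flag H n" if h: "h \<in> H" for h
  proof -
    have "app h (app z v) = app z (app h v) - app (z * h - h * z) v" by simp
    moreover have "app z (app h v) \<in> flag H n" using Suc h by simp
    moreover have "app (z * h - h * z) v \<in> flag H n"
      by (rule flag_step[OF Suc.prems]) (use assms(2) h in \<open>simp add: normalizes_def\<close>)
    ultimately show ?thesis using subspace_diff[OF flag_subspace[OF assms(1)]] by metis
  qed
  then show ?case by simp
qed simp

lemma nil_set_nilpotent:
  assumes "nil_set H" "h \<in> H"
  shows "\<exists>k. h ^ k = 0"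
proof -
  obtain N where N: "\<forall>v. v \<in> flag H N" using assms(1) by (auto simp: nil_set_def)
  have "app (h ^ n) v = 0" if "v \<in> flag H n" for n v
    using that
  proof (induction n arbitrary: v)
    case (Suc n)
    then show ?case using assms(2) by (simp only: power_Suc2 app_simps flag_step)
  qed simp
  then have "h ^ N = 0" using N by (intro endo_eqI) simp
  then show ?thesis by (rule exI)
qed

text \<open>y preserves every step of the flag of H and x lowers it by one. This is why a nil
  subalgebra is orthogonal to its normalizer for a trace form.\<close>

lemma nil_set_mult_nilpotent:
  assumes H: "H \<subseteq> Lin UNIV" "nil_set H" "x \<in> H" and y: "normalizes y H"
  shows "\<exists>k. (x * y) ^ k = 0"
proof -
  obtain N where N: "\<forall>v. v \<in> flag H N" using H(2) by (auto simp: nil_set_def)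
  have "app ((x * y) ^ n) v = 0" if "v \<in> flag H n" for n v
    using that
  proof (induction n arbitrary: v)
    case (Suc n)
    have "app y v \<in> flag H (Suc n)" by (rule flag_normalized[OF H(1) y Suc.prems])
    then have "app x (app y v) \<in> flag H n" using H(3) by (rule flag_step)
    then show ?case using Suc.IH by (simp only: power_Suc2 app_simps)
  qed simp
  then have "(x * y) ^ N = 0" using N by (intro endo_eqI) simp
  then show ?thesis by (rule exI)
qed

text \<open>z preserves the flag of H, and on each layer, where H acts as zero, the k-th power of z
  vanishes. So k steps of the new flag cover one layer of the old one.\<close>

lemma nil_set_extend:
  assumes H: "H \<subseteq> Lin UNIV" "nil_set H" and z: "z \<in> Lin UNIV" "normalizes z H" "z ^ k = 0"
  shows "nil_set {h + escale c z | h c. h \<in> H}"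
proof -
  let ?H = "{h + escale c z | h c. h \<in> H}"
  obtain N where N: "\<forall>v. v \<in> flag H N" using H(2) by (auto simp: nil_set_def)
  note s = flag_subspace[OF H(1)]
  have "v \<in> flag H n \<Longrightarrow> v \<in> flag ?H (k * n)" for v n
  proof (induction n arbitrary: v)
    case (Suc n)
    have pow: "app (z ^ i) v \<in> flag H (Suc n)" for i
      by (induction i) (simp_all only: power_0 power_Suc app_simps Suc.prems flag_normalized[OF H(1) z(2)])
    \<comment> \<open>A member of the extended set sends c z^i v + u to a vector of the same kind
      with exponent i + 1, the rest falling into the lower step u. Here j counts the applications
      left until the exponent reaches k.\<close>
    have "scale c (app (z ^ i) v) + u \<in> flag ?H (j + k * n)" if "u \<in> flag H n" "k \<le> i + j" for c i j u
      using that
    proof (induction j arbitrary: i u c)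
      case 0
      then have "z ^ i = z ^ (i - k) * z ^ k" by (simp flip: power_add)
      then show ?case using Suc.IH[OF "0.prems"(1)] z(3) by simp
    next
      case (Suc j)
      have "app (h + escale d z) (scale c (app (z ^ i) v) + u) \<in> flag ?H (j + k * n)"
        if h: "h \<in> H" for h d
      proof -
        have hL: "app h (scale c w) = scale c (app h w)" for c w using H(1) h by (intro Lin_scale) auto
        let ?u = "scale c (app h (app (z ^ i) v)) + (app h u + scale d (app z u))"
        have "app (h + escale d z) (scale c (app (z ^ i) v) + u)
          = scale (d * c) (app (z ^ Suc i) v) + ?u"
          by (simp add: app_add_right hL Lin_scale[OF z(1)] algebra_simps)
        moreover have "?u \<in> flag H n"
        proof (intro subspace_add[OF s] subspace_scale[OF s])
          show "app h (app (z ^ i) v) \<in> flag H n" by (rule flag_step[OF pow h])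
          show "app h u \<in> flag H n"
            by (rule flag_step[OF flag_mono_Suc[OF Suc.prems(1)] h])
          show "app z u \<in> flag H n" by (rule flag_normalized[OF H(1) z(2) Suc.prems(1)])
        qed
        ultimately show ?thesis using Suc.IH[of ?u "Suc i" "d * c"] Suc.prems(2) by simp
      qed
      then show ?case by auto
    qed
    from this[where c = 1 and i = 0 and j = k and u = 0] show ?case using subspace_0[OF s] by simp
  qed simp
  then show ?thesis using N unfolding nil_set_def by blast
qed

text \<open>H acts on operators by commutators, and each commutator brings an operator one level
  deeper into a filtration that ends in 0. An element of M outside H at the greatest possible depth
  has all its commutators with H inside H.\<close>

lemma ex_normalizing:
  assumes H: "H \<subseteq> Lin UNIV" "nil_set H" "0 \<in> H" and MC: "\<And>h t. h \<in> H \<Longrightarrow> t \<in> M \<Longrightarrow> h * t - t * h \<in> M"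
    and ne: "z \<in> M" "z \<notin> H"
  shows "\<exists>t. t \<in> M \<and> t \<notin> H \<and> (\<forall>h\<in>H. h * t - t * h \<in> H)"
proof -
  obtain N where N: "\<And>v. v \<in> flag H N" using H(2) by (auto simp: nil_set_def)
  note s = flag_subspace[OF H(1)]
  \<comment> \<open>t lowers the flag by s - N. The shift by N keeps the indices natural: level 0
    contains every operator, level 2 N only 0.\<close>
  define F where "F s = {t. \<forall>j. \<forall>v\<in>flag H j. app t v \<in> flag H ((j + N) - s)}" for s
  have FD: "app t v \<in> flag H ((j + N) - s)" if "t \<in> F s" "v \<in> flag H j" for t v j s
    using that(1)[unfolded F_def mem_Collect_eq, rule_format, OF that(2)] .
  have F0: "t \<in> F 0" for t
    unfolding F_def mem_Collect_eq by (intro allI ballI flag_mono[OF N]) simp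
  have FN: "t = 0" if "t \<in> F (2 * N)" for t
  proof (rule endo_eqI)
    fix v have "app t v \<in> flag H (N + N - 2 * N)" by (rule FD[OF that N])
    then show "app t v = app 0 v" by simp
  qed
  have Fs: "h * t - t * h \<in> F (Suc s)" if "t \<in> F s" and h: "h \<in> H" for h t s
    unfolding F_def
  proof (intro CollectI allI ballI)
    fix j v assume v: "v \<in> flag H j"
    show "app (h * t - t * h) v \<in> flag H (j + N - Suc s)"
    proof (cases j)
      case 0
      then show ?thesis using v subspace_0[OF s] by simp
    next
      case (Suc i)
      have "app h v \<in> flag H i" using v h Suc flag_step by simp
      then have "app t (app h v) \<in> flag H (i + N - s)" by (rule FD[OF that(1)])
      moreover have "app h (app t v) \<in> flag H (j + N - s - 1)"
        by (rule flag_step'[OF FD[OF that(1) v] h])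
      moreover have "j + N - Suc s = i + N - s" "j + N - s - 1 = i + N - s" using Suc by simp_all
      ultimately show ?thesis using subspace_diff[OF s, of "app h (app t v)"] by (simp only: app_simps)
    qed
  qed
  define Q where "Q n \<longleftrightarrow> (\<exists>t. t \<in> M \<and> t \<notin> H \<and> t \<in> F n)" for n
  have lt: "n < 2 * N" if Q: "Q n" for n
  proof (rule ccontr)
    assume n: "\<not> n < 2 * N"
    from Q[unfolded Q_def] obtain t where t: "t \<notin> H" "t \<in> F n" by (elim exE conjE) (rule that)
    have "t \<in> F (2 * N)" unfolding F_def
    proof (intro CollectI allI ballI)
      fix j v assume "v \<in> flag H j"
      then have "app t v \<in> flag H (j + N - n)" by (rule FD[OF t(2)])
      then show "app t v \<in> flag H (j + N - 2 * N)"
        by (rule flag_mono) (use n in simp)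
    qed
    then show False using FN t(1) H(3) by metis
  qed
  have "Q 0" unfolding Q_def using ne F0 by metis
  then obtain n where n: "Q n" "\<And>n'. Q n' \<Longrightarrow> n' \<le> n"
    using ex_has_greatest_nat[of Q 0 "\<lambda>n. n" "2 * N"] lt by metis
  from n(1)[unfolded Q_def] obtain t where t: "t \<in> M" "t \<notin> H" "t \<in> F n"
    by (elim exE conjE) (rule that)
  have "h * t - t * h \<in> H" if "h \<in> H" for h
  proof (rule ccontr)
    assume "h * t - t * h \<notin> H"
    then have "Q (Suc n)" unfolding Q_def using Fs[OF t(3) that] MC[OF that t(1)] by metis
    then show False using n(2)[of "Suc n"] by simp
  qed
  then show ?thesis using t by (intro exI[of _ t]) simp
qed

text \<open>Among the subalgebras H of M with \<open>nil_set H\<close> take a maximal one. If it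
  were proper, \<open>ex_normalizing\<close> would give an element z that normalizes it, and
  adjoining z would enlarge it by \<open>nil_set_extend\<close>.\<close>

theorem engel:
  assumes M: "M \<subseteq> Lin UNIV" "module.subspace escale M" "fin_dim escale M"
    and closed: "\<And>s t. s \<in> M \<Longrightarrow> t \<in> M \<Longrightarrow> s * t - t * s \<in> M"
    and nil: "\<And>t. t \<in> M \<Longrightarrow> \<exists>k. t ^ k = 0"
  shows "nil_set M"
proof -
  interpret E: vspace escale by (rule vspace_escale)
  define P where "P H \<longleftrightarrow> E.subspace H \<and> H \<subseteq> M \<and> (\<forall>s\<in>H. \<forall>t\<in>H. s * t - t * s \<in> H) \<and> nil_set H" for H
  have "v \<in> flag {0} 1" for v by simp
  then have "nil_set {0}" unfolding nil_set_def by blast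
  then have "P {0}" using E.subspace_0[OF M(2)] by (simp add: P_def E.subspace_single_0)
  from E.ex_maximal_subspace[of M P, OF M(3) this] obtain H where H: "P H"
    and max: "\<And>K. P K \<Longrightarrow> H \<subseteq> K \<Longrightarrow> K = H"
    by (auto simp: P_def)
  have sH: "E.subspace H" and HM: "H \<subseteq> M" and cH: "\<And>s t. s \<in> H \<Longrightarrow> t \<in> H \<Longrightarrow> s * t - t * s \<in> H"
    and nH: "nil_set H" using H by (auto simp: P_def)
  have HL: "H \<subseteq> Lin UNIV" using HM M(1) by blast
  have "H = M"
  proof (rule ccontr)
    assume "H \<noteq> M"
    then obtain z0 where "z0 \<in> M" "z0 \<notin> H" using HM by blast
    from ex_normalizing[OF HL nH E.subspace_0[OF sH] _ this, of] closed HM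
    obtain z where z: "z \<in> M" "z \<notin> H" "\<And>h. h \<in> H \<Longrightarrow> h * z - z * h \<in> H" by blast
    have zh: "z * h - h * z \<in> H" if "h \<in> H" for h
      using E.subspace_neg[OF sH z(3)[OF that]] by simp
    have zL: "z \<in> Lin UNIV" using z M by blast
    obtain k where k: "z ^ k = 0" using nil[OF z(1)] by blast
    let ?K = "{h + escale c z | h c. h \<in> H}"
    have "P ?K"
      unfolding P_def
    proof (intro conjI ballI)
      show "E.subspace ?K"
        unfolding E.subspace_def
      proof (intro conjI ballI allI)
        show "0 \<in> ?K" using E.subspace_0[OF sH] by (auto intro!: exI[of _ 0])
      next
        fix s t assume "s \<in> ?K" "t \<in> ?K"
        then obtain h c h' c' where "s = h + escale c z" "h \<in> H" "t = h' + escale c' z" "h' \<in> H" by auto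
        moreover have "(h + escale c z) + (h' + escale c' z) = (h + h') + escale (c + c') z"
          by (simp add: E.scale_left_distrib)
        ultimately show "s + t \<in> ?K" using E.subspace_add[OF sH] by blast
      next
        fix d s assume "s \<in> ?K"
        then obtain h c where "s = h + escale c z" "h \<in> H" by auto
        moreover have "escale d (h + escale c z) = escale d h + escale (d * c) z"
          by (simp add: E.scale_right_distrib)
        ultimately show "escale d s \<in> ?K" using E.subspace_scale[OF sH] by blast
      qed
      show "?K \<subseteq> M"
        using HM z(1) E.subspace_add[OF M(2)] E.subspace_scale[OF M(2)] by auto
      show "nil_set ?K"
        by (rule nil_set_extend[OF HL nH zL _ k]) (use zh in \<open>simp add: normalizes_def\<close>)
      fix s t assume "s \<in> ?K" "t \<in> ?K"
      then obtain h c h' c' where *: "s = h + escale c z" "h \<in> H" "t = h' + escale c' z" "h' \<in> H" by auto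
      have L: "h * escale c' z = escale c' (h * z)" "h' * escale c z = escale c (h' * z)"
        "z * escale c z = escale c (z * z)" for c c'
        using * HL zL by (auto intro!: Lin_escale_mult)
      have "s * t - t * s = (h * h' - h' * h) + escale c (z * h' - h' * z) + escale c' (h * z - z * h)"
        unfolding * by (simp add: L escale_mult_left algebra_simps E.scale_right_diff_distrib)
      moreover have "\<dots> \<in> H"
        using * by (intro E.subspace_add[OF sH] E.subspace_scale[OF sH] cH zh z(3))
      ultimately have "s * t - t * s = (s * t - t * s) + escale 0 z \<and> s * t - t * s \<in> H" by simp
      then show "s * t - t * s \<in> ?K" by blast
    qed
    moreover have "H \<subseteq> ?K"
    proof
      fix h assume "h \<in> H"
      moreover have "h = h + escale 0 z" by simp
      ultimately show "h \<in> ?K" by blast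
    qed
    ultimately have "?K = H" by (rule max)
    moreover have "z = 0 + escale 1 z" by simp
    then have "z \<in> ?K" using E.subspace_0[OF sH] by blast
    ultimately show False using z(2) by blast
  qed
  then show ?thesis using nH by simp
qed

text \<open>
  The Engel descent: among the elements of \<open>Y - Z\<close>, take one as deep as possible in the flag.
\<close>
lemma nil_set_descent:
  assumes nil: "nil_set (t ` H)" and z: "z \<in> Y" "z \<notin> Z"
    and act: "\<And>h y. h \<in> H \<Longrightarrow> y \<in> Y \<Longrightarrow> act h y \<in> Y \<and> app (t h) (\<phi> y) = \<phi> (act h y)"
    and 0: "\<And>y. y \<in> Y \<Longrightarrow> \<phi> y = 0 \<Longrightarrow> y \<in> Z"
  shows "\<exists>y. y \<in> Y \<and> y \<notin> Z \<and> (\<forall>h\<in>H. act h y \<in> Z)"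
proof -
  obtain N where "\<And>v. v \<in> flag (t ` H) N" using nil by (auto simp: nil_set_def)
  then have "\<phi> z \<in> flag (t ` H) N" .
  then show ?thesis using z
  proof (induction N arbitrary: z)
    case (Suc N)
    show ?case
    proof (cases "\<forall>h\<in>H. act h z \<in> Z")
      case False
      then obtain h where h: "h \<in> H" "act h z \<notin> Z" by blast
      have "\<phi> (act h z) \<in> flag (t ` H) N" using Suc.prems act[OF h(1), of z] h(1) by auto
      then show ?thesis using Suc.IH[of "act h z"] act[OF h(1)] Suc.prems h(2) by blast
    qed (use Suc.prems in blast)
  qed (use 0 in auto)
qed

end

subsection \<open>Operators of a representation\<close>

locale lie_rep = lie_representation scale bracket h scaleV V \<rho>
  for scale :: "'k::field_char_0 \<Rightarrow> 'a::ab_group_add \<Rightarrow> 'a"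
    and bracket :: "'a \<Rightarrow> 'a \<Rightarrow> 'a" and h :: "'a set"
    and scaleV :: "'k \<Rightarrow> 'v::ab_group_add \<Rightarrow> 'v" and V :: "'v set" and \<rho> :: "'a \<Rightarrow> 'v \<Rightarrow> 'v"

sublocale lie_rep \<subseteq> A: vspace_char_0 scale by unfold_locales
sublocale lie_rep \<subseteq> E: vspace_char_0 scaleV by unfold_locales

context lie_rep
begin

definition proj :: "'v \<Rightarrow> 'v" where
  "proj = (SOME P. E.lin_on UNIV P \<and> range P \<subseteq> V \<and> (\<forall>w\<in>V. P w = w))"

text \<open>The projection onto V makes the action additive on the whole type, with values in V, so
  that it is a member of \<open>E.Lin V\<close>.\<close>

definition op :: "'a \<Rightarrow> 'v endo" where
  "op x = Abs_endo (\<lambda>v. \<rho> x (proj v))"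

definition form :: "'a \<Rightarrow> 'a \<Rightarrow> 'k" where
  "form x y = E.tr V (op x * op y)"

lemma sub_V: "V.subspace V"
  by (rule E.fin_dim_subspace_carrier[OF V_fin_dim])

lemma proj: "E.lin_on UNIV proj" "proj v \<in> V" "w \<in> V \<Longrightarrow> proj w = w"
proof -
  have *: "E.lin_on UNIV proj \<and> range proj \<subseteq> V \<and> (\<forall>w\<in>V. proj w = w)"
    unfolding proj_def by (rule someI_ex[OF E.ex_projection[OF sub_V]])
  then show "E.lin_on UNIV proj" "proj v \<in> V" "w \<in> V \<Longrightarrow> proj w = w" by auto
qed

lemma app_op: "x \<in> h \<Longrightarrow> app (op x) v = \<rho> x (proj v)"
  unfolding op_def
  by (subst Abs_endo_inverse) (auto simp: E.lin_onD(1)[OF proj(1)] rho_add_right proj(2))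

lemma app_op_V: "x \<in> h \<Longrightarrow> v \<in> V \<Longrightarrow> app (op x) v = \<rho> x v"
  by (simp add: app_op proj(3))

lemma op_Lin: "x \<in> h \<Longrightarrow> op x \<in> E.Lin V"
  by (simp add: E.Lin_def app_op rho_closed proj(2) E.lin_onD(2)[OF proj(1)] rho_scale_right)

lemma op_LinU: "x \<in> h \<Longrightarrow> op x \<in> E.Lin UNIV"
  by (rule E.Lin_UNIV[OF op_Lin])

lemma op_add: "x \<in> h \<Longrightarrow> y \<in> h \<Longrightarrow> op (x + y) = op x + op y"
  by (rule endo_eqI) (simp add: app_op subspace_add[OF subspace_carrier] rho_add_left proj(2))

lemma op_scale: "x \<in> h \<Longrightarrow> op (scale c x) = E.escale c (op x)"
  by (rule endo_eqI) (simp add: app_op subspace_scale[OF subspace_carrier] rho_scale_left proj(2))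

lemma op_0: "op 0 = 0"
  by (rule endo_eqI)
    (use rho_scale_left[OF subspace_0[OF subspace_carrier] proj(2), of 0] in
      \<open>simp add: app_op subspace_0[OF subspace_carrier]\<close>)

lemma op_sum: "(\<And>i. i \<in> I \<Longrightarrow> f i \<in> h) \<Longrightarrow> op (sum f I) = (\<Sum>i\<in>I. op (f i))"
proof (induction I rule: infinite_finite_induct)
  case (insert x F)
  then have "sum f F \<in> h" by (intro subspace_sum[OF subspace_carrier]) auto
  then show ?case using insert by (simp add: op_add)
qed (simp_all add: op_0)

lemma op_bracket: "x \<in> h \<Longrightarrow> y \<in> h \<Longrightarrow> op (bracket x y) = op x * op y - op y * op x"
  by (rule endo_eqI) (simp add: app_op bracket_closed rho_bracket proj(2,3) rho_closed)

lemma op_eqI: "x \<in> h \<Longrightarrow> y \<in> h \<Longrightarrow> (\<And>v. v \<in> V \<Longrightarrow> \<rho> x v = \<rho> y v) \<Longrightarrow> op x = op y"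
  by (rule endo_eqI) (simp add: app_op proj(2))

lemma app_op_power: "x \<in> h \<Longrightarrow> v \<in> V \<Longrightarrow> app (op x ^ m) v = (\<rho> x ^^ m) v \<and> (\<rho> x ^^ m) v \<in> V"
  by (induction m) (simp_all add: app_op_V rho_closed)

lemma op_nilpotent_iff:
  assumes x: "x \<in> h"
  shows "(\<exists>m. \<forall>v\<in>V. (\<rho> x ^^ m) v = 0) \<longleftrightarrow> (\<exists>m. op x ^ m = 0)"
proof
  assume "\<exists>m. \<forall>v\<in>V. (\<rho> x ^^ m) v = 0"
  then obtain m where m: "\<forall>v\<in>V. (\<rho> x ^^ m) v = 0" by (rule exE)
  \<comment> \<open>One factor is spent on moving an arbitrary vector into V.\<close>
  have "op x ^ Suc m = 0"
  proof (rule endo_eqI)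
    fix v
    have "app (op x ^ m) (app (op x) v) = 0"
      using app_op_power[OF x E.Lin_in[OF op_Lin[OF x]], of m v] m E.Lin_in[OF op_Lin[OF x]] by simp
    then show "app (op x ^ Suc m) v = app 0 v" by (simp only: power_Suc2 app_simps)
  qed
  then show "\<exists>m. op x ^ m = 0" by (rule exI)
next
  assume "\<exists>m. op x ^ m = 0"
  then obtain m where m: "op x ^ m = 0" by (rule exE)
  have "(\<rho> x ^^ m) v = 0" if "v \<in> V" for v using app_op_power[OF x that, of m] m by simp
  then show "\<exists>m. \<forall>v\<in>V. (\<rho> x ^^ m) v = 0" by blast
qed

lemma form_add: "x \<in> h \<Longrightarrow> y \<in> h \<Longrightarrow> z \<in> h \<Longrightarrow> form (x + y) z = form x z + form y z"
  unfolding form_def op_add distrib_right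
  by (simp add: op_add distrib_right E.tr_add[OF V_fin_dim] E.Lin_mult' op_Lin)

lemma form_scale: "x \<in> h \<Longrightarrow> z \<in> h \<Longrightarrow> form (scale c x) z = c * form x z"
  by (simp add: form_def op_scale E.escale_mult_left E.tr_scale[OF V_fin_dim] E.Lin_mult' op_Lin)

lemma form_commute: "x \<in> h \<Longrightarrow> y \<in> h \<Longrightarrow> form x y = form y x"
  unfolding form_def by (rule E.tr_commute[OF V_fin_dim op_Lin op_Lin])

lemma form_invariant:
  assumes "x \<in> h" "y \<in> h" "z \<in> h" shows "form (bracket x y) z = form x (bracket y z)"
proof -
  note L = assms[THEN op_Lin]
  have "E.tr V (op y * op x * op z) = E.tr V (op x * op z * op y)"
    using E.tr_commute[OF V_fin_dim L(2) E.Lin_mult'[OF L(1,3)]] by (simp add: mult.assoc)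
  then show ?thesis
    by (simp add: form_def op_bracket assms left_diff_distrib right_diff_distrib
        E.tr_diff[OF V_fin_dim] E.Lin_mult' L mult.assoc)
qed

definition subalg :: "'a set \<Rightarrow> bool" where
  "subalg m \<longleftrightarrow> m \<subseteq> h \<and> subspace m \<and> (\<forall>x\<in>m. \<forall>y\<in>m. bracket x y \<in> m) \<and> fin_dim scale m"

lemma nil_set_op:
  assumes m: "subalg m" and nil: "\<And>x. x \<in> m \<Longrightarrow> \<exists>k. op x ^ k = 0"
  shows "E.nil_set (op ` m)"
proof -
  interpret EE: vspace E.escale by (rule E.vspace_escale)
  have mh: "m \<subseteq> h" "subspace m" and mm: "\<And>x y. x \<in> m \<Longrightarrow> y \<in> m \<Longrightarrow> bracket x y \<in> m"
    using m by (auto simp: subalg_def)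
  obtain B where B: "finite B" "m = span B" using m by (auto simp: subalg_def fin_dim_def)
  have sub: "EE.subspace (op ` m)"
    unfolding EE.subspace_def
  proof (intro conjI ballI allI)
    show "0 \<in> op ` m" using op_0 subspace_0[OF mh(2)] by (metis imageI)
  next
    fix s t assume "s \<in> op ` m" "t \<in> op ` m"
    then obtain x y where "x \<in> m" "y \<in> m" "s = op x" "t = op y" by blast
    then have "s + t = op (x + y)" "x + y \<in> m"
      using op_add[of x y] subsetD[OF mh(1)] subspace_add[OF mh(2)] by simp_all
    then show "s + t \<in> op ` m" by blast
  next
    fix c s assume "s \<in> op ` m"
    then obtain x where "x \<in> m" "s = op x" by blast
    then have "E.escale c s = op (scale c x)" "scale c x \<in> m"
      using mh subspace_scale[OF mh(2)] op_scale[of x c] by auto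
    then show "E.escale c s \<in> op ` m" by blast
  qed
  have "op x \<in> EE.span (op ` B)" if "x \<in> span B" for x
  proof -
    have "x \<in> m \<and> op x \<in> EE.span (op ` B)" using that
    proof (induction rule: span_induct_alt)
      case base
      then show ?case using op_0 EE.span_zero subspace_0[OF mh(2)] by simp
    next
      case (step c x y)
      then have x: "x \<in> m" "scale c x \<in> m"
        using B(2) span_base subspace_scale[OF mh(2)] by auto
      have "op (scale c x + y) = E.escale c (op x) + op y"
        using op_add[of "scale c x" y] op_scale[of x c] subsetD[OF mh(1)] x step by simp
      moreover have "op x \<in> EE.span (op ` B)" using step by (intro EE.span_base) simp
      ultimately show ?case
        using EE.span_add EE.span_scale step subspace_add[OF mh(2) x(2)] by metis
    qed
    then show ?thesis ..
  qed
  moreover have "EE.span (op ` B) \<subseteq> op ` m"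
    using EE.span_minimal[OF _ sub] B(2) span_superset by (metis image_mono)
  ultimately have "op ` m = EE.span (op ` B)" using B(2) by blast
  then have fd: "fin_dim E.escale (op ` m)" unfolding fin_dim_def using B(1) by blast
  show ?thesis
  proof (rule E.engel[OF _ sub fd])
    show "op ` m \<subseteq> E.Lin UNIV" using mh op_LinU by blast
    show "s * t - t * s \<in> op ` m" if st: "s \<in> op ` m" "t \<in> op ` m" for s t
    proof -
      obtain x y where xy: "x \<in> m" "y \<in> m" "s = op x" "t = op y" using st by blast
      then have "s * t - t * s = op (bracket x y)"
        using op_bracket[of x y] subsetD[OF mh(1)] by simp
      then show ?thesis using mm[OF xy(1,2)] by blast
    qed
  qed (use nil in blast)
qed

lemma op_normalizes:
  assumes "m \<subseteq> h" "y \<in> h" "\<And>x. x \<in> m \<Longrightarrow> bracket y x \<in> m"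
  shows "E.normalizes (op y) (op ` m)"
  unfolding E.normalizes_def
proof
  fix t assume "t \<in> op ` m"
  then obtain x where x: "x \<in> m" "t = op x" by blast
  then have "op y * t - t * op y = op (bracket y x)"
    using op_bracket[OF assms(2) subsetD[OF assms(1) x(1)]] by simp
  then show "op y * t - t * op y \<in> op ` m" using assms(3)[OF x(1)] by blast
qed

lemma form_nil_normalizer:
  assumes m: "subalg m" and nil: "\<And>x. x \<in> m \<Longrightarrow> \<exists>k. op x ^ k = 0"
    and x: "x \<in> m" and y: "y \<in> h" "\<And>x. x \<in> m \<Longrightarrow> bracket y x \<in> m"
  shows "form x y = 0"
proof -
  have mh: "m \<subseteq> h" using m by (simp add: subalg_def)
  have "op ` m \<subseteq> E.Lin UNIV" using mh op_LinU by blast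
  from E.nil_set_mult_nilpotent[OF this nil_set_op[OF m nil] imageI[OF x] op_normalizes[OF mh y]]
  obtain k where "(op x * op y) ^ k = 0" by (rule exE)
  then show ?thesis unfolding form_def
    using mh x y by (intro E.tr_nilpotent[OF V_fin_dim E.Lin_mult'[OF op_Lin op_Lin]]) auto
qed

lemma op_nilpotent_add:
  assumes m: "subalg m" and nil: "\<And>x. x \<in> m \<Longrightarrow> \<exists>k. op x ^ k = 0"
    and x: "x \<in> m" and y: "y \<in> h" "\<And>x. x \<in> m \<Longrightarrow> bracket y x \<in> m" and ny: "\<exists>k. op y ^ k = 0"
  shows "\<exists>k. op (x + y) ^ k = 0"
proof -
  have mh: "m \<subseteq> h" using m by (simp add: subalg_def)
  obtain k where k: "op y ^ k = 0" using ny by (rule exE)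
  have L: "op ` m \<subseteq> E.Lin UNIV" using mh op_LinU by blast
  have "op (x + y) = op x + E.escale 1 (op y)"
    using mh x y(1) op_add[of x y] by (intro endo_eqI) auto
  then have "op (x + y) \<in> {t + E.escale c (op y) | t c. t \<in> op ` m}" using x by blast
  from E.nil_set_nilpotent[OF E.nil_set_extend[OF L nil_set_op[OF m nil] op_LinU[OF y(1)]
        op_normalizes[OF mh y] k] this]
  show ?thesis .
qed

text \<open>Cartan's criterion in terms of the trace form. Only \<open>op z\<close> has to be a sum
  of commutators: in \<open>perp_normalizer\<close> the element z differs from such a sum by an
  element of Q, which acts as zero.\<close>

lemma op_nilpotent_if_form:
  fixes n :: nat
  assumes a: "\<And>i. i < n \<Longrightarrow> a i \<in> h" and b: "\<And>i. i < n \<Longrightarrow> b i \<in> h"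
    and z: "z \<in> h" "op z = (\<Sum>i<n. op (bracket (a i) (b i)))"
    and 0: "\<And>i j. i < n \<Longrightarrow> N \<le> j \<Longrightarrow> form (b i) ((bracket z ^^ j) (a i)) = 0"
  shows "\<exists>k. op z ^ k = 0"
proof (rule E.nilpotent_if_trace_ad[OF V_fin_dim finite_lessThan[of n], where N = N])
  show "op (a i) \<in> E.Lin V" "op (b i) \<in> E.Lin V" if "i \<in> {..<n}" for i using that a b by (auto intro: op_Lin)
  show "op z = (\<Sum>i<n. op (a i) * op (b i) - op (b i) * op (a i))"
    unfolding z(2) by (intro sum.cong refl op_bracket) (use a b in auto)
  fix j assume "N \<le> j"
  have adj: "(bracket z ^^ j) x \<in> h \<and> op ((bracket z ^^ j) x) = (ad (op z) ^^ j) (op x)" if "x \<in> h" for j x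
    by (induction j) (use that z(1) in \<open>auto simp: bracket_closed op_bracket ad_def\<close>)
  show "(\<Sum>i<n. E.tr V (op (b i) * (ad (op z) ^^ j) (op (a i)))) = 0"
  proof (rule sum.neutral, rule ballI)
    fix i assume "i \<in> {..<n}"
    then show "E.tr V (op (b i) * (ad (op z) ^^ j) (op (a i))) = 0"
      using 0[OF _ \<open>N \<le> j\<close>, of i] adj[OF a, of i j] by (simp add: form_def)
  qed
qed

end

subsection \<open>The radical and the trace form\<close>

locale fd_lie = lie_algebra scale bracket g
  for scale :: "'k::field_char_0 \<Rightarrow> 'a::ab_group_add \<Rightarrow> 'a"
    and bracket :: "'a \<Rightarrow> 'a \<Rightarrow> 'a" and g :: "'a set" +
  assumes fin: "fin_dim scale g"

sublocale fd_lie \<subseteq> L: vspace_char_0 scale by unfold_locales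

context fd_lie
begin

abbreviation cone :: "'a set" where "cone \<equiv> nilpotent_cone scale bracket g"

definition D :: "'a set" where "D = span {bracket a b | a b. a \<in> g \<and> b \<in> g}"

definition ideal :: "'a set \<Rightarrow> bool" where
  "ideal I \<longleftrightarrow> subspace I \<and> I \<subseteq> g \<and> (\<forall>x\<in>g. \<forall>y\<in>I. bracket x y \<in> I)"

lemma bracket_0: "x \<in> g \<Longrightarrow> bracket x 0 = 0" "x \<in> g \<Longrightarrow> bracket 0 x = 0"
  using bracket_scale_right[of x 0 0] bracket_scale_left[of 0 x 0] subspace_0[OF subspace_carrier]
  by simp_all

lemma bracket_anti: "x \<in> g \<Longrightarrow> y \<in> g \<Longrightarrow> bracket x y = - bracket y x"
  using bracket_self[of "x + y"] bracket_self[of x] bracket_self[of y] subspace_add[OF subspace_carrier, of x y]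
  by (simp add: bracket_add_left bracket_add_right add_eq_0_iff)

lemma bracket_minus: "x \<in> g \<Longrightarrow> y \<in> g \<Longrightarrow> bracket (- x) y = - bracket x y"
    "x \<in> g \<Longrightarrow> y \<in> g \<Longrightarrow> bracket x (- y) = - bracket x y"
  using bracket_scale_left[of x y "-1"] bracket_scale_right[of x y "-1"] by simp_all

lemma bracket_diff:
  "x \<in> g \<Longrightarrow> y \<in> g \<Longrightarrow> z \<in> g \<Longrightarrow> bracket (x - y) z = bracket x z - bracket y z"
  "x \<in> g \<Longrightarrow> y \<in> g \<Longrightarrow> z \<in> g \<Longrightarrow> bracket x (y - z) = bracket x y - bracket x z"
  using bracket_add_left[of x "- y" z] bracket_add_right[of x y "- z"] subspace_neg[OF subspace_carrier]
  by (simp_all add: bracket_minus)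

lemma jacobi_left:
  assumes "x \<in> g" "y \<in> g" "z \<in> g"
  shows "bracket (bracket x y) z = bracket x (bracket y z) - bracket y (bracket x z)"
proof -
  have "bracket z (bracket x y) = - bracket (bracket x y) z"
    by (rule bracket_anti) (use assms bracket_closed in auto)
  moreover have "bracket y (bracket z x) = - bracket y (bracket x z)"
    using bracket_anti[of z x] bracket_minus(2)[of y "bracket x z"] assms bracket_closed by simp
  ultimately show ?thesis using jacobi[OF assms] by (simp add: algebra_simps)
qed

lemma bracket_pow_closed: "x \<in> g \<Longrightarrow> y \<in> g \<Longrightarrow> (bracket x ^^ n) y \<in> g"
  by (induction n) (auto intro: bracket_closed)

lemma D_g: "D \<subseteq> g"
  unfolding D_def by (rule span_minimal[OF _ subspace_carrier]) (auto intro: bracket_closed)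

lemma D_subspace: "subspace D"
  unfolding D_def by (rule subspace_span)

lemma D_bracket: "x \<in> g \<Longrightarrow> y \<in> g \<Longrightarrow> bracket x y \<in> D"
  unfolding D_def by (rule span_base) blast

lemma span_bracket_sum:
  assumes "x \<in> span {bracket a b | a b. a \<in> A \<and> b \<in> B}" "subspace A" "A \<subseteq> g" "B \<subseteq> g"
  shows "\<exists>(n::nat) h k. (\<forall>i<n. h i \<in> A \<and> k i \<in> B) \<and> x = (\<Sum>i<n. bracket (h i) (k i))"
proof (rule L.span_pair_sum[OF assms(1)])
  fix a c assume a: "a \<in> A"
  have "\<forall>b\<in>B. bracket (scale c a) b = scale c (bracket a b)"
    using bracket_scale_left[OF subsetD[OF assms(3) a]] subsetD[OF assms(4)] by blast
  then show "\<exists>a'\<in>A. \<forall>b\<in>B. bracket a' b = scale c (bracket a b)"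
    using subspace_scale[OF assms(2) a] by blast
qed

lemma cone_g: "cone \<subseteq> g"
  by (auto simp: nilpotent_cone_def)

lemma cone_rep:
  assumes "x \<in> cone" "lie_rep scale bracket g scaleV V \<rho>"
  shows "\<exists>k. lie_rep.op scaleV V \<rho> x ^ k = 0"
proof -
  interpret W: lie_rep scale bracket g scaleV V \<rho> by fact
  show ?thesis
    using W.op_nilpotent_iff[of x] nilpotent_cone_any[OF assms(1) W.lie_representation_axioms] assms(1) cone_g
    by blast
qed

lemma coneI:
  assumes "x \<in> g"
    and "\<And>V \<rho>. lie_rep scale bracket g (fun_scale :: 'k \<Rightarrow> _) V \<rho> \<Longrightarrow> \<exists>k. lie_rep.op fun_scale V \<rho> x ^ k = 0"
  shows "x \<in> cone"
  unfolding nilpotent_cone_def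
proof (intro CollectI conjI allI impI assms(1))
  fix V and \<rho> :: "'a \<Rightarrow> (nat \<Rightarrow> 'k) \<Rightarrow> nat \<Rightarrow> 'k"
  assume "lie_representation scale bracket g fun_scale V \<rho>"
  then interpret W: lie_rep scale bracket g fun_scale V \<rho> by (simp add: lie_rep_def)
  show "\<exists>m. \<forall>v\<in>V. (\<rho> x ^^ m) v = 0"
    using W.op_nilpotent_iff[OF assms(1)] assms(2)[OF W.lie_rep_axioms] by simp
qed

section \<open>Nil subalgebras and closure properties of the nilpotent cone\<close>

definition nilsub :: "'a set \<Rightarrow> bool" where
  "nilsub m \<longleftrightarrow> subspace m \<and> (\<forall>x\<in>m. \<forall>y\<in>m. bracket x y \<in> m) \<and> m \<subseteq> cone"

lemma nilsubD:
  assumes "nilsub m"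
  shows "subspace m" "\<And>x y. x \<in> m \<Longrightarrow> y \<in> m \<Longrightarrow> bracket x y \<in> m" "m \<subseteq> cone" "m \<subseteq> g" "fin_dim scale m"
  using assms cone_g L.fin_dim_subspace[OF fin] by (auto simp: nilsub_def)

text \<open>The cone is not closed under sums in general. Here the flag of m in any representation
  is preserved by y, and \<open>nil_set_extend\<close> applies.\<close>

lemma cone_add_normalizer:
  assumes m: "nilsub m" and x: "x \<in> m" and y: "y \<in> cone" "\<And>x. x \<in> m \<Longrightarrow> bracket y x \<in> m"
  shows "x + y \<in> cone"
proof (rule coneI)
  have xy: "x \<in> g" "y \<in> g" using nilsubD(4)[OF m] x y(1) cone_g by auto
  then show "x + y \<in> g" by (rule subspace_add[OF subspace_carrier])
  fix V and \<rho> :: "'a \<Rightarrow> (nat \<Rightarrow> 'k) \<Rightarrow> nat \<Rightarrow> 'k"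
  assume "lie_rep scale bracket g fun_scale V \<rho>"
  then interpret W: lie_rep scale bracket g fun_scale V \<rho> .
  show "\<exists>k. W.op (x + y) ^ k = 0"
  proof (rule W.op_nilpotent_add[OF _ _ x xy(2) y(2)])
    show "W.subalg m" using nilsubD[OF m] by (simp add: W.subalg_def)
    show "\<exists>k. W.op x ^ k = 0" if "x \<in> m" for x
      using cone_rep[OF _ W.lie_rep_axioms] nilsubD(3)[OF m] that by blast
    show "\<exists>k. W.op y ^ k = 0" by (rule cone_rep[OF y(1) W.lie_rep_axioms])
  qed
qed

lemma cone_0: "0 \<in> cone"
proof (rule coneI[OF subspace_0[OF subspace_carrier]])
  fix V and \<rho> :: "'a \<Rightarrow> (nat \<Rightarrow> 'k) \<Rightarrow> nat \<Rightarrow> 'k"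
  assume "lie_rep scale bracket g fun_scale V \<rho>"
  then interpret W: lie_rep scale bracket g fun_scale V \<rho> .
  show "\<exists>k. W.op 0 ^ k = 0" by (intro exI[of _ 1]) (simp add: W.op_0)
qed

lemma cone_scale:
  assumes "x \<in> cone" shows "scale c x \<in> cone"
proof (rule coneI)
  have x: "x \<in> g" using assms cone_g by blast
  then show "scale c x \<in> g" by (rule subspace_scale[OF subspace_carrier])
  fix V and \<rho> :: "'a \<Rightarrow> (nat \<Rightarrow> 'k) \<Rightarrow> nat \<Rightarrow> 'k"
  assume "lie_rep scale bracket g fun_scale V \<rho>"
  then interpret W: lie_rep scale bracket g fun_scale V \<rho> .
  interpret EE: vspace W.E.escale by (rule W.E.vspace_escale)
  obtain k where k: "W.op x ^ k = 0" by (rule exE[OF cone_rep[OF assms W.lie_rep_axioms]])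
  have "W.E.escale c (W.op x) ^ n = W.E.escale (c ^ n) (W.op x ^ n)" for n
    by (induction n)
      (simp_all add: W.E.escale_mult_left W.E.Lin_escale_mult[OF W.op_LinU[OF x]] mult.commute)
  then have "W.op (scale c x) ^ k = 0" by (simp add: W.op_scale[OF x] k)
  then show "\<exists>k. W.op (scale c x) ^ k = 0" by (rule exI)
qed

text \<open>A functional that vanishes on D is a one-dimensional representation. If x were outside
  D, one of these would let x act as 1.\<close>

lemma cone_D: "cone \<subseteq> D"
proof
  fix x assume x: "x \<in> cone"
  show "x \<in> D"
  proof (rule ccontr)
    assume "x \<notin> D"
    from L.ex_functional[OF D_subspace this] obtain f where
      f: "L.functional f \<and> (\<forall>w\<in>D. f w = 0) \<and> f x = 1" by (rule exE)
    then have "L.functional f" by blast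
    note fl = L.functionalD[OF this]
    interpret k: vector_space "(*) :: 'k \<Rightarrow> 'k \<Rightarrow> 'k" by unfold_locales (auto simp: algebra_simps)
    have "x \<in> k.span {1}" for x :: 'k
      using k.span_scale[OF k.span_base[of 1 "{1}"], of x] by simp
    then have "UNIV = k.span {1 :: 'k}" by blast
    then have "fin_dim (*) (UNIV :: 'k set)" unfolding fin_dim_def by (intro exI[of _ "{1}"]) simp
    moreover have "f (bracket y z) = 0" if "y \<in> g" "z \<in> g" for y z using f D_bracket[OF that] by blast
    ultimately have "lie_rep scale bracket g (*) (UNIV :: 'k set) (\<lambda>x v. f x * v)"
      by unfold_locales (simp_all only: fl UNIV_I distrib_left distrib_right mult.assoc mult.left_commute
        mult_zero_left diff_self)
    then interpret W: lie_rep scale bracket g "(*)" "UNIV :: 'k set" "\<lambda>x v. f x * v" .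
    have one: "((\<lambda>v. f x * v) ^^ m) 1 = 1" for m by (induction m) (simp_all add: f)
    obtain m where "\<forall>v\<in>UNIV. ((\<lambda>v. f x * v) ^^ m) v = 0"
      by (rule exE[OF nilpotent_cone_any[OF x W.lie_representation_axioms]])
    from bspec[OF this UNIV_I, of 1] show False unfolding one by simp
  qed
qed

end

locale lie_quot = fd_lie scale bracket g
  for scale :: "'k::field_char_0 \<Rightarrow> 'a::ab_group_add \<Rightarrow> 'a"
    and bracket :: "'a \<Rightarrow> 'a \<Rightarrow> 'a" and g :: "'a set" +
  fixes Q :: "'a set"
  assumes Q: "ideal Q" and DQ: "D \<inter> Q \<subseteq> cone"
begin

lemma Q': "subspace Q" "Q \<subseteq> g" "\<And>x y. x \<in> g \<Longrightarrow> y \<in> Q \<Longrightarrow> bracket x y \<in> Q"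
  "\<And>x y. x \<in> g \<Longrightarrow> y \<in> Q \<Longrightarrow> bracket y x \<in> Q"
proof -
  show *: "subspace Q" "Q \<subseteq> g" "\<And>x y. x \<in> g \<Longrightarrow> y \<in> Q \<Longrightarrow> bracket x y \<in> Q"
    using Q by (auto simp: ideal_def)
  show "bracket y x \<in> Q" if "x \<in> g" "y \<in> Q" for x y
    using bracket_anti[of y x] *(2) *(3)[OF that] subspace_neg[OF *(1)] that by auto
qed

definition PQ :: "'a \<Rightarrow> 'a" where
  "PQ = (SOME P. L.lin_on UNIV P \<and> range P \<subseteq> Q \<and> (\<forall>w\<in>Q. P w = w))"

text \<open>\<open>\<pi>\<close> plays the quotient map g \<rightarrow> g / Q, with the complement
  \<open>U\<close> of Q in the place of the quotient. \<open>R\<close> below is the adjoint action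
  on it.\<close>

definition \<pi> :: "'a \<Rightarrow> 'a" where "\<pi> x = x - PQ x"

definition U :: "'a set" where "U = \<pi> ` g"

lemma PQ: "L.lin_on UNIV PQ" "PQ v \<in> Q" "w \<in> Q \<Longrightarrow> PQ w = w"
proof -
  have *: "L.lin_on UNIV PQ \<and> range PQ \<subseteq> Q \<and> (\<forall>w\<in>Q. PQ w = w)"
    unfolding PQ_def by (rule someI_ex[OF L.ex_projection[OF Q'(1)]])
  then show "L.lin_on UNIV PQ" "PQ v \<in> Q" "w \<in> Q \<Longrightarrow> PQ w = w" by auto
qed

lemma \<pi>_add: "\<pi> (x + y) = \<pi> x + \<pi> y"
  using L.lin_onD(1)[OF PQ(1), of x y] by (simp add: \<pi>_def)

lemma \<pi>_scale: "\<pi> (scale c x) = scale c (\<pi> x)"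
  using L.lin_onD(2)[OF PQ(1), of x c] by (simp add: \<pi>_def scale_right_diff_distrib)

lemma \<pi>_diff: "\<pi> (x - y) = \<pi> x - \<pi> y"
  using \<pi>_add[of "x - y" y] by (simp add: eq_diff_eq)

lemma \<pi>_0_iff: "\<pi> x = 0 \<longleftrightarrow> x \<in> Q"
  using PQ(2)[of x] PQ(3)[of x] by (auto simp: \<pi>_def)

lemma \<pi>_mod: "x - \<pi> x \<in> Q"
  using PQ(2) by (simp add: \<pi>_def)

lemma \<pi>_g: "x \<in> g \<Longrightarrow> \<pi> x \<in> g"
  unfolding \<pi>_def using PQ(2) Q'(2) by (intro subspace_diff[OF subspace_carrier]) auto

lemma \<pi>_U: "x \<in> g \<Longrightarrow> \<pi> x \<in> U"
  by (simp add: U_def)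

lemma \<pi>_eq: "x - y \<in> Q \<Longrightarrow> \<pi> x = \<pi> y"
  using \<pi>_0_iff[of "x - y"] by (simp add: \<pi>_diff)

lemma \<pi>_idem: "\<pi> (\<pi> x) = \<pi> x"
  using subspace_neg[OF Q'(1) \<pi>_mod[of x]] by (intro \<pi>_eq) simp

lemma \<pi>_on_U: "u \<in> U \<Longrightarrow> \<pi> u = u"
  by (auto simp: U_def \<pi>_idem)

lemma U_g: "U \<subseteq> g"
  using \<pi>_g by (auto simp: U_def)

lemma U_subspace: "subspace U"
  unfolding U_def by (rule L.subspace_lin_image[OF _ subspace_carrier]) (simp add: L.lin_on_def \<pi>_add \<pi>_scale)

lemma U_fin: "fin_dim scale U"
  by (rule L.fin_dim_subspace[OF fin U_subspace U_g])

lemma \<pi>_bracket: "x \<in> g \<Longrightarrow> y \<in> g \<Longrightarrow> \<pi> (bracket x (\<pi> y)) = \<pi> (bracket x y)"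
  using Q'(3)[of x "y - \<pi> y"] \<pi>_mod[of y] \<pi>_g[of y] subspace_neg[OF Q'(1)]
  by (intro \<pi>_eq) (metis bracket_diff(2) minus_diff_eq)

lemma rep_U: "lie_rep scale bracket g scale U (\<lambda>x u. \<pi> (bracket x u))"
proof unfold_locales
  show "fin_dim scale U" by (rule U_fin)
  fix x u c assume x: "x \<in> g" and u': "u \<in> U"
  then have u: "u \<in> g" using U_g by blast
  show "\<pi> (bracket x u) \<in> U" by (rule \<pi>_U[OF bracket_closed[OF x u]])
  show "\<pi> (bracket x (scale c u)) = scale c (\<pi> (bracket x u))"
    "\<pi> (bracket (scale c x) u) = scale c (\<pi> (bracket x u))"
    by (simp_all add: bracket_scale_right[OF x u] bracket_scale_left[OF x u] \<pi>_scale)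
  show "\<pi> (bracket x (u + w)) = \<pi> (bracket x u) + \<pi> (bracket x w)" if "w \<in> U" for w
    using bracket_add_right[OF x u, of w] U_g that by (auto simp: \<pi>_add)
  fix y assume y: "y \<in> g"
  show "\<pi> (bracket (x + y) u) = \<pi> (bracket x u) + \<pi> (bracket y u)"
    by (simp add: bracket_add_left[OF x y u] \<pi>_add)
  show "\<pi> (bracket (bracket x y) u) = \<pi> (bracket x (\<pi> (bracket y u))) - \<pi> (bracket y (\<pi> (bracket x u)))"
    by (simp add: jacobi_left[OF x y u] \<pi>_diff \<pi>_bracket x y u bracket_closed)
qed

sublocale R: lie_rep scale bracket g scale U "\<lambda>x u. \<pi> (bracket x u)"
  by (rule rep_U)

abbreviation \<kappa> :: "'a \<Rightarrow> 'a \<Rightarrow> 'k" where "\<kappa> \<equiv> R.form"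

lemma app_op_\<pi>: "x \<in> g \<Longrightarrow> y \<in> g \<Longrightarrow> app (R.op x) (\<pi> y) = \<pi> (bracket x y)"
  by (simp add: R.app_op_V \<pi>_U \<pi>_bracket)

lemma op_Q: "q \<in> Q \<Longrightarrow> R.op q = 0"
proof -
  assume q: "q \<in> Q"
  have "R.op q = R.op 0"
  proof (rule R.op_eqI)
    fix u assume "u \<in> U"
    then have u: "u \<in> g" using U_g by blast
    have "\<pi> (bracket q u) = 0" using Q'(4)[OF u q] by (simp add: \<pi>_0_iff)
    moreover have "\<pi> (bracket 0 u) = 0" using bracket_0(2)[OF u] subspace_0[OF Q'(1)] by (simp add: \<pi>_0_iff)
    ultimately show "\<pi> (bracket q u) = \<pi> (bracket 0 u)" by simp
  qed (use q Q'(2) subspace_0[OF subspace_carrier] in auto)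
  then show ?thesis by (simp add: R.op_0)
qed

lemma \<kappa>_Q: "q \<in> Q \<Longrightarrow> y \<in> g \<Longrightarrow> \<kappa> q y = 0" "q \<in> Q \<Longrightarrow> y \<in> g \<Longrightarrow> \<kappa> y q = 0"
  using op_Q R.form_commute Q'(2) by (auto simp: R.form_def L.tr_0[OF U_fin])

lemma \<pi>_bracket_pow: "x \<in> g \<Longrightarrow> y \<in> g \<Longrightarrow> \<pi> ((bracket x ^^ n) y) = app (R.op x ^ n) (\<pi> y)"
  by (induction n) (simp_all add: app_op_\<pi>[symmetric] bracket_pow_closed)

lemma DQ_ideal: "subspace (D \<inter> Q)" "D \<inter> Q \<subseteq> g" "\<And>x y. x \<in> g \<Longrightarrow> y \<in> Q \<Longrightarrow> bracket x y \<in> D \<inter> Q"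
  using subspace_inter[OF D_subspace Q'(1)] Q' D_bracket by auto

lemma DQ_nilsub: "nilsub (D \<inter> Q)"
  using DQ_ideal DQ by (auto simp: nilsub_def)

text \<open>
  A nilpotent action on \<open>g / Q\<close> suffices: high powers of \<open>ad x\<close> map \<open>g\<close> into the nil ideal
  \<open>D \<inter> Q\<close>, which is orthogonal to everything for every trace form.
\<close>
lemma cone_if_op_nilpotent:
  assumes x: "x \<in> D" and nil: "\<exists>k. R.op x ^ k = 0"
  shows "x \<in> cone"
proof (rule coneI)
  show xg: "x \<in> g" using x D_g by blast
  obtain k where k: "R.op x ^ k = 0" using nil by (rule exE)
  fix V and \<rho> :: "'a \<Rightarrow> (nat \<Rightarrow> 'k) \<Rightarrow> nat \<Rightarrow> 'k"
  assume "lie_rep scale bracket g fun_scale V \<rho>"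
  then interpret W: lie_rep scale bracket g fun_scale V \<rho> .
  obtain n :: nat and a b where ab: "\<forall>i<n. a i \<in> g \<and> b i \<in> g" and xs: "x = (\<Sum>i<n. bracket (a i) (b i))"
    using span_bracket_sum[OF x[unfolded D_def] subspace_carrier order_refl order_refl]
    by (elim exE conjE) (rule that)
  show "\<exists>k. W.op x ^ k = 0"
  \<comment> \<open>After k brackets with x the result is in Q; one more puts it into D as well,
    hence \<open>Suc k\<close>.\<close>
  proof (rule W.op_nilpotent_if_form[where n = n and a = a and b = b and N = "Suc k"])
    show "a i \<in> g" "b i \<in> g" if "i < n" for i using ab that by auto
    show "W.op x = (\<Sum>i<n. W.op (bracket (a i) (b i)))"
      unfolding xs by (rule W.op_sum) (use ab bracket_closed in auto)
    fix i j assume i: "i < n" and j: "Suc k \<le> j"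
    have a: "a i \<in> g" and b: "b i \<in> g" using ab i by auto
    have "\<pi> ((bracket x ^^ (j - 1)) (a i)) = app (R.op x ^ (j - 1)) (\<pi> (a i))"
      by (rule \<pi>_bracket_pow[OF xg a])
    also have "R.op x ^ (j - 1) = R.op x ^ (j - 1 - k) * R.op x ^ k"
      using j by (simp flip: power_add)
    finally have "(bracket x ^^ (j - 1)) (a i) \<in> Q" using k by (simp add: \<pi>_0_iff)
    then have "bracket x ((bracket x ^^ (j - 1)) (a i)) \<in> D \<inter> Q" by (rule DQ_ideal(3)[OF xg])
    moreover have "bracket x ((bracket x ^^ (j - 1)) (a i)) = (bracket x ^^ j) (a i)"
      using j by (cases j) auto
    ultimately have y: "(bracket x ^^ j) (a i) \<in> D \<inter> Q" by simp
    have "W.form ((bracket x ^^ j) (a i)) (b i) = 0"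
    proof (rule W.form_nil_normalizer[OF _ _ y b])
      show "W.subalg (D \<inter> Q)" using nilsubD[OF DQ_nilsub] by (simp add: W.subalg_def)
      show "\<exists>k. W.op x ^ k = 0" if "x \<in> D \<inter> Q" for x
        using cone_rep[OF _ W.lie_rep_axioms] DQ that by blast
    qed (use DQ_ideal(3)[OF b] in blast)
    then show "W.form (b i) ((bracket x ^^ j) (a i)) = 0"
      using W.form_commute[OF b] bracket_pow_closed[OF xg a] by simp
  qed (rule xg)
qed

end

text \<open>
  \<open>Q\<close> is the solvable radical. Choosing it by this maximality property makes it at once the
  radical of the trace form of \<open>g / Q\<close>, see \<open>orthogonal_D\<close>.
\<close>
locale lie_rad = lie_quot scale bracket g Q
  for scale :: "'k::field_char_0 \<Rightarrow> 'a::ab_group_add \<Rightarrow> 'a"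
    and bracket :: "'a \<Rightarrow> 'a \<Rightarrow> 'a" and g Q :: "'a set" +
  assumes Q_max: "\<And>I. ideal I \<Longrightarrow> D \<inter> I \<subseteq> cone \<Longrightarrow> Q \<subseteq> I \<Longrightarrow> I = Q"
begin

lemma form_diff: "x \<in> g \<Longrightarrow> y \<in> g \<Longrightarrow> z \<in> g \<Longrightarrow> \<kappa> (x - y) z = \<kappa> x z - \<kappa> y z"
  using R.form_add[of "x - y" y z] subspace_diff[OF subspace_carrier] by (simp add: eq_diff_eq)

lemma form_add_right: "x \<in> g \<Longrightarrow> y \<in> g \<Longrightarrow> z \<in> g \<Longrightarrow> \<kappa> z (x + y) = \<kappa> z x + \<kappa> z y"
  using R.form_add[of x y z] R.form_commute subspace_add[OF subspace_carrier] by simp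

lemma form_scale_right: "x \<in> g \<Longrightarrow> z \<in> g \<Longrightarrow> \<kappa> z (scale c x) = c * \<kappa> z x"
  using R.form_scale[of x z c] R.form_commute subspace_scale[OF subspace_carrier] by simp

lemma form_0: "x \<in> g \<Longrightarrow> \<kappa> x 0 = 0" "x \<in> g \<Longrightarrow> \<kappa> 0 x = 0"
  using \<kappa>_Q subspace_0[OF Q'(1)] by auto

text \<open>By invariance the orthogonal J of D is an ideal. For x in D and J the form of [x, c]
  with b equals that of x with [c, b], which is zero, so x is nilpotent by Cartan's criterion. Thus
  J competes with Q, and maximality of Q gives equality.\<close>

lemma orthogonal_D: "{x \<in> g. \<forall>y\<in>D. \<kappa> x y = 0} = Q"
proof (rule Q_max)
  let ?J = "{x \<in> g. \<forall>y\<in>D. \<kappa> x y = 0}"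
  have Dg: "y \<in> g" if "y \<in> D" for y using that D_g by blast
  show "Q \<subseteq> ?J" using \<kappa>_Q Q'(2) Dg by auto
  show "ideal ?J"
    unfolding ideal_def subspace_def
  proof (intro conjI ballI allI)
    show "0 \<in> ?J" using subspace_0[OF subspace_carrier] form_0 Dg by auto
    show "x + y \<in> ?J" if "x \<in> ?J" "y \<in> ?J" for x y
      using that subspace_add[OF subspace_carrier] Dg by (auto simp: R.form_add)
    show "scale c x \<in> ?J" if "x \<in> ?J" for c x
      using that subspace_scale[OF subspace_carrier] Dg by (auto simp: R.form_scale)
    fix x y assume x: "x \<in> g" and y: "y \<in> ?J"
    have "\<kappa> (bracket x y) z = 0" if "z \<in> D" for z
    proof -
      have "\<kappa> (bracket y x) z = \<kappa> y (bracket x z)"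
        using R.form_invariant[of y x z] x y Dg[OF that] by simp
      also have "\<dots> = 0" using y D_bracket[OF x Dg[OF that]] by simp
      finally have "\<kappa> (bracket y x) z = 0" .
      moreover have "bracket x y = scale (-1) (bracket y x)" using bracket_anti[of x y] x y by simp
      ultimately show ?thesis using R.form_scale[of "bracket y x" z "-1"] x y Dg[OF that] bracket_closed by simp
    qed
    then show "bracket x y \<in> ?J" using x y bracket_closed by simp
  qed auto
  show "D \<inter> ?J \<subseteq> cone"
  proof
    fix x assume x: "x \<in> D \<inter> ?J"
    then have xg: "x \<in> g" by blast
    obtain n :: nat and a b where ab: "\<forall>i<n. a i \<in> g \<and> b i \<in> g" and xs: "x = (\<Sum>i<n. bracket (a i) (b i))"
      using span_bracket_sum[OF _ subspace_carrier order_refl order_refl, of x] x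
      by (simp add: D_def) (elim exE conjE, rule that)
    show "x \<in> cone"
    proof (rule cone_if_op_nilpotent)
      show "\<exists>k. R.op x ^ k = 0"
      proof (rule R.op_nilpotent_if_form[where n = n and a = a and b = b and N = 1])
        show "a i \<in> g" "b i \<in> g" if "i < n" for i using ab that by auto
        show "R.op x = (\<Sum>i<n. R.op (bracket (a i) (b i)))"
          unfolding xs by (rule R.op_sum) (use ab bracket_closed in auto)
        fix i j assume i: "i < n" and j: "1 \<le> (j::nat)"
        define c where "c = (bracket x ^^ (j - 1)) (a i)"
        have c: "c \<in> g" and b: "b i \<in> g" using ab i bracket_pow_closed[OF xg] by (auto simp: c_def)
        have "(bracket x ^^ j) (a i) = bracket x c" using j by (cases j) (auto simp: c_def)
        moreover have "\<kappa> (bracket x c) (b i) = \<kappa> x (bracket c (b i))"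
          by (rule R.form_invariant[OF xg c b])
        moreover have "\<dots> = 0" using x D_bracket[OF c b] by blast
        ultimately show "\<kappa> (b i) ((bracket x ^^ j) (a i)) = 0"
          using R.form_commute[OF b, of "bracket x c"] bracket_closed[OF xg c] by simp
      qed (rule xg)
    qed (use x in blast)
  qed
qed

text \<open>Suppose the coordinates of f on a basis of U were not those of any
  \<open>\<kappa> y\<close>. A functional \<open>\<Phi>\<close> separating them is, by biduality,
  evaluation at some u in U. This u is orthogonal to g, so it is in Q by \<open>orthogonal_D\<close>
  and therefore 0, although f u = 1.\<close>

lemma form_represents:
  assumes f: "L.functional f" "\<And>q. q \<in> Q \<Longrightarrow> f q = 0"
  shows "\<exists>y\<in>g. \<forall>x\<in>g. \<kappa> y x = f x"
proof -
  obtain B where B: "finite B" "independent B" "span B = U"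
    using L.fin_dim_basis[OF U_fin] by (elim exE conjE) (rule that)
  have BU: "b \<in> U" "b \<in> g" if "b \<in> B" for b
    using that B(3) span_base U_g by auto
  interpret F: vspace "\<lambda>c (\<phi> :: 'a \<Rightarrow> 'k) x. c * \<phi> x"
    by unfold_locales (auto simp: fun_eq_iff algebra_simps)
  define r where "r y = (\<lambda>b. if b \<in> B then \<kappa> y b else 0)" for y
  define W where "W = r ` g"
  have sW: "F.subspace W"
    unfolding F.subspace_def
  proof (intro conjI ballI allI)
    have "r 0 = 0" using BU form_0 by (auto simp: r_def)
    then show "0 \<in> W" unfolding W_def using subspace_0[OF subspace_carrier] by (metis imageI)
    fix u v assume "u \<in> W" "v \<in> W"
    then obtain x y where xy: "x \<in> g" "y \<in> g" "u = r x" "v = r y" by (auto simp: W_def)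
    then have "r (x + y) = u + v" using BU by (auto simp: r_def R.form_add)
    then show "u + v \<in> W" unfolding W_def using subspace_add[OF subspace_carrier xy(1,2)] by (metis imageI)
  next
    fix c u assume "u \<in> W"
    then obtain x where x: "x \<in> g" "u = r x" by (auto simp: W_def)
    then have "r (scale c x) = (\<lambda>b. c * u b)" using BU by (auto simp: r_def R.form_scale)
    then show "(\<lambda>b. c * u b) \<in> W" unfolding W_def using subspace_scale[OF subspace_carrier x(1)] by (metis imageI)
  qed
  define fB where "fB b = (if b \<in> B then f b else 0)" for b
  have "fB \<in> W"
  proof (rule ccontr)
    assume "fB \<notin> W"
    from F.ex_functional[OF sW this] obtain \<Phi> where
      \<Phi>: "F.functional \<Phi> \<and> (\<forall>w\<in>W. \<Phi> w = 0) \<and> \<Phi> fB = 1" by (rule exE)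
    note \<Phi>l = F.functionalD[of \<Phi>] F.functional_sum[of \<Phi>]
    define e where "e b = (\<lambda>x. if x = b then 1 else 0 :: 'k)" for b :: 'a
    have exp: "\<phi> = (\<Sum>b\<in>B. (\<lambda>x. \<phi> b * e b x))" if "\<And>x. x \<notin> B \<Longrightarrow> \<phi> x = 0" for \<phi>
    proof
      fix x
      have "(\<Sum>b\<in>B. \<phi> b * e b x) = (\<Sum>b\<in>B. if b = x then \<phi> x else 0)"
        by (intro sum.cong) (auto simp: e_def)
      then show "\<phi> x = (\<Sum>b\<in>B. (\<lambda>x. \<phi> b * e b x)) x"
        using that B(1) by (auto simp: sum_fun_apply)
    qed
    have \<Phi>exp: "\<Phi> \<phi> = (\<Sum>b\<in>B. \<phi> b * \<Phi> (e b))" if "\<And>x. x \<notin> B \<Longrightarrow> \<phi> x = 0" for \<phi>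
      using \<Phi> by (subst exp[OF that]) (simp_all add: \<Phi>l)
    \<comment> \<open>This is the vector at which \<open>\<Phi>\<close> evaluates.\<close>
    define u where "u = (\<Sum>b\<in>B. scale (\<Phi> (e b)) b)"
    have su: "scale (\<Phi> (e b)) b \<in> g" "scale (\<Phi> (e b)) b \<in> U" if "b \<in> B" for b
      using BU[OF that] subspace_scale[OF subspace_carrier] subspace_scale[OF U_subspace] by auto
    have u: "u \<in> g" "u \<in> U"
      unfolding u_def using su by (auto intro!: subspace_sum[OF subspace_carrier] subspace_sum[OF U_subspace])
    have "\<kappa> y u = 0" if y: "y \<in> g" for y
    proof -
      have "\<kappa> y u = (\<Sum>b\<in>B. \<kappa> y (scale (\<Phi> (e b)) b))"
        unfolding u_def using B(1) su(1)
      proof (induction B)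
        case (insert b F)
        have "(\<Sum>b\<in>F. scale (\<Phi> (e b)) b) \<in> g"
          by (rule subspace_sum[OF subspace_carrier]) (use insert in auto)
        then show ?case using insert y by (simp add: form_add_right)
      qed (simp add: form_0 y)
      also have "\<dots> = (\<Sum>b\<in>B. r y b * \<Phi> (e b))"
        by (intro sum.cong refl) (simp add: form_scale_right BU y r_def mult.commute)
      also have "\<dots> = \<Phi> (r y)" by (rule \<Phi>exp[symmetric]) (simp add: r_def)
      also have "\<dots> = 0" using \<Phi> y by (simp add: W_def)
      finally show ?thesis .
    qed
    then have "u \<in> {x \<in> g. \<forall>y\<in>D. \<kappa> x y = 0}" using u D_g R.form_commute by auto
    then have "u = 0" using u(2) \<pi>_on_U[OF u(2)] by (simp add: orthogonal_D \<pi>_0_iff[symmetric])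
    moreover have "f u = (\<Sum>b\<in>B. fB b * \<Phi> (e b))"
      unfolding u_def
      by (simp add: L.functional_sum[OF f(1)] L.functionalD[OF f(1)] fB_def mult.commute)
    moreover have "\<dots> = \<Phi> fB" by (rule \<Phi>exp[symmetric]) (simp add: fB_def)
    ultimately show False using \<Phi> L.functionalD(3)[OF f(1)] by simp
  qed
  then obtain y where y: "y \<in> g" "fB = r y" by (auto simp: W_def)
  have yb: "\<kappa> y b = f b" if "b \<in> B" for b using fun_cong[OF y(2), of b] that by (simp add: fB_def r_def)
  have yu: "u \<in> g \<and> \<kappa> y u = f u" if "u \<in> span B" for u
    using that
  proof (induction rule: span_induct_alt)
    case base
    then show ?case using y(1) form_0 subspace_0[OF subspace_carrier] L.functionalD(3)[OF f(1)] by simp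
  next
    case (step c b u)
    then show ?case
      using BU(2)[of b] y(1) subspace_scale[OF subspace_carrier, of b c] subspace_add[OF subspace_carrier]
      by (simp add: form_add_right form_scale_right yb L.functionalD[OF f(1)])
  qed
  have "\<kappa> y x = f x" if x: "x \<in> g" for x
  proof -
    have q: "x - \<pi> x \<in> Q" by (rule \<pi>_mod)
    have "\<kappa> y (\<pi> x + (x - \<pi> x)) = \<kappa> y (\<pi> x)"
      using form_add_right[OF \<pi>_g[OF x] _ y(1), of "x - \<pi> x"] q Q'(2) \<kappa>_Q(2)[OF q y(1)] by auto
    moreover have "f (\<pi> x + (x - \<pi> x)) = f (\<pi> x)"
      using f(2)[OF q] L.functionalD(1)[OF f(1), of "\<pi> x" "x - \<pi> x"] by simp
    ultimately show ?thesis using yu[of "\<pi> x"] \<pi>_U[OF x] B(3) by simp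
  qed
  then show ?thesis using y(1) by blast
qed

end

subsection \<open>Orthogonality and parabolic subalgebras\<close>

context lie_rad
begin

text \<open>For a parabolic subalgebra this is its nilpotent radical, see \<open>nil_radical_parabolic\<close>.\<close>
definition perp :: "'a set \<Rightarrow> 'a set" where
  "perp Y = {x \<in> D. \<forall>y\<in>Y. \<kappa> x y = 0}"

lemma perp_g: "perp Y \<subseteq> g"
  using D_g by (auto simp: perp_def)

text \<open>A functional separating x from Y kills Q, so it is \<open>\<kappa> z\<close> for some z.
  Equality of Y with its double orthogonal is the tool behind most membership proofs below.\<close>

lemma separation:
  assumes Y: "subspace Y" "Q \<subseteq> Y" and x: "x \<in> g"
    and orth: "\<And>z. z \<in> g \<Longrightarrow> (\<And>y. y \<in> Y \<Longrightarrow> y \<in> g \<Longrightarrow> \<kappa> z y = 0) \<Longrightarrow> \<kappa> z x = 0"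
  shows "x \<in> Y"
proof (rule ccontr)
  assume "x \<notin> Y"
  from L.ex_functional[OF Y(1) this] obtain f where
    f: "L.functional f \<and> (\<forall>w\<in>Y. f w = 0) \<and> f x = 1" by (rule exE)
  have "f q = 0" if "q \<in> Q" for q using f Y(2) that by blast
  from form_represents[OF conjunct1[OF f] this] obtain z where
    z: "z \<in> g" "\<forall>x\<in>g. \<kappa> z x = f x" by (rule bexE)
  have "\<kappa> z x = 0" by (rule orth[OF z(1)]) (use z(2) f in auto)
  then show False using z(2) x f by simp
qed

lemma sum_right: "subspace A \<Longrightarrow> b \<in> B \<Longrightarrow> b \<in> {a + b | a b. a \<in> A \<and> b \<in> B}"
  using subspace_0[of A] by (intro CollectI exI[of _ 0] exI[of _ b]) simp

lemma sum_left: "subspace B \<Longrightarrow> a \<in> A \<Longrightarrow> a \<in> {a + b | a b. a \<in> A \<and> b \<in> B}"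
  using subspace_0[of B] by (intro CollectI exI[of _ a] exI[of _ 0]) simp

text \<open>An element orthogonal to D + Q lies in Q by \<open>orthogonal_D\<close>, so D + Q is all
  of g. In other words, g / Q is perfect.\<close>

lemma D_mod_Q:
  assumes "x \<in> g" shows "\<exists>d\<in>D. x - d \<in> Q"
proof -
  let ?Y = "{a + b | a b. a \<in> D \<and> b \<in> Q}"
  have "x \<in> ?Y"
  proof (rule separation[OF subspace_sums[OF D_subspace Q'(1)] _ assms])
    show "Q \<subseteq> ?Y" using sum_right[OF D_subspace] by (rule subsetI)
    fix z assume z: "z \<in> g" "\<And>y. y \<in> ?Y \<Longrightarrow> y \<in> g \<Longrightarrow> \<kappa> z y = 0"
    have "\<kappa> z d = 0" if "d \<in> D" for d
    proof (rule z(2))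
      show "d \<in> ?Y" by (rule sum_left[OF Q'(1) that])
      show "d \<in> g" using that D_g by blast
    qed
    then have "z \<in> Q" using z(1) orthogonal_D by blast
    then show "\<kappa> z x = 0" using \<kappa>_Q(1) assms by blast
  qed
  then obtain d q where "x = d + q" "d \<in> D" "q \<in> Q" by blast
  then have "d \<in> D" "x - d \<in> Q" by simp_all
  then show ?thesis by (rule bexI[rotated])
qed

text \<open>Modulo Q every z has a representative in D, so it suffices to test against the
  orthogonal taken inside D.\<close>

lemma perp_separation:
  assumes Y: "subspace Y" "Q \<subseteq> Y" "Y \<subseteq> g" and x: "x \<in> g"
    and orth: "\<And>z. z \<in> perp Y \<Longrightarrow> \<kappa> z x = 0"
  shows "x \<in> Y"
proof (rule separation[OF Y(1,2) x])
  fix z assume z: "z \<in> g" "\<And>y. y \<in> Y \<Longrightarrow> y \<in> g \<Longrightarrow> \<kappa> z y = 0"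
  obtain d where d: "d \<in> D" "z - d \<in> Q" by (rule bexE[OF D_mod_Q[OF z(1)]])
  have dg: "d \<in> g" using d(1) D_g by blast
  have eq: "\<kappa> z y = \<kappa> d y" if "y \<in> g" for y
    using form_diff[OF z(1) dg that] \<kappa>_Q(1)[OF d(2) that] by simp
  have "d \<in> perp Y" unfolding perp_def using d(1) z(2) eq Y(3) by auto
  then show "\<kappa> z x = 0" using orth eq[OF x] by simp
qed

text \<open>The double orthogonal gives x = a + q with a in A and q in Q. Then q is in
  \<open>D \<inter> Q\<close>, which A contains.\<close>

lemma D_separation:
  assumes A: "subspace A" "D \<inter> Q \<subseteq> A" "A \<subseteq> D" and x: "x \<in> D"
    and orth: "\<And>y. y \<in> g \<Longrightarrow> (\<And>a. a \<in> A \<Longrightarrow> \<kappa> a y = 0) \<Longrightarrow> \<kappa> x y = 0"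
  shows "x \<in> A"
proof -
  let ?Y = "{a + b | a b. a \<in> A \<and> b \<in> Q}"
  have xg: "x \<in> g" using x D_g by blast
  have "x \<in> ?Y"
  proof (rule separation[OF subspace_sums[OF A(1) Q'(1)] _ xg])
    show "Q \<subseteq> ?Y" using sum_right[OF A(1)] by (rule subsetI)
    fix z assume z: "z \<in> g" "\<And>y. y \<in> ?Y \<Longrightarrow> y \<in> g \<Longrightarrow> \<kappa> z y = 0"
    have "\<kappa> a z = 0" if a: "a \<in> A" for a
    proof -
      have ag: "a \<in> g" using a A(3) D_g by blast
      have "a \<in> ?Y" by (rule sum_left[OF Q'(1) a])
      then show ?thesis using z(2)[OF _ ag] R.form_commute[OF ag z(1)] by simp
    qed
    then show "\<kappa> z x = 0" using orth[OF z(1)] R.form_commute[OF xg z(1)] by simp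
  qed
  then obtain a q where aq: "x = a + q" "a \<in> A" "q \<in> Q" by blast
  then have "q = x - a" by simp
  then have "q \<in> D" using subspace_diff[OF D_subspace x] aq(2) A(3) by blast
  then show ?thesis using aq A(2) subspace_add[OF A(1)] by blast
qed

section \<open>Maximal nil subalgebras and their normalizers\<close>

definition normalizer :: "'a set \<Rightarrow> 'a set" where "normalizer m = lie_normalizer bracket g m"

definition max_nilsub :: "'a set \<Rightarrow> bool" where
  "max_nilsub m \<longleftrightarrow> nilsub m \<and> (\<forall>n. nilsub n \<and> m \<subseteq> n \<longrightarrow> n = m)"

definition subalgebra :: "'a set \<Rightarrow> bool" where
  "subalgebra r \<longleftrightarrow> r \<subseteq> g \<and> subspace r \<and> (\<forall>x\<in>r. \<forall>y\<in>r. bracket x y \<in> r)"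

lemma subalgebraD: "subalgebra r \<Longrightarrow> subspace r" "subalgebra r \<Longrightarrow> r \<subseteq> g" "subalgebra r \<Longrightarrow> x \<in> r \<Longrightarrow> y \<in> r \<Longrightarrow> bracket x y \<in> r"
  by (auto simp: subalgebra_def)

lemma normalizer_iff: "x \<in> normalizer m \<longleftrightarrow> x \<in> g \<and> (\<forall>y\<in>m. bracket x y \<in> m)"
  by (simp add: normalizer_def lie_normalizer_def)

lemma nilsub_eq: "nil_subalgebra scale bracket g m \<longleftrightarrow> nilsub m"
  using cone_g by (auto simp: nil_subalgebra_def lie_subalgebra_def nilsub_def)

lemma parabolic_iff:
  "parabolic_subalgebra scale bracket g p \<longleftrightarrow> subalgebra p \<and> (\<exists>m. max_nilsub m \<and> normalizer m \<subseteq> p)"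
  unfolding parabolic_subalgebra_def maximal_nil_subalgebra_def nilsub_eq normalizer_def max_nilsub_def
    lie_subalgebra_def subalgebra_def ..

lemma ex_max_nilsub:
  assumes "nilsub n" shows "\<exists>m. max_nilsub m \<and> n \<subseteq> m"
proof -
  have *: "subspace W \<and> W \<subseteq> g" if "nilsub W" for W using nilsubD(1,4)[OF that] by simp
  have "\<exists>M. nilsub M \<and> n \<subseteq> M \<and> (\<forall>N. nilsub N \<longrightarrow> M \<subseteq> N \<longrightarrow> N = M)"
    by (rule L.ex_maximal_subspace[where P = nilsub, OF fin assms]) (rule *)
  then obtain M where "nilsub M" "n \<subseteq> M" "\<forall>N. nilsub N \<longrightarrow> M \<subseteq> N \<longrightarrow> N = M"
    by (elim exE conjE) (rule that)
  then show ?thesis unfolding max_nilsub_def by (intro exI[of _ M]) simp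
qed

text \<open>By \<open>cone_add_normalizer\<close> the sum of m and the line through z is a nil
  subalgebra, so it equals m.\<close>

lemma max_nilsub_absorb:
  assumes m: "max_nilsub m" and z: "z \<in> cone" "z \<in> normalizer m"
  shows "z \<in> m"
proof -
  have n: "nilsub m" using m by (simp add: max_nilsub_def)
  note nD = nilsubD[OF n]
  have zg: "z \<in> g" and zm: "\<And>y. y \<in> m \<Longrightarrow> bracket z y \<in> m" using z(2) by (auto simp: normalizer_iff)
  let ?K = "{y + b | y b. y \<in> m \<and> b \<in> span {z}}"
  have K: "x \<in> ?K \<longleftrightarrow> (\<exists>y c. y \<in> m \<and> x = y + scale c z)" for x
    by (auto simp: span_singleton)
  have mz: "bracket y z \<in> m" if "y \<in> m" for y
    using bracket_anti[of y z] zm[OF that] subspace_neg[OF nD(1)] nD(4) zg that by auto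
  have "nilsub ?K"
    unfolding nilsub_def
  proof (intro conjI ballI subsetI)
    show "subspace ?K" by (rule subspace_sums[OF nD(1) subspace_span])
    show "x \<in> cone" if xK: "x \<in> ?K" for x
    proof -
      obtain y c where y: "y \<in> m" "x = y + scale c z" using xK unfolding K by (elim exE conjE) (rule that)
      have "bracket (scale c z) w \<in> m" if "w \<in> m" for w
        using bracket_scale_left[OF zg, of w c] zm[OF that] subspace_scale[OF nD(1)] nD(4) that by auto
      then show ?thesis unfolding y(2) by (intro cone_add_normalizer[OF n y(1) cone_scale[OF z(1)]])
    qed
    fix x x' assume "x \<in> ?K" "x' \<in> ?K"
    then obtain y c y' c' where y: "y \<in> m" "x = y + scale c z" "y' \<in> m" "x' = y' + scale c' z"
      unfolding K by (elim exE conjE) (rule that)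
    have yg: "y \<in> g" "y' \<in> g" using y nD(4) by auto
    have cz: "scale c z \<in> g" for c by (rule subspace_scale[OF subspace_carrier zg])
    have "bracket x x' = bracket y y' + scale c' (bracket y z) + scale c (bracket z y')"
      unfolding y(2,4)
      by (simp add: bracket_add_left bracket_add_right yg cz subspace_add[OF subspace_carrier]
          bracket_scale_left bracket_scale_right zg bracket_self)
    moreover have "\<dots> \<in> m"
      using y mz zm nD(2) by (intro subspace_add[OF nD(1)] subspace_scale[OF nD(1)]) auto
    ultimately show "bracket x x' \<in> ?K" unfolding K by (intro exI[of _ "bracket x x'"] exI[of _ 0]) simp
  qed
  moreover have "m \<subseteq> ?K"
  proof
    fix y assume "y \<in> m" then show "y \<in> ?K" unfolding K by (intro exI[of _ y] exI[of _ 0]) simp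
  qed
  ultimately have "?K = m" using m unfolding max_nilsub_def by blast
  moreover have "z \<in> ?K" unfolding K
    by (rule exI[of _ 0], rule exI[of _ 1]) (simp add: subspace_0[OF nD(1)])
  ultimately show ?thesis by simp
qed

lemma max_nilsub_DQ:
  assumes m: "max_nilsub m" shows "D \<inter> Q \<subseteq> m"
proof -
  have n: "nilsub m" using m by (simp add: max_nilsub_def)
  note nD = nilsubD[OF n]
  let ?K = "{y + b | y b. y \<in> m \<and> b \<in> D \<inter> Q}"
  note R = DQ_ideal
  have R': "bracket y x \<in> D \<inter> Q" if "x \<in> g" "y \<in> D \<inter> Q" for x y
    using R(3)[OF that(1), of y] bracket_anti[of y x] subspace_neg[OF R(1)] R(2) that by auto
  have "nilsub ?K"
    unfolding nilsub_def
  proof (intro conjI ballI subsetI)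
    show "subspace ?K" by (rule subspace_sums[OF nD(1) R(1)])
    show "x \<in> cone" if xK: "x \<in> ?K" for x
    proof -
      obtain y b where y: "x = y + b" "y \<in> m" "b \<in> D \<inter> Q" using xK by blast
      have "b + y \<in> cone"
        using R(3)[of y] y nD by (intro cone_add_normalizer[OF DQ_nilsub y(3)]) auto
      then show ?thesis by (simp add: y(1) add.commute)
    qed
    fix x x' assume "x \<in> ?K" "x' \<in> ?K"
    then obtain y b y' b' where y: "x = y + b" "y \<in> m" "b \<in> D \<inter> Q" "x' = y' + b'" "y' \<in> m" "b' \<in> D \<inter> Q"
      by blast
    have yg: "y \<in> g" "y' \<in> g" "b \<in> g" "b' \<in> g" using y nD(4) R(2) by auto
    have "bracket x x' = bracket y y' + (bracket y b' + (bracket b y' + bracket b b'))"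
      unfolding y(1,4)
      by (simp add: bracket_add_left bracket_add_right yg subspace_add[OF subspace_carrier])
    moreover have "bracket y b' + (bracket b y' + bracket b b') \<in> D \<inter> Q"
      using R(3) R' y yg by (intro subspace_add[OF R(1)]) auto
    ultimately show "bracket x x' \<in> ?K" using nD(2)[OF y(2,5)] by blast
  qed
  moreover have "m \<subseteq> ?K" using sum_left[OF R(1)] by (rule subsetI)
  ultimately have "?K = m" using m unfolding max_nilsub_def by blast
  moreover have "D \<inter> Q \<subseteq> ?K" using sum_right[OF nD(1)] by (rule subsetI)
  ultimately show ?thesis by simp
qed

lemma nilsub_norm: "nilsub m \<Longrightarrow> m \<subseteq> normalizer m"
  using nilsubD(2,4)[of m] by (auto simp: normalizer_iff)

lemma max_nilsub_Q_normalizer: "max_nilsub m \<Longrightarrow> Q \<subseteq> normalizer m"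
proof
  fix q assume m: "max_nilsub m" and q: "q \<in> Q"
  have n: "nilsub m" using m by (simp add: max_nilsub_def)
  have "bracket q y \<in> D \<inter> Q" if "y \<in> m" for y
    using Q'(4)[of y q] q D_bracket[of q y] Q'(2) nilsubD(4)[OF n] that by auto
  then show "q \<in> normalizer m" using max_nilsub_DQ[OF m] q Q'(2) by (auto simp: normalizer_iff)
qed

lemma form_nil:
  assumes m: "nilsub m" and x: "x \<in> m" and y: "y \<in> normalizer m"
  shows "\<kappa> x y = 0"
proof (rule R.form_nil_normalizer[OF _ _ x])
  show "R.subalg m" using nilsubD[OF m] by (simp add: R.subalg_def)
  show "\<exists>k. R.op x ^ k = 0" if "x \<in> m" for x
    using cone_rep[OF _ R.lie_rep_axioms] nilsubD(3)[OF m] that by blast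
qed (use y in \<open>auto simp: normalizer_iff\<close>)

lemma nil_set_op: "nilsub m \<Longrightarrow> L.nil_set (R.op ` m)"
proof (rule R.nil_set_op)
  assume m: "nilsub m"
  show "R.subalg m" using nilsubD[OF m] by (simp add: R.subalg_def)
  show "\<exists>k. R.op x ^ k = 0" if "x \<in> m" for x
    using cone_rep[OF _ R.lie_rep_axioms] nilsubD(3)[OF m] that by blast
qed

lemma perp_normalizer:
  assumes m: "max_nilsub m" shows "perp (normalizer m) = m"
proof -
  have n: "nilsub m" using m by (simp add: max_nilsub_def)
  note nD = nilsubD[OF n]
  have mD: "m \<subseteq> D" using nD(3) cone_D by blast
  have ng: "x \<in> g" if "x \<in> normalizer m" for x using that by (simp add: normalizer_iff)
  have in_m: "z \<in> m" if z: "z \<in> perp (normalizer m)" "z \<in> normalizer m" for z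
  proof -
    have zD: "z \<in> D" and zg: "z \<in> g" using z ng by (auto simp: perp_def)
    define mp where "mp = {y \<in> g. \<forall>x\<in>m. \<kappa> x y = 0}"
    \<comment> \<open>Y is [m, mp] + Q. If w is orthogonal to Y, then [w, a] for a in m is
      orthogonal to mp, so it lies in the double orthogonal m. Such w normalizes m and is therefore
      orthogonal to z.\<close>
    define Y where "Y = {a + b | a b. a \<in> span {bracket a b | a b. a \<in> m \<and> b \<in> mp} \<and> b \<in> Q}"
    have "z \<in> Y"
    proof (rule separation[OF _ _ zg])
      show "subspace Y" unfolding Y_def by (rule subspace_sums[OF subspace_span Q'(1)])
      show "Q \<subseteq> Y" unfolding Y_def using sum_right[OF subspace_span] by (rule subsetI)
      fix w assume w: "w \<in> g" "\<And>y. y \<in> Y \<Longrightarrow> y \<in> g \<Longrightarrow> \<kappa> w y = 0"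
      have "bracket w a \<in> m" if a: "a \<in> m" for a
      proof (rule D_separation[OF nD(1) max_nilsub_DQ[OF m] mD])
        have ag: "a \<in> g" using a nD(4) by blast
        show "bracket w a \<in> D" by (rule D_bracket[OF w(1) ag])
        fix b assume b: "b \<in> g" "\<And>a. a \<in> m \<Longrightarrow> \<kappa> a b = 0"
        have "bracket a b \<in> span {bracket a b | a b. a \<in> m \<and> b \<in> mp}"
          using a b by (intro span_base) (auto simp: mp_def)
        then have "bracket a b \<in> Y" unfolding Y_def by (rule sum_left[OF Q'(1)])
        then show "\<kappa> (bracket w a) b = 0"
          using w(2) R.form_invariant[OF w(1) ag b(1)] bracket_closed[OF ag b(1)] by simp
      qed
      then have "w \<in> normalizer m" using w(1) by (simp add: normalizer_iff)
      then show "\<kappa> w z = 0" using z(1) R.form_commute[OF w(1) zg] by (simp add: perp_def)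
    qed
    then obtain s q where sq: "z = s + q" "s \<in> span {bracket a b | a b. a \<in> m \<and> b \<in> mp}" "q \<in> Q"
      unfolding Y_def by blast
    have mpg: "mp \<subseteq> g" by (auto simp: mp_def)
    obtain k :: nat and a b where ab: "\<forall>i<k. a i \<in> m \<and> b i \<in> mp" and ss: "s = (\<Sum>i<k. bracket (a i) (b i))"
      using span_bracket_sum[OF sq(2) nD(1,4) mpg] by (elim exE conjE) (rule that)
    have ag: "a i \<in> g" "b i \<in> g" if "i < k" for i using ab that nD(4) mpg by auto
    have sg: "s \<in> g" unfolding ss by (rule subspace_sum[OF subspace_carrier]) (use ag bracket_closed in auto)
    have "\<exists>k. R.op z ^ k = 0"
    \<comment> \<open>z normalizes m, so ad z keeps the a i in m, to which the b i are orthogonal.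
      The traces vanish from the start, hence \<open>N = 0\<close>.\<close>
    proof (rule R.op_nilpotent_if_form[where n = k and a = a and b = b and N = 0])
      have "R.op z = R.op s + R.op q" unfolding sq(1) by (rule R.op_add[OF sg]) (use sq Q'(2) in blast)
      also have "\<dots> = R.op s" using op_Q[OF sq(3)] by simp
      also have "\<dots> = (\<Sum>i<k. R.op (bracket (a i) (b i)))"
        unfolding ss by (rule R.op_sum) (use ag bracket_closed in auto)
      finally show "R.op z = (\<Sum>i<k. R.op (bracket (a i) (b i)))" .
      fix i j assume i: "i < k"
      have "(bracket z ^^ j) (a i) \<in> m"
        using z(2) ab i by (induction j) (auto simp: normalizer_iff)
      then show "\<kappa> (b i) ((bracket z ^^ j) (a i)) = 0"
        using ab i R.form_commute[OF ag(2)[OF i], of "(bracket z ^^ j) (a i)"] nD(4) by (auto simp: mp_def)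
    qed (use ag zg in auto)
    then have "z \<in> cone" by (rule cone_if_op_nilpotent[OF zD])
    then show "z \<in> m" by (rule max_nilsub_absorb[OF m _ z(2)])
  qed
  show ?thesis
  proof
    show "m \<subseteq> perp (normalizer m)" using mD form_nil[OF n] by (auto simp: perp_def)
    show "perp (normalizer m) \<subseteq> m"
    proof
      fix z assume z: "z \<in> perp (normalizer m)"
      show "z \<in> m"
      proof (rule ccontr)
        assume zm: "z \<notin> m"
        \<comment> \<open>Engel's descent for m acting on \<open>perp (normalizer m)\<close> modulo
          m. The element found is outside m but normalizes m, against \<open>in_m\<close>.\<close>
        have "\<exists>y. y \<in> perp (normalizer m) \<and> y \<notin> m \<and> (\<forall>h\<in>m. bracket h y \<in> m)"
        proof (rule L.nil_set_descent[where \<phi> = \<pi>, OF nil_set_op[OF n] z zm])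
          fix h y assume h: "h \<in> m" and y: "y \<in> perp (normalizer m)"
          have hg: "h \<in> g" and yg: "y \<in> g" using h y nD(4) perp_g by auto
          have "\<kappa> (bracket h y) w = 0" if w: "w \<in> normalizer m" for w
          proof -
            have "bracket h w \<in> m"
              using bracket_anti[OF hg ng[OF w]] w h subspace_neg[OF nD(1)] by (simp add: normalizer_iff)
            then have "\<kappa> y (bracket h w) = 0" using y nilsub_norm[OF n] by (auto simp: perp_def)
            then have "\<kappa> (bracket y h) w = 0" using R.form_invariant[OF yg hg ng[OF w]] by simp
            moreover have "bracket h y = scale (-1) (bracket y h)" using bracket_anti[OF hg yg] by simp
            ultimately show ?thesis using R.form_scale[OF bracket_closed[OF yg hg] ng[OF w], of "-1"] by simp
          qed
          then show "bracket h y \<in> perp (normalizer m) \<and> app (R.op h) (\<pi> y) = \<pi> (bracket h y)"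
            using D_bracket[OF hg yg] app_op_\<pi>[OF hg yg] by (simp add: perp_def)
        next
          fix y assume "y \<in> perp (normalizer m)" "\<pi> y = 0"
          then show "y \<in> m" using max_nilsub_DQ[OF m] by (auto simp: perp_def \<pi>_0_iff)
        qed
        then obtain y where y: "y \<in> perp (normalizer m)" "y \<notin> m" "\<And>h. h \<in> m \<Longrightarrow> bracket h y \<in> m" by blast
        have yg: "y \<in> g" using y(1) perp_g by blast
        have "bracket y h \<in> m" if "h \<in> m" for h
          using bracket_anti[OF yg, of h] nD(4) that y(3)[OF that] subspace_neg[OF nD(1)] by auto
        then have "y \<in> normalizer m" using yg by (simp add: normalizer_iff)
        then show False using in_m y by blast
      qed
    qed
  qed
qed

lemma perp_antimono: "Y \<subseteq> Z \<Longrightarrow> perp Z \<subseteq> perp Y"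
  by (auto simp: perp_def)

lemma perp_subspace:
  assumes "Y \<subseteq> g" shows "subspace (perp Y)"
  unfolding subspace_def perp_def
  using assms subspace_0[OF D_subspace] subspace_add[OF D_subspace] subspace_scale[OF D_subspace]
    subsetD[OF D_g] subsetD[OF assms] form_0 R.form_add R.form_scale
  by (auto simp: R.form_add R.form_scale form_0)

lemma perp_ideal:
  assumes r: "subalgebra r" and x: "x \<in> r" and y: "y \<in> perp r"
  shows "bracket x y \<in> perp r" "bracket y x \<in> perp r"
proof -
  have g: "x \<in> g" "y \<in> g" using subalgebraD(2)[OF r] x y perp_g by auto
  show *: "bracket y x \<in> perp r"
    unfolding perp_def
  proof (intro CollectI conjI ballI)
    show "bracket y x \<in> D" by (rule D_bracket[OF g(2,1)])
    fix z assume z: "z \<in> r"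
    then have "z \<in> g" using subalgebraD(2)[OF r] by blast
    then show "\<kappa> (bracket y x) z = 0"
      using R.form_invariant[OF g(2,1)] y subalgebraD(3)[OF r x z] by (simp add: perp_def)
  qed
  show "bracket x y \<in> perp r"
    using bracket_anti[OF g] subspace_neg[OF perp_subspace[OF subalgebraD(2)[OF r]] *] by simp
qed

definition parabolic_over :: "'a set \<Rightarrow> 'a set \<Rightarrow> bool" where
  "parabolic_over p m \<longleftrightarrow> subalgebra p \<and> max_nilsub m \<and> normalizer m \<subseteq> p"

lemma parabolicD:
  assumes "parabolic_over p m"
  shows "subalgebra p" "nilsub m" "m \<subseteq> p" "Q \<subseteq> p" "perp p \<subseteq> m" "normalizer m \<subseteq> p" "max_nilsub m"
    "perp p \<subseteq> p" "perp p \<subseteq> cone" "p \<subseteq> g" "subspace p"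
proof -
  show *: "subalgebra p" "nilsub m" "normalizer m \<subseteq> p" "max_nilsub m" "p \<subseteq> g" "subspace p"
    using assms by (auto simp: parabolic_over_def max_nilsub_def subalgebra_def)
  show mp: "m \<subseteq> p" using nilsub_norm[OF *(2)] *(3) by blast
  show "Q \<subseteq> p" using max_nilsub_Q_normalizer[OF *(4)] *(3) by blast
  show "perp p \<subseteq> m" using perp_antimono[OF *(3)] perp_normalizer[OF *(4)] by blast
  then show "perp p \<subseteq> p" "perp p \<subseteq> cone" using mp nilsubD(3)[OF *(2)] by auto
qed

lemma parabolic_iff_over: "parabolic_subalgebra scale bracket g p \<longleftrightarrow> (\<exists>m. parabolic_over p m)"
  unfolding parabolic_iff parabolic_over_def by blast

lemma perp_nilsub:
  assumes r: "subalgebra r" and "perp r \<subseteq> r" "perp r \<subseteq> cone"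
  shows "nilsub (perp r)"
  unfolding nilsub_def
  using perp_subspace[OF subalgebraD(2)[OF r]] perp_ideal[OF r] assms by blast

text \<open>
  Any maximal nil subalgebra \<open>m\<close> above \<open>perp r\<close> works: its normalizer is orthogonal to \<open>m\<close>, hence to
  \<open>perp r\<close>, hence lies in \<open>r\<close>.
\<close>
lemma ex_parabolic:
  assumes r: "subalgebra r" "Q \<subseteq> r" "perp r \<subseteq> r" "perp r \<subseteq> cone"
  shows "\<exists>m. parabolic_over r m"
proof -
  obtain m where m: "max_nilsub m" "perp r \<subseteq> m"
    using ex_max_nilsub[OF perp_nilsub[OF r(1,3,4)]] by (elim exE conjE) (rule that)
  have n: "nilsub m" using m by (simp add: max_nilsub_def)
  have "normalizer m \<subseteq> r"
  proof
    fix w assume w: "w \<in> normalizer m"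
    show "w \<in> r"
      by (rule perp_separation[OF subalgebraD(1)[OF r(1)] r(2) subalgebraD(2)[OF r(1)]])
        (use w form_nil[OF n] m(2) in \<open>auto simp: normalizer_iff\<close>)
  qed
  then show ?thesis using r(1) m(1) by (auto simp: parabolic_over_def)
qed

section \<open>The subalgebra \<open>p \<inter> q + perp q\<close>\<close>

context
  fixes p q m n
  assumes p: "parabolic_over p m" and q: "parabolic_over q n"
begin

definition composite :: "'a set" where "composite = {a + b | a b. a \<in> p \<inter> q \<and> b \<in> perp q}"

definition composite_nil :: "'a set" where "composite_nil = {a + b | a b. a \<in> perp p \<inter> q \<and> b \<in> perp q}"

lemma sub_composite: "subalgebra composite"
  unfolding subalgebra_def composite_def
proof (intro conjI ballI)
  let ?r = "{a + b | a b. a \<in> p \<inter> q \<and> b \<in> perp q}"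
  have sq: "subspace (perp q)" by (rule perp_subspace[OF parabolicD(10)[OF q]])
  show "subspace ?r"
    by (rule subspace_sums[OF subspace_inter[OF parabolicD(11)[OF p] parabolicD(11)[OF q]] sq])
  show "?r \<subseteq> g" using parabolicD(10)[OF p] perp_g[of q] subspace_add[OF subspace_carrier] by blast
  fix x y assume "x \<in> ?r" "y \<in> ?r"
  then obtain a b a' b' where x: "x = a + b" "a \<in> p \<inter> q" "b \<in> perp q"
    and y: "y = a' + b'" "a' \<in> p \<inter> q" "b' \<in> perp q" by blast
  have gs: "a \<in> g" "b \<in> g" "a' \<in> g" "b' \<in> g" using x y parabolicD(10)[OF p] perp_g by auto
  have "bracket x y = bracket a a' + (bracket a b' + (bracket b a' + bracket b b'))"
    unfolding x(1) y(1) by (simp add: bracket_add_left bracket_add_right gs subspace_add[OF subspace_carrier])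
  moreover have "bracket a a' \<in> p \<inter> q" using x y subalgebraD(3)[OF parabolicD(1)[OF p]] subalgebraD(3)[OF parabolicD(1)[OF q]] by blast
  moreover have "bracket a b' + (bracket b a' + bracket b b') \<in> perp q"
    using x y perp_ideal[OF parabolicD(1)[OF q]] parabolicD(8)[OF q] by (intro subspace_add[OF sq]) auto
  ultimately show "bracket x y \<in> ?r" by blast
qed

lemma composite_Q: "Q \<subseteq> composite"
proof
  fix x assume "x \<in> Q"
  then have "x \<in> p \<inter> q" using parabolicD(4)[OF p] parabolicD(4)[OF q] by blast
  then show "x \<in> composite" unfolding composite_def
    by (rule sum_left[OF perp_subspace[OF parabolicD(10)[OF q]]])
qed

text \<open>Orthogonality to \<open>perp q\<close> puts x into q, and orthogonality to
  \<open>p \<inter> q\<close> puts it into \<open>perp p + perp q\<close>, up to Q. So x = a + b,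
  and a = x - b is in q. Conversely, \<open>perp p \<inter> q\<close> pairs to zero with
  \<open>perp q\<close> because it lies in q.\<close>

lemma perp_composite: "perp composite = composite_nil"
proof
  have sp: "subspace (perp p)" "subspace (perp q)"
    using perp_subspace[OF parabolicD(10)[OF p]] perp_subspace[OF parabolicD(10)[OF q]] by auto
  have pg: "p \<subseteq> g" "q \<subseteq> g" using parabolicD(10)[OF p] parabolicD(10)[OF q] by auto
  show "composite_nil \<subseteq> perp composite"
  proof
    fix x assume "x \<in> composite_nil"
    then obtain a b where x: "x = a + b" "a \<in> perp p" "a \<in> q" "b \<in> perp q" by (auto simp: composite_nil_def)
    have ab: "a \<in> g" "b \<in> g" "a \<in> D" "b \<in> D" using x perp_g by (auto simp: perp_def)
    have "\<kappa> x y = 0" if yc: "y \<in> composite" for y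
    proof -
      obtain c d where y: "y = c + d" "c \<in> p" "c \<in> q" "d \<in> perp q" using yc by (auto simp: composite_def)
      have cd: "c \<in> g" "d \<in> g" using y pg perp_g by auto
      have "\<kappa> a c = 0" "\<kappa> b c = 0" using x y by (auto simp: perp_def)
      moreover have "\<kappa> b d = 0" using x(4) y(4) parabolicD(8)[OF q] by (auto simp: perp_def)
      moreover have "\<kappa> a d = 0" using y(4) x(3) R.form_commute[OF ab(1) cd(2)] by (auto simp: perp_def)
      ultimately show ?thesis
        unfolding x(1) y(1) by (simp add: R.form_add form_add_right ab cd subspace_add[OF subspace_carrier])
    qed
    then show "x \<in> perp composite" using subspace_add[OF D_subspace ab(3,4)] x(1) by (simp add: perp_def)
  qed
  show "perp composite \<subseteq> composite_nil"
  proof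
    fix x assume x: "x \<in> perp composite"
    have xD: "x \<in> D" and xg: "x \<in> g" and xo: "\<And>y. y \<in> composite \<Longrightarrow> \<kappa> x y = 0"
      using x D_g by (auto simp: perp_def)
    have xq: "x \<in> q"
    proof (rule perp_separation[OF parabolicD(11)[OF q] parabolicD(4)[OF q] pg(2) xg])
      fix z assume z: "z \<in> perp q"
      then have "z \<in> composite" unfolding composite_def
        by (rule sum_right[OF subspace_inter[OF parabolicD(11)[OF p] parabolicD(11)[OF q]]])
      then show "\<kappa> z x = 0" using xo R.form_commute[OF xg, of z] perp_g z by auto
    qed
    define S where "S = {a + b | a b. a \<in> perp p \<and> b \<in> perp q}"
    define Y where "Y = {s + b | s b. s \<in> S \<and> b \<in> Q}"
    have sS: "subspace S" unfolding S_def by (rule subspace_sums[OF sp])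
    have "x \<in> Y"
    proof (rule separation[OF _ _ xg])
      show "subspace Y" unfolding Y_def by (rule subspace_sums[OF sS Q'(1)])
      show "Q \<subseteq> Y" unfolding Y_def using sum_right[OF sS] by (rule subsetI)
      fix w assume w: "w \<in> g" "\<And>y. y \<in> Y \<Longrightarrow> y \<in> g \<Longrightarrow> \<kappa> w y = 0"
      have SY: "s \<in> Y" if "s \<in> S" for s unfolding Y_def by (rule sum_left[OF Q'(1) that])
      have "perp p \<subseteq> S" "perp q \<subseteq> S"
        unfolding S_def by (rule subsetI, rule sum_left[OF sp(2)], assumption)
          (rule subsetI, rule sum_right[OF sp(1)], assumption)
      then have "\<kappa> z w = 0" if z: "z \<in> perp p \<union> perp q" for z
      proof -
        have "z \<in> S" using z \<open>perp p \<subseteq> S\<close> \<open>perp q \<subseteq> S\<close> by blast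
        moreover have zg: "z \<in> g" using z perp_g by blast
        ultimately show ?thesis using w(2)[OF SY] R.form_commute[OF w(1) zg] by simp
      qed
      then have "w \<in> p" "w \<in> q"
        using perp_separation[OF parabolicD(11)[OF p] parabolicD(4)[OF p] pg(1) w(1)]
          perp_separation[OF parabolicD(11)[OF q] parabolicD(4)[OF q] pg(2) w(1)] by auto
      then have "w \<in> composite" unfolding composite_def by (intro sum_left[OF sp(2)] IntI)
      then show "\<kappa> w x = 0" using xo R.form_commute[OF w(1) xg] by simp
    qed
    then obtain a b s where abs: "x = (a + b) + s" "a \<in> perp p" "b \<in> perp q" "s \<in> Q"
      unfolding Y_def S_def by blast
    have abD: "a \<in> D" "b \<in> D" using abs by (auto simp: perp_def)
    have "s = x - (a + b)" using abs(1) by simp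
    then have "s \<in> D" using subspace_diff[OF D_subspace xD subspace_add[OF D_subspace abD]] by simp
    \<comment> \<open>The Q-part of x is in \<open>D \<inter> Q\<close>, hence in
      \<open>perp q\<close>, and joins the second summand.\<close>
    then have s: "s \<in> perp q" using \<kappa>_Q(1)[OF abs(4)] pg(2) by (auto simp: perp_def)
    have bs: "b + s \<in> perp q" by (rule subspace_add[OF sp(2) abs(3) s])
    have "a = x - (b + s)" using abs(1) by simp
    then have "a \<in> q" using subspace_diff[OF parabolicD(11)[OF q] xq] bs parabolicD(8)[OF q] by auto
    moreover have "x = a + (b + s)" using abs(1) by simp
    ultimately show "x \<in> composite_nil" unfolding composite_nil_def using abs(2) bs by blast
  qed
qed

lemma composite_nil_cone: "composite_nil \<subseteq> cone" "composite_nil \<subseteq> composite"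
proof -
  show "composite_nil \<subseteq> composite" unfolding composite_nil_def composite_def using parabolicD(8)[OF p] by blast
  show "composite_nil \<subseteq> cone"
  proof
    fix x assume "x \<in> composite_nil"
    then obtain a b where x: "x = a + b" "a \<in> perp p" "a \<in> q" "b \<in> perp q" by (auto simp: composite_nil_def)
    have "b + a \<in> cone"
    proof (rule cone_add_normalizer[OF _ x(4)])
      show "nilsub (perp q)" by (rule perp_nilsub[OF parabolicD(1,8,9)[OF q]])
      show "a \<in> cone" using x(2) parabolicD(9)[OF p] by blast
      show "bracket a y \<in> perp q" if "y \<in> perp q" for y by (rule perp_ideal(1)[OF parabolicD(1)[OF q] x(3) that])
    qed
    then show "x \<in> cone" by (simp add: x(1) add.commute)
  qed
qed

lemma ex_parabolic_composite: "\<exists>l. parabolic_over composite l"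
  using ex_parabolic[OF sub_composite composite_Q] composite_nil_cone by (simp add: perp_composite)

end

end

subsection \<open>The nilpotent radical\<close>

context fd_lie
begin

abbreviation nilrad :: "'a set" where "nilrad \<equiv> nil_radical scale bracket g"

lemma idealD:
  assumes "ideal I"
  shows "subspace I" "I \<subseteq> g" "\<And>x y. x \<in> g \<Longrightarrow> y \<in> I \<Longrightarrow> bracket x y \<in> I"
    "\<And>x y. x \<in> g \<Longrightarrow> y \<in> I \<Longrightarrow> bracket y x \<in> I"
proof -
  show *: "subspace I" "I \<subseteq> g" "\<And>x y. x \<in> g \<Longrightarrow> y \<in> I \<Longrightarrow> bracket x y \<in> I"
    using assms by (auto simp: ideal_def)
  show "bracket y x \<in> I" if "x \<in> g" "y \<in> I" for x y
    using bracket_anti[of y x] *(2) *(3)[OF that] subspace_neg[OF *(1)] that by auto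
qed

lemma nilrad_ideal: "ideal nilrad"
  unfolding ideal_def subspace_def
proof (intro conjI ballI allI)
  have rep: "lie_representation scale bracket g fun_scale V \<rho>"
    if "simple_representation scale bracket g (fun_scale :: 'k \<Rightarrow> _) V \<rho>" for V \<rho>
    using that by (simp add: simple_representation_def)
  show "nilrad \<subseteq> g" by (auto simp: nil_radical_def)
  show "0 \<in> nilrad"
    unfolding nil_radical_def
  proof (intro CollectI conjI allI impI ballI)
    fix V \<rho> and v :: "nat \<Rightarrow> 'k" assume s: "simple_representation scale bracket g fun_scale V \<rho>" and v: "v \<in> V"
    from s interpret W: lie_representation scale bracket g fun_scale V \<rho> by (rule rep)
    show "\<rho> 0 v = 0" using W.rho_scale_left[OF subspace_0[OF subspace_carrier] v, of 0] by simp
  qed (rule subspace_0[OF subspace_carrier])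
  show "x + y \<in> nilrad" if "x \<in> nilrad" "y \<in> nilrad" for x y
    unfolding nil_radical_def
  proof (intro CollectI conjI allI impI ballI)
    have xy: "x \<in> g" "y \<in> g" using that by (auto simp: nil_radical_def)
    show "x + y \<in> g" using xy by (rule subspace_add[OF subspace_carrier])
    fix V \<rho> and v :: "nat \<Rightarrow> 'k" assume s: "simple_representation scale bracket g fun_scale V \<rho>" and v: "v \<in> V"
    from s interpret W: lie_representation scale bracket g fun_scale V \<rho> by (rule rep)
    show "\<rho> (x + y) v = 0" using W.rho_add_left[OF xy v] nil_radical_any[OF _ s v] that by simp
  qed
  show "scale c x \<in> nilrad" if "x \<in> nilrad" for c x
    unfolding nil_radical_def
  proof (intro CollectI conjI allI impI ballI)
    have x: "x \<in> g" using that by (auto simp: nil_radical_def)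
    then show "scale c x \<in> g" by (rule subspace_scale[OF subspace_carrier])
    fix V \<rho> and v :: "nat \<Rightarrow> 'k" assume s: "simple_representation scale bracket g fun_scale V \<rho>" and v: "v \<in> V"
    from s interpret W: lie_representation scale bracket g fun_scale V \<rho> by (rule rep)
    show "\<rho> (scale c x) v = 0" using W.rho_scale_left[OF x v] nil_radical_any[OF that s v] by simp
  qed
  show "bracket x y \<in> nilrad" if x: "x \<in> g" and y: "y \<in> nilrad" for x y
    unfolding nil_radical_def
  proof (intro CollectI conjI allI impI ballI)
    have yg: "y \<in> g" using y by (auto simp: nil_radical_def)
    show "bracket x y \<in> g" by (rule bracket_closed[OF x yg])
    fix V \<rho> and v :: "nat \<Rightarrow> 'k" assume s: "simple_representation scale bracket g fun_scale V \<rho>" and v: "v \<in> V"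
    from s interpret W: lie_representation scale bracket g fun_scale V \<rho> by (rule rep)
    have "\<rho> y v = 0" "\<rho> y (\<rho> x v) = 0"
      using nil_radical_any[OF y s] v W.rho_closed[OF x v] by auto
    moreover have "\<rho> x 0 = 0" using W.rho_scale_right[OF x v, of 0] by simp
    ultimately show "\<rho> (bracket x y) v = 0" using W.rho_bracket[OF x yg v] by simp
  qed
qed

text \<open>A maximal proper invariant subspace S has a simple quotient, on which x acts as zero. So
  x maps V into S, and induction on the dimension applies to S.\<close>

lemma nilrad_nilpotent:
  fixes scaleV :: "'k \<Rightarrow> 'v::ab_group_add \<Rightarrow> 'v"
  assumes rep: "lie_rep scale bracket g scaleV V \<rho>" and x: "x \<in> nilrad"
  shows "\<exists>m. \<forall>v\<in>V. (\<rho> x ^^ m) v = 0"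
proof -
  have "vspace_char_0 scaleV"
  proof -
    interpret W0: lie_rep scale bracket g scaleV V \<rho> by (rule rep)
    show ?thesis by (rule W0.E.vspace_char_0_axioms)
  qed
  then interpret E: vspace_char_0 scaleV .
  have xg: "x \<in> g" using x by (simp add: nil_radical_def)
  show ?thesis
    using rep
  proof (induction "E.dim V" arbitrary: V rule: less_induct)
    case less
    interpret W: lie_rep scale bracket g scaleV V \<rho> by (rule less.prems)
    have sV: "E.subspace V" by (rule W.sub_V)
    show ?case
    proof (cases "V = {0}")
      case True
      then show ?thesis by (intro exI[of _ 0]) simp
    next
      case False
      define M where "M S \<longleftrightarrow> E.subspace S \<and> S \<subseteq> V \<and> (\<forall>y\<in>g. \<forall>s\<in>S. \<rho> y s \<in> S) \<and> S \<noteq> V" for S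
      have \<rho>0: "\<rho> y 0 = 0" if "y \<in> g" for y
        using W.rho_scale_right[OF that E.subspace_0[OF sV], of 0] by simp
      have M0: "M {0}" using False E.subspace_0[OF sV] by (auto simp: M_def E.subspace_single_0 \<rho>0)
      have "\<exists>S. M S \<and> {0} \<subseteq> S \<and> (\<forall>T. M T \<longrightarrow> S \<subseteq> T \<longrightarrow> T = S)"
        by (rule E.ex_maximal_subspace[where P = M, OF W.V_fin_dim M0]) (simp add: M_def)
      then obtain S where S: "M S" and max: "\<forall>T. M T \<longrightarrow> S \<subseteq> T \<longrightarrow> T = S"
        by (elim exE conjE) (rule that)
      have sS: "E.subspace S" and SV: "S \<subseteq> V" and S\<rho>: "\<And>y s. y \<in> g \<Longrightarrow> s \<in> S \<Longrightarrow> \<rho> y s \<in> S" and SnV: "S \<noteq> V"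
        using S by (auto simp: M_def)
      have repS: "lie_rep scale bracket g scaleV S \<rho>"
        by unfold_locales
          (simp_all add: S\<rho> W.rho_add_right W.rho_scale_right W.rho_add_left W.rho_scale_left
            W.rho_bracket E.fin_dim_subspace[OF W.V_fin_dim sS SV] subsetD[OF SV])
      have "E.dim S < E.dim V"
        by (rule E.subspace_dim_less[OF W.V_fin_dim sS sV _ order_refl]) (use SV SnV in blast)
      from less.hyps[OF this repS] obtain k where k: "\<forall>v\<in>S. (\<rho> x ^^ k) v = 0" by (rule exE)
      obtain P where P: "E.lin_on UNIV P \<and> range P \<subseteq> S \<and> (\<forall>w\<in>S. P w = w)"
        by (rule exE[OF E.ex_projection[OF sS]])
      \<comment> \<open>The quotient V / S is realised on the complement \<open>C\<close> of S, with
        \<open>t\<close> as the quotient map.\<close>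
      define t where "t v = v - P v" for v
      define C where "C = t ` V"
      have PS: "P v \<in> S" for v using P by blast
      have Pl: "P (v + w) = P v + P w" "P (scaleV c v) = scaleV c (P v)" for v w c
        using E.lin_onD[of UNIV P] P by auto
      have t_add: "t (v + w) = t v + t w" for v w by (simp add: t_def Pl)
      have t_scale: "t (scaleV c v) = scaleV c (t v)" for c v
        by (simp add: t_def Pl E.scale_right_diff_distrib)
      have t_diff: "t (v - w) = t v - t w" for v w using t_add[of "v - w" w] by (simp add: eq_diff_eq)
      have t0: "t v = 0 \<longleftrightarrow> v \<in> S" for v
      proof
        assume "t v = 0" then have "v = P v" by (simp add: t_def)
        then show "v \<in> S" using PS[of v] by simp
      qed (use P in \<open>simp add: t_def\<close>)
      have tV: "t v \<in> V" if "v \<in> V" for v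
        unfolding t_def using that PS SV by (intro E.subspace_diff[OF sV]) auto
      have tt: "t (t v) = t v" for v
      proof -
        have "t (P v) = 0" using t0 PS by blast
        then have "t (v - P v) = t v" by (simp only: t_diff diff_zero)
        then show ?thesis by (simp only: t_def)
      qed
      have tC: "t c = c" if "c \<in> C" for c using that tt by (auto simp: C_def)
      have CV: "C \<subseteq> V" using tV by (auto simp: C_def)
      have t\<rho>: "t (\<rho> y (t v)) = t (\<rho> y v)" if "y \<in> g" "v \<in> V" for y v
      proof -
        have "\<rho> y v = \<rho> y (t v + P v)" by (simp add: t_def)
        also have "\<dots> = \<rho> y (t v) + \<rho> y (P v)"
          by (rule W.rho_add_right[OF that(1) tV[OF that(2)]]) (use PS SV in blast)
        finally show ?thesis using t0 S\<rho>[OF that(1) PS] by (simp add: t_add)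
      qed
      have sC: "E.subspace C"
        unfolding C_def by (rule E.subspace_lin_image[OF _ sV]) (simp add: E.lin_on_def t_add t_scale)
      have repC: "lie_rep scale bracket g scaleV C (\<lambda>y v. t (\<rho> y v))"
      proof unfold_locales
        show "fin_dim scaleV C" by (rule E.fin_dim_subspace[OF W.V_fin_dim sC CV])
        fix y c b assume y: "y \<in> g" and c': "c \<in> C"
        then have c: "c \<in> V" using CV by blast
        show "t (\<rho> y c) \<in> C" using W.rho_closed[OF y c] by (simp add: C_def)
        show "t (\<rho> y (scaleV b c)) = scaleV b (t (\<rho> y c))" "t (\<rho> (scale b y) c) = scaleV b (t (\<rho> y c))"
          by (simp_all add: W.rho_scale_right[OF y c] W.rho_scale_left[OF y c] t_scale)
        show "t (\<rho> y (c + w)) = t (\<rho> y c) + t (\<rho> y w)" if "w \<in> C" for w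
          using W.rho_add_right[OF y c subsetD[OF CV that]] by (simp add: t_add)
        fix z assume z: "z \<in> g"
        show "t (\<rho> (y + z) c) = t (\<rho> y c) + t (\<rho> z c)"
          using W.rho_add_left[OF y z c] by (simp add: t_add)
        show "t (\<rho> (bracket y z) c) = t (\<rho> y (t (\<rho> z c))) - t (\<rho> z (t (\<rho> y c)))"
          using W.rho_bracket[OF y z c] t\<rho> y z c W.rho_closed by (simp add: t_diff)
      qed
      have "simple_representation scale bracket g scaleV C (\<lambda>y v. t (\<rho> y v))"
        unfolding simple_representation_def
      proof (intro conjI allI impI)
        show "lie_representation scale bracket g scaleV C (\<lambda>y v. t (\<rho> y v))"
          using repC by (simp add: lie_rep_def)
        obtain v where "v \<in> V" "v \<notin> S" using SV SnV by blast
        then have "t v \<in> C" "t v \<noteq> 0" using t0 by (auto simp: C_def)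
        then show "C \<noteq> {0}" by blast
        fix T assume "module.subspace scaleV T \<and> T \<subseteq> C \<and> (\<forall>y\<in>g. \<forall>w\<in>T. t (\<rho> y w) \<in> T)"
        then have T: "E.subspace T" "T \<subseteq> C" "\<And>y w. y \<in> g \<Longrightarrow> w \<in> T \<Longrightarrow> t (\<rho> y w) \<in> T" by auto
        \<comment> \<open>The preimage of T in V. It lies between S and V, so maximality of S leaves
          only the two extreme cases.\<close>
        let ?K = "{s + w | s w. s \<in> S \<and> w \<in> T}"
        have KV: "?K \<subseteq> V" using SV T(2) CV E.subspace_add[OF sV] by blast
        have SK: "S \<subseteq> ?K"
        proof
          fix s assume "s \<in> S"
          moreover have "s = s + 0" by simp
          ultimately show "s \<in> ?K" using E.subspace_0[OF T(1)] by blast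
        qed
        show "T = {0} \<or> T = C"
        proof (cases "?K = V")
          case True
          have "C \<subseteq> T"
          proof
            fix c assume c: "c \<in> C"
            then have "c \<in> ?K" using CV True by blast
            then obtain s w where sw: "c = s + w" "s \<in> S" "w \<in> T" by blast
            have "t c = t s + t w" unfolding sw(1) by (rule t_add)
            then have "c = w" using tC[OF c] tC[OF subsetD[OF T(2) sw(3)]] t0 sw(2) by simp
            then show "c \<in> T" using sw(3) by simp
          qed
          then show ?thesis using T(2) by blast
        next
          case False
          have "M ?K"
            unfolding M_def
          proof (intro conjI ballI KV False)
            show "E.subspace ?K" by (rule E.subspace_sums[OF sS T(1)])
            fix y a assume y: "y \<in> g" and "a \<in> ?K"
            then obtain s w where sw: "a = s + w" "s \<in> S" "w \<in> T" by blast
            have sv: "s \<in> V" "w \<in> V" using sw SV T(2) CV by auto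
            have "\<rho> y a = (\<rho> y s + P (\<rho> y w)) + t (\<rho> y w)"
              unfolding sw(1) W.rho_add_right[OF y sv] by (simp add: t_def)
            moreover have "\<rho> y s + P (\<rho> y w) \<in> S" using S\<rho>[OF y sw(2)] PS by (rule E.subspace_add[OF sS])
            ultimately show "\<rho> y a \<in> ?K" using T(3)[OF y sw(3)] by blast
          qed
          then have KS: "?K = S" using max SK by blast
          have "w = 0" if w: "w \<in> T" for w
          proof -
            have "w = 0 + w" by simp
            then have "w \<in> S" using w KS E.subspace_0[OF sS] by blast
            then show ?thesis using tC[OF subsetD[OF T(2) w]] t0[of w] by metis
          qed
          then show ?thesis using E.subspace_0[OF T(1)] by blast
        qed
      qed
      from nil_radical_any[OF x this] have xC: "t (\<rho> x c) = 0" if "c \<in> C" for c using that by simp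
      have "(\<rho> x ^^ Suc k) v = 0" if v: "v \<in> V" for v
      proof -
        have "t (\<rho> x v) = 0" using t\<rho>[OF xg v] xC[of "t v"] v by (simp add: C_def)
        then have "\<rho> x v \<in> S" using t0 by blast
        then show ?thesis using k by (simp add: funpow_Suc_right del: funpow.simps)
      qed
      then show ?thesis by blast
    qed
  qed
qed

lemma nilrad_cone: "nilrad \<subseteq> cone"
proof
  fix x assume x: "x \<in> nilrad"
  then have xg: "x \<in> g" by (simp add: nil_radical_def)
  show "x \<in> cone"
  proof (rule coneI[OF xg])
    fix V and \<rho> :: "'a \<Rightarrow> (nat \<Rightarrow> 'k) \<Rightarrow> nat \<Rightarrow> 'k"
    assume rep: "lie_rep scale bracket g fun_scale V \<rho>"
    then interpret W: lie_rep scale bracket g fun_scale V \<rho> .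
    show "\<exists>k. W.op x ^ k = 0" using W.op_nilpotent_iff[OF xg] nilrad_nilpotent[OF rep x] by simp
  qed
qed

lemma ideal_nilsub: "ideal I \<Longrightarrow> I \<subseteq> cone \<Longrightarrow> nilsub I"
  using idealD[of I] by (auto simp: nilsub_def)

text \<open>By Engel's theorem I has a nonzero common kernel in a nonzero representation. As I is an
  ideal, this kernel is a subrepresentation, hence everything if the representation is
  simple.\<close>

lemma nil_ideal_nilrad:
  assumes I: "ideal I" "I \<subseteq> cone" shows "I \<subseteq> nilrad"
proof
  fix x assume x: "x \<in> I"
  have n: "nilsub I" by (rule ideal_nilsub[OF I])
  note ID = idealD[OF I(1)]
  show "x \<in> nilrad"
    unfolding nil_radical_def
  proof (intro CollectI conjI allI impI ballI)
    show "x \<in> g" using x ID(2) by blast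
    fix V \<rho> and v :: "nat \<Rightarrow> 'k" assume s: "simple_representation scale bracket g fun_scale V \<rho>" and v: "v \<in> V"
    then interpret W: lie_rep scale bracket g fun_scale V \<rho> by (simp add: simple_representation_def lie_rep_def)
    have "W.E.nil_set (W.op ` I)"
    proof (rule W.nil_set_op)
      show "W.subalg I" using nilsubD[OF n] by (simp add: W.subalg_def)
      show "\<exists>k. W.op y ^ k = 0" if "y \<in> I" for y
        by (rule cone_rep[OF subsetD[OF I(2) that] W.lie_rep_axioms])
    qed
    then obtain N where N: "\<forall>v. v \<in> W.E.flag (W.op ` I) N" unfolding W.E.nil_set_def by (rule exE)
    define S where "S = {v \<in> V. \<forall>y\<in>I. \<rho> y v = 0}"
    have \<rho>0: "\<rho> y 0 = 0" if "y \<in> g" for y using W.rho_scale_right[OF that v, of 0] by simp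
    have Ig: "y \<in> g" if "y \<in> I" for y using that ID(2) by blast
    have "W.V.subspace S"
      unfolding W.V.subspace_def S_def
      using W.V.subspace_0[OF W.sub_V] W.V.subspace_add[OF W.sub_V] W.V.subspace_scale[OF W.sub_V]
      by (auto simp: \<rho>0 Ig W.rho_add_right W.rho_scale_right)
    moreover have "S \<subseteq> V" by (auto simp: S_def)
    moreover have "\<forall>z\<in>g. \<forall>w\<in>S. \<rho> z w \<in> S"
    proof (intro ballI)
      fix z w assume z: "z \<in> g" and w: "w \<in> S"
      have wV: "w \<in> V" using w by (simp add: S_def)
      have "\<rho> y (\<rho> z w) = 0" if y: "y \<in> I" for y
        using W.rho_bracket[OF Ig[OF y] z wV] w y ID(4)[OF z y] \<rho>0[OF z] by (simp add: S_def)
      then show "\<rho> z w \<in> S" using W.rho_closed[OF z wV] by (simp add: S_def)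
    qed
    ultimately have "S = {0} \<or> S = V" using s unfolding simple_representation_def by blast
    moreover have False if S0: "S = {0}"
    proof -
      have "w = 0" if "w \<in> V" "w \<in> W.E.flag (W.op ` I) n" for w n
        using that
      proof (induction n arbitrary: w)
        case (Suc n)
        have "\<rho> y w = 0" if y: "y \<in> I" for y
        proof (rule Suc.IH)
          show "\<rho> y w \<in> V" by (rule W.rho_closed[OF Ig[OF y] Suc.prems(1)])
          have "app (W.op y) w \<in> W.E.flag (W.op ` I) n"
            using W.E.flag_step[OF Suc.prems(2)] y by blast
          then show "\<rho> y w \<in> W.E.flag (W.op ` I) n" by (simp add: W.app_op_V Ig[OF y] Suc.prems(1))
        qed
        then have "w \<in> S" using Suc.prems(1) by (simp add: S_def)
        then show ?case using S0 by simp
      qed simp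
      then have "V = {0}" using N W.V.subspace_0[OF W.sub_V] by blast
      then show False using s by (simp add: simple_representation_def)
    qed
    ultimately have "v \<in> S" using v by blast
    then show "\<rho> x v = 0" using x by (simp add: S_def)
  qed
qed

lemma cone_ad_nilpotent:
  assumes "x \<in> cone" shows "\<exists>k. \<forall>y\<in>g. (bracket x ^^ k) y = 0"
proof -
  have "lie_representation scale bracket g scale g bracket"
    by unfold_locales (auto simp: fin bracket_closed bracket_add_left bracket_add_right
      bracket_scale_left bracket_scale_right jacobi_left)
  from nilpotent_cone_any[OF assms this] show ?thesis .
qed

text \<open>This is the case Q = {0} of \<open>cone_if_op_nilpotent\<close>. It will be applied to a
  parabolic subalgebra in the place of g.\<close>

lemma cone_if_ad_nilpotent:
  assumes x: "x \<in> D" and nil: "\<exists>k. \<forall>y\<in>g. (bracket x ^^ k) y = 0"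
  shows "x \<in> cone"
proof -
  interpret q: lie_quot scale bracket g "{0}"
    by unfold_locales (auto simp: ideal_def subspace_single_0 subspace_0[OF subspace_carrier] bracket_0 cone_0)
  have xg: "x \<in> g" using x D_g by blast
  obtain k where k: "\<forall>y\<in>g. (bracket x ^^ k) y = 0" using nil by (rule exE)
  have "q.R.op x ^ Suc k = 0"
  proof (rule endo_eqI)
    fix v
    have u: "app (q.R.op x) v \<in> q.U" by (rule L.Lin_in[OF q.R.op_Lin[OF xg]])
    have "app (q.R.op x ^ k) (q.\<pi> (app (q.R.op x) v)) = q.\<pi> ((bracket x ^^ k) (app (q.R.op x) v))"
      using q.\<pi>_bracket_pow[OF xg, of "app (q.R.op x) v" k] u q.U_g by auto
    also have "\<dots> = 0" using k u q.U_g q.\<pi>_0_iff by auto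
    finally have "app (q.R.op x ^ k) (app (q.R.op x) v) = 0" by (simp add: q.\<pi>_on_U[OF u])
    then show "app (q.R.op x ^ Suc k) v = app 0 v" by (simp only: power_Suc2 app_simps)
  qed
  then show ?thesis using q.cone_if_op_nilpotent[OF x] by blast
qed

lemma subalgebra_fd_lie:
  assumes r: "subspace r" "r \<subseteq> g" "\<And>x y. x \<in> r \<Longrightarrow> y \<in> r \<Longrightarrow> bracket x y \<in> r"
  shows "fd_lie scale bracket r"
  by unfold_locales
    (simp_all add: r bracket_add_left bracket_add_right bracket_scale_left bracket_scale_right
      bracket_self jacobi L.fin_dim_subspace[OF fin r(1,2)] subsetD[OF r(2)])

text \<open>Representations of g restrict to r. The cone of r can be smaller than r \<inter>
  \<open>cone\<close>: a nilpotent matrix spans an abelian algebra with one-dimensional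
  representations in which it is not nilpotent.\<close>

lemma subalgebra_cone:
  assumes r: "subspace r" "r \<subseteq> g" "\<And>x y. x \<in> r \<Longrightarrow> y \<in> r \<Longrightarrow> bracket x y \<in> r"
  shows "nilpotent_cone scale bracket r \<subseteq> cone"
proof
  fix x assume x: "x \<in> nilpotent_cone scale bracket r"
  interpret r: fd_lie scale bracket r by (rule subalgebra_fd_lie[OF r])
  show "x \<in> cone"
    unfolding nilpotent_cone_def
  proof (intro CollectI conjI allI impI)
    show "x \<in> g" using x r(2) by (auto simp: nilpotent_cone_def)
    fix V and \<rho> :: "'a \<Rightarrow> (nat \<Rightarrow> 'k) \<Rightarrow> nat \<Rightarrow> 'k"
    assume "lie_representation scale bracket g fun_scale V \<rho>"
    then interpret W: lie_representation scale bracket g fun_scale V \<rho> .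
    have "lie_representation scale bracket r fun_scale V \<rho>"
      by unfold_locales
        (simp_all add: W.V_fin_dim W.rho_closed W.rho_add_right W.rho_scale_right W.rho_add_left
          W.rho_scale_left W.rho_bracket subsetD[OF r(2)])
    then show "\<exists>m. \<forall>v\<in>V. (\<rho> x ^^ m) v = 0" using x by (simp add: nilpotent_cone_def)
  qed
qed

end

subsection \<open>Functionals invariant under a parabolic subalgebra\<close>

context vspace_char_0
begin

text \<open>Z = [E, F] commutes with E, so Cartan's criterion makes Z nilpotent, and then E F is
  nilpotent too. In the Jacobson-Morozov argument below this puts e into (ad e)^2 g modulo
  Q.\<close>

lemma tr_0_if_commutator_commutes:
  assumes V: "fin_dim scale V" and E: "E \<in> Lin V" "E ^ n = 0" and F: "F \<in> Lin V"
    and comm: "E * (E * F - F * E) = (E * F - F * E) * E"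
  shows "tr V (E * F) = 0"
proof -
  interpret EE: vspace escale by (rule vspace_escale)
  define Z where "Z = E * F - F * E"
  have EZ: "E * Z = Z * E" using comm by (simp add: Z_def)
  have "\<exists>m. Z ^ m = 0"
  proof (rule nilpotent_if_trace_ad[OF V, where I = "{0::nat}" and a = "\<lambda>_. E" and b = "\<lambda>_. F" and N = 1])
    fix j :: nat assume j: "1 \<le> j"
    have "(ad Z ^^ j) E = 0"
    proof -
      obtain i where i: "j = Suc i" using j by (cases j) auto
      have "ad Z E = 0" using EZ by (simp add: ad_def)
      moreover have "(ad Z ^^ i) 0 = 0" by (induction i) (simp_all add: ad_def)
      ultimately show ?thesis by (simp add: i funpow_Suc_right del: funpow.simps)
    qed
    then show "(\<Sum>i\<in>{0::nat}. tr V (F * (ad Z ^^ j) E)) = 0" by (simp add: tr_0[OF V])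
  qed (use E F in \<open>auto simp: Z_def\<close>)
  then obtain m where m: "Z ^ m = 0" by (rule exE)
  have sV: "subspace V" by (rule fin_dim_subspace_carrier[OF V])
  have ZV: "Z \<in> Lin V" unfolding Z_def by (intro Lin_diff Lin_mult' sV E F)
  define A where "A = E * F"
  have EiZ: "E ^ i * Z = Z * E ^ i" for i by (rule power_commuting_commutes[OF EZ])
  have EiF: "E ^ i * F = F * E ^ i + escale (of_nat i) (Z * E ^ (i - 1))" for i
  proof (induction i)
    case (Suc i)
    have "E ^ Suc i * F = E * (E ^ i * F)" by (simp add: mult.assoc)
    also have "\<dots> = E * F * E ^ i + escale (of_nat i) (Z * (E * E ^ (i - 1)))"
      unfolding Suc by (simp add: distrib_left Lin_escale_mult[OF E(1)] EZ mult.assoc[symmetric])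
    also have "E * F = F * E + Z" by (simp add: Z_def)
    also have "escale (of_nat i) (Z * (E * E ^ (i - 1))) = escale (of_nat i) (Z * E ^ i)"
      by (cases i) simp_all
    finally show ?case
      by (simp add: distrib_right mult.assoc EE.scale_left_distrib)
  qed simp
  have EiA: "E ^ i * A = F * E ^ Suc i + escale (of_nat (Suc i)) (Z * E ^ i)" for i
    unfolding A_def mult.assoc[symmetric] power_Suc2[symmetric] using EiF[of "Suc i"] by simp
  have EA: "\<exists>G. E ^ Suc i * A = G * E ^ Suc i" for i
  proof -
    have "E ^ Suc i * A = (F * E + escale (of_nat (Suc (Suc i))) Z) * E ^ Suc i"
      using EiA[of "Suc i"] by (simp add: distrib_right escale_mult_left mult.assoc)
    then show ?thesis by (rule exI)
  qed
  \<comment> \<open>Modulo left multiples of E^(i+1), multiplying E^i by A from the right gives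
    (i+1) Z E^i. Since Z^m = 0, every m factors of A produce one more factor E on the right.\<close>
  have step: "\<exists>G. E ^ i * A ^ k = G * E ^ Suc i + escale (of_nat (Suc i) ^ k) (Z ^ k * E ^ i)" for i k
  proof (induction k)
    case 0
    show ?case by (intro exI[of _ 0]) simp
  next
    case (Suc k)
    then obtain G where G: "E ^ i * A ^ k = G * E ^ Suc i + escale (of_nat (Suc i) ^ k) (Z ^ k * E ^ i)"
      by (rule exE)
    obtain G' where G': "E ^ Suc i * A = G' * E ^ Suc i" using EA by (rule exE)
    have "E ^ i * A ^ Suc k = (E ^ i * A ^ k) * A" by (simp only: power_Suc2 mult.assoc)
    also have "\<dots> = G * (E ^ Suc i * A) + escale (of_nat (Suc i) ^ k) (Z ^ k * (E ^ i * A))"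
      unfolding G by (simp only: distrib_right mult.assoc escale_mult_left)
    also have "E ^ i * A = F * E ^ Suc i + escale (of_nat (Suc i)) (Z * E ^ i)" using EiA[of i] by simp
    also have "Z ^ k * (F * E ^ Suc i + escale (of_nat (Suc i)) (Z * E ^ i))
      = Z ^ k * F * E ^ Suc i + escale (of_nat (Suc i)) (Z ^ Suc k * E ^ i)"
      using Lin_escale_mult[OF Lin_power[OF Lin_UNIV[OF ZV]]]
      by (simp only: distrib_left mult.assoc power_Suc2)
    finally have "E ^ i * A ^ Suc k = (G * G' + escale (of_nat (Suc i) ^ k) (Z ^ k * F)) * E ^ Suc i
      + escale (of_nat (Suc i) ^ Suc k) (Z ^ Suc k * E ^ i)"
      unfolding G' by (simp only: EE.scale_right_distrib distrib_right mult.assoc escale_mult_left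
        EE.scale_scale power_Suc2 add.assoc)
    then show ?case by (rule exI)
  qed
  have "\<exists>G. A ^ (m * i) = G * E ^ i" for i
  proof (induction i)
    case 0
    show ?case by (intro exI[of _ 1]) simp
  next
    case (Suc i)
    then obtain G where G: "A ^ (m * i) = G * E ^ i" by (rule exE)
    obtain G' where "E ^ i * A ^ m = G' * E ^ Suc i + escale (of_nat (Suc i) ^ m) (Z ^ m * E ^ i)"
      using step by (rule exE)
    then have G': "E ^ i * A ^ m = G' * E ^ Suc i" by (simp add: m)
    have "A ^ (m * Suc i) = A ^ (m * i) * A ^ m" by (simp add: power_add[symmetric] add.commute)
    also have "\<dots> = (G * G') * E ^ Suc i" unfolding G by (simp only: mult.assoc G')
    finally show ?case by (rule exI)
  qed
  then obtain G where "A ^ (m * n) = G * E ^ n" by (rule exE)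
  then have "A ^ (m * n) = 0" by (simp add: E(2))
  then show ?thesis unfolding A_def by (rule tr_nilpotent[OF V Lin_mult'[OF E(1) F]])
qed

text \<open>
  A highest weight vector for \<open>sl\<^sub>2\<close> in a finite dimensional module has nonnegative weight;
  dually, a functional killed by \<open>E\<close> cannot have \<open>H\<close>-eigenvalue 2. All relations are only
  needed modulo a submodule \<open>W\<close> on which the functional vanishes.
\<close>
lemma sl2_functional_0:
  assumes V: "subspace V" and W: "subspace W" "W \<subseteq> V"
    and lin: "lin_on V E" "lin_on V F" "lin_on V H"
    and EV: "\<And>u. u \<in> V \<Longrightarrow> E u \<in> V" and FV: "\<And>u. u \<in> V \<Longrightarrow> F u \<in> V" and HV: "\<And>u. u \<in> V \<Longrightarrow> H u \<in> V"
    and EW: "\<And>u. u \<in> W \<Longrightarrow> E u \<in> W" and FW: "\<And>u. u \<in> W \<Longrightarrow> F u \<in> W"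
    and EF: "\<And>u. u \<in> V \<Longrightarrow> E (F u) - F (E u) - H u \<in> W"
    and HE: "\<And>u. u \<in> V \<Longrightarrow> H (E u) - E (H u) - scale 2 (E u) \<in> W"
    and f: "\<And>u w. u \<in> V \<Longrightarrow> w \<in> V \<Longrightarrow> f (u + w) = f u + f w" "\<And>c u. u \<in> V \<Longrightarrow> f (scale c u) = c * f u"
      "\<And>w. w \<in> W \<Longrightarrow> f w = 0" "\<And>u. u \<in> V \<Longrightarrow> f (E u) = 0" "\<And>u. u \<in> V \<Longrightarrow> f (H u) = 2 * f u"
    and nil: "\<And>u. u \<in> V \<Longrightarrow> (E ^^ k) u \<in> W" and u: "u \<in> V"
  shows "f u = 0"
proof -
  have EiV: "(E ^^ i) u \<in> V" if "u \<in> V" for i u by (induction i) (use that EV in auto)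
  have E: "E (x + y) = E x + E y" "E (x - y) = E x - E y" "E (scale c x) = scale c (E x)"
    if "x \<in> V" "y \<in> V" for x y c
    using lin_onD[OF lin(1)] lin_on_diff[OF lin(1) V] that by auto
  have HEi: "H ((E ^^ i) u) - (E ^^ i) (H u) - scale (2 * of_nat i) ((E ^^ i) u) \<in> W" if u: "u \<in> V" for i u
  proof (induction i)
    case 0
    then show ?case using subspace_0[OF W(1)] by simp
  next
    case (Suc i)
    let ?w = "(E ^^ i) u"
    have w: "?w \<in> V" by (rule EiV[OF u])
    have V3: "H ?w \<in> V" "(E ^^ i) (H u) \<in> V" "scale (2 * of_nat i) ?w \<in> V"
      using HV[OF w] EiV[OF HV[OF u]] subspace_scale[OF V w] by auto
    have "E (H ?w - (E ^^ i) (H u) - scale (2 * of_nat i) ?w) \<in> W" by (rule EW[OF Suc])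
    then have "E (H ?w) - E ((E ^^ i) (H u)) - scale (2 * of_nat i) (E ?w) \<in> W"
      using V3 w by (simp add: E subspace_diff[OF V])
    from subspace_add[OF W(1) HE[OF w] this] show ?case
      by (simp add: algebra_simps scale_left_distrib)
  qed
  have EFi: "(E ^^ Suc i) (F u) - F ((E ^^ Suc i) u) - scale (of_nat (Suc i)) ((E ^^ i) (H u))
      - scale (of_nat (Suc i) * of_nat i) ((E ^^ i) u) \<in> W" if u: "u \<in> V" for i u
  proof (induction i)
    case 0
    then show ?case using EF[OF u] by simp
  next
    case (Suc i)
    let ?w = "(E ^^ Suc i) u"
    have w: "?w \<in> V" by (rule EiV[OF u])
    have V3: "(E ^^ Suc i) (F u) \<in> V" "F ?w \<in> V" "scale (of_nat (Suc i)) ((E ^^ i) (H u)) \<in> V"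
      "scale (of_nat (Suc i) * of_nat i) ((E ^^ i) u) \<in> V" "(E ^^ i) (H u) \<in> V" "(E ^^ i) u \<in> V"
      using EiV[OF FV[OF u], of "Suc i"] FV[OF w] subspace_scale[OF V EiV[OF HV[OF u], of i]]
        subspace_scale[OF V EiV[OF u, of i]] EiV[OF HV[OF u]] EiV[OF u] by auto
    have "E ((E ^^ Suc i) (F u) - F ?w - scale (of_nat (Suc i)) ((E ^^ i) (H u))
      - scale (of_nat (Suc i) * of_nat i) ((E ^^ i) u)) \<in> W" by (rule EW[OF Suc])
    then have a: "(E ^^ Suc (Suc i)) (F u) - E (F ?w) - scale (of_nat (Suc i)) ((E ^^ Suc i) (H u))
      - scale (of_nat (Suc i) * of_nat i) ?w \<in> W"
      using E(2)[OF subspace_diff[OF V subspace_diff[OF V V3(1,2)] V3(3)] V3(4)]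
        E(2)[OF subspace_diff[OF V V3(1,2)] V3(3)] E(2)[OF V3(1,2)]
        E(3)[OF V3(5,5), of "of_nat (Suc i)"] E(3)[OF V3(6,6), of "of_nat (Suc i) * of_nat i"]
      by simp
    note b = EF[OF w] and c = HEi[OF u, of "Suc i"]
    have "(E ^^ Suc (Suc i)) (F u) - F ((E ^^ Suc (Suc i)) u) - scale (of_nat (Suc (Suc i))) ((E ^^ Suc i) (H u))
      - scale (of_nat (Suc (Suc i)) * of_nat (Suc i)) ?w
      = ((E ^^ Suc (Suc i)) (F u) - E (F ?w) - scale (of_nat (Suc i)) ((E ^^ Suc i) (H u))
      - scale (of_nat (Suc i) * of_nat i) ?w)
      + ((E (F ?w) - F (E ?w) - H ?w) + (H ?w - (E ^^ Suc i) (H u) - scale (2 * of_nat (Suc i)) ?w))"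
    proof -
      have s1: "scale (of_nat (Suc (Suc i))) y = scale (of_nat (Suc i)) y + y" for y
        unfolding of_nat_Suc[of "Suc i"] scale_left_distrib by (simp add: add.commute)
      have s2: "scale (of_nat (Suc (Suc i)) * of_nat (Suc i)) y
        = scale (of_nat (Suc i) * of_nat i) y + scale (2 * of_nat (Suc i)) y" for y
        unfolding scale_left_distrib[symmetric] by (rule arg_cong[where f = "\<lambda>c. scale c y"]) (simp add: algebra_simps)
      have s3: "(E ^^ Suc (Suc i)) u = E ?w" by simp
      show ?thesis unfolding s1 s2 s3 by (simp only: algebra_simps)
    qed
    then show ?case using subspace_add[OF W(1) a subspace_add[OF W(1) b c]] by (simp only:)
  qed
  \<comment> \<open>If E^(i+1) u is in W, then by \<open>EFi\<close> so is E^i applied to E F u -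
    (i+1)(H + i) u, and f vanishes there by induction. As f(E F u) = 0 and f(H u) = 2 f u, this says
    (i+1)(i+2) f u = 0.\<close>
  have "f u = 0" if "u \<in> V" "(E ^^ i) u \<in> W" for i u
    using that
  proof (induction i arbitrary: u)
    case 0
    then show ?case using f(3) by simp
  next
    case (Suc i)
    note u = Suc.prems(1)
    define a b where "a = scale (of_nat (Suc i)) (H u)" and "b = scale (of_nat (Suc i) * of_nat i) u"
    have V3: "E (F u) \<in> V" "a \<in> V" "b \<in> V"
      unfolding a_def b_def using EV[OF FV[OF u]] subspace_scale[OF V HV[OF u]] subspace_scale[OF V u] by auto
    have Ei: "(E ^^ j) (x - y) = (E ^^ j) x - (E ^^ j) y" "(E ^^ j) (scale c x) = scale c ((E ^^ j) x)"
      if "x \<in> V" "y \<in> V" for x y c j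
      by (induction j) (use that EiV E in auto)
    have "(E ^^ i) (E (F u) - a - b) = (E ^^ Suc i) (F u) - (E ^^ i) a - (E ^^ i) b"
      using Ei(1)[OF subspace_diff[OF V V3(1,2)] V3(3)] Ei(1)[OF V3(1,2)]
      by (simp add: funpow_Suc_right del: funpow.simps)
    also have "\<dots> = ((E ^^ Suc i) (F u) - F ((E ^^ Suc i) u) - scale (of_nat (Suc i)) ((E ^^ i) (H u))
      - scale (of_nat (Suc i) * of_nat i) ((E ^^ i) u)) + F ((E ^^ Suc i) u)"
      unfolding a_def b_def Ei(2)[OF HV[OF u] u] Ei(2)[OF u u] by (simp only: algebra_simps)
    also have "\<dots> \<in> W" by (rule subspace_add[OF W(1) EFi[OF u] FW[OF Suc.prems(2)]])
    finally have "f (E (F u) - a - b) = 0"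
      using Suc.IH V3 by (simp add: subspace_diff[OF V])
    moreover have "f (E (F u)) = f ((E (F u) - a - b) + (a + b))" by simp
    ultimately have "f (a + b) = 0"
      using f(1)[of "E (F u) - a - b" "a + b"] f(4)[OF FV[OF u]] V3
      by (simp add: subspace_diff[OF V] subspace_add[OF V])
    then have "of_nat (Suc i) * (2 * f u) + of_nat (Suc i) * of_nat i * f u = 0"
      using f(1)[OF V3(2,3)] f(2)[OF HV[OF u]] f(2)[OF u] f(5)[OF u] by (simp add: a_def b_def)
    then have "of_nat (Suc i * (2 + i)) * f u = 0" by (simp add: algebra_simps)
    then show ?case by (simp only: mult_eq_0_iff of_nat_eq_0_iff) simp
  qed
  then show ?thesis using nil u by blast
qed

end

context lie_rad
begin

text \<open>
  The stabilizer \<open>h\<close> of \<open>f\<close> in \<open>g\<close> contains \<open>r\<close>. Were it proper, the centre of \<open>perp h\<close> would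
  contain some \<open>e\<close> outside \<open>Q\<close>, and a Jacobson--Morozov argument would produce a weight of the
  wrong sign.
\<close>
lemma functional_kills_g_Q:
  assumes r: "parabolic_over r m" and f: "L.functional f" and fr: "\<And>a b. a \<in> r \<Longrightarrow> b \<in> r \<Longrightarrow> f (bracket a b) = 0"
    and a: "a \<in> g" and q: "q \<in> Q"
  shows "f (bracket a q) = 0"
proof (rule ccontr)
  assume faq: "f (bracket a q) \<noteq> 0"
  note fl = L.functionalD[OF f]
  have Qg: "x \<in> g" if "x \<in> Q" for x using that Q'(2) by blast
  \<comment> \<open>The stabilizer, under the coadjoint action, of the restriction of f to
    Q.\<close>
  define h where "h = {x \<in> g. \<forall>q\<in>Q. f (bracket x q) = 0}"
  have hI: "x \<in> h \<longleftrightarrow> x \<in> g \<and> (\<forall>q\<in>Q. f (bracket x q) = 0)" for x by (simp add: h_def)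
  have hg: "h \<subseteq> g" by (auto simp: h_def)
  have fjac: "f (bracket (bracket x y) z) = f (bracket x (bracket y z)) - f (bracket y (bracket x z))"
    if "x \<in> g" "y \<in> g" "z \<in> g" for x y z
    using jacobi_left[OF that] by (simp add: fl)
  have rh: "r \<subseteq> h"
    using fr parabolicD(4,10)[OF r] by (auto simp: h_def)
  have sh: "subspace h"
    unfolding subspace_def h_def
    using subspace_0[OF subspace_carrier] subspace_add[OF subspace_carrier] subspace_scale[OF subspace_carrier]
    by (auto simp: bracket_0 bracket_add_left bracket_scale_left Qg fl)
  have subh: "subalgebra h"
    unfolding subalgebra_def
  proof (intro conjI hg sh ballI)
    fix x y assume x: "x \<in> h" and y: "y \<in> h"
    then have xy: "x \<in> g" "y \<in> g" using hg by auto
    have "f (bracket (bracket x y) z) = 0" if z: "z \<in> Q" for z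
      using fjac[OF xy Qg[OF z]] x y Q'(3)[OF xy(1) z] Q'(3)[OF xy(2) z] by (simp add: h_def)
    then show "bracket x y \<in> h" using bracket_closed[OF xy] by (simp add: h_def)
  qed
  have Qh: "Q \<subseteq> h" using parabolicD(4)[OF r] rh by blast
  have shm: "perp h \<subseteq> m" using perp_antimono[OF rh] parabolicD(5)[OF r] by blast
  have shh: "perp h \<subseteq> h" using shm parabolicD(3)[OF r] rh by blast
  have nsh: "nilsub (perp h)"
    by (rule perp_nilsub[OF subh shh]) (use shm nilsubD(3)[OF parabolicD(2)[OF r]] in blast)
  have ah: "a \<notin> h" using faq q by (auto simp: h_def)
  have "\<exists>z\<in>perp h. z \<notin> Q"
  proof (rule ccontr)
    assume "\<not> (\<exists>z\<in>perp h. z \<notin> Q)"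
    then have "\<kappa> z a = 0" if "z \<in> perp h" for z using that \<kappa>_Q(1) a by blast
    then have "a \<in> h" by (rule perp_separation[OF sh Qh hg a])
    then show False using ah by blast
  qed
  then obtain z where z: "z \<in> perp h" "z \<notin> Q" by blast
  have "\<exists>e. e \<in> perp h \<and> e \<notin> Q \<and> (\<forall>y\<in>perp h. bracket y e \<in> Q)"
  proof (rule L.nil_set_descent[where \<phi> = \<pi>, OF nil_set_op[OF nsh] z])
    show "bracket x y \<in> perp h \<and> app (R.op x) (\<pi> y) = \<pi> (bracket x y)"
      if "x \<in> perp h" "y \<in> perp h" for x y
      using nilsubD(2)[OF nsh that] app_op_\<pi>[of x y] perp_g that by auto
  qed (simp add: \<pi>_0_iff)
  then obtain e where e: "e \<in> perp h" "e \<notin> Q" and eQ: "\<And>y. y \<in> perp h \<Longrightarrow> bracket y e \<in> Q" by blast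
  have eg: "e \<in> g" and eh: "e \<in> h" and ec: "e \<in> cone"
    using e perp_g shh nilsubD(3)[OF nsh] by auto
  \<comment> \<open>For z in \<open>perp h\<close> the form of z with [e, y] is that of [z, e] with
    y, and [z, e] is in Q. So ad e maps g into the double orthogonal h.\<close>
  have eyh: "bracket e y \<in> h" if y: "y \<in> g" for y
  proof (rule perp_separation[OF sh Qh hg bracket_closed[OF eg y]])
    fix z assume z: "z \<in> perp h"
    then have zg: "z \<in> g" using perp_g by blast
    show "\<kappa> z (bracket e y) = 0"
      using R.form_invariant[OF zg eg y] \<kappa>_Q(1)[OF eQ[OF z] y] by simp
  qed
  have bl: "L.lin_on g (bracket x)" if "x \<in> g" for x
    using that by (auto simp: L.lin_on_def bracket_add_right bracket_scale_right)
  \<comment> \<open>The Jacobson-Morozov step, by duality: if w is orthogonal to (ad e)^2 g, then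
    [[w, e], e] is in Q, and \<open>\<kappa> w e\<close> vanishes by
    \<open>tr_0_if_commutator_commutes\<close>.\<close>
  have "\<exists>x\<in>g. e - bracket e (bracket e x) \<in> Q"
  proof -
    let ?S = "(\<lambda>x. bracket e (bracket e x)) ` g"
    have sS: "subspace ?S"
      by (rule L.subspace_lin_image[OF _ subspace_carrier])
        (auto simp: L.lin_on_def bracket_add_right bracket_scale_right eg bracket_closed)
    have "e \<in> {s + q | s q. s \<in> ?S \<and> q \<in> Q}"
    proof (rule separation[OF subspace_sums[OF sS Q'(1)] _ eg])
      show "Q \<subseteq> {s + q | s q. s \<in> ?S \<and> q \<in> Q}" using sum_right[OF sS] by (rule subsetI)
      fix w assume w: "w \<in> g"
        "\<And>y. y \<in> {s + q | s q. s \<in> ?S \<and> q \<in> Q} \<Longrightarrow> y \<in> g \<Longrightarrow> \<kappa> w y = 0"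
      have wee: "bracket (bracket w e) e \<in> g" using w(1) eg bracket_closed by simp
      have "\<kappa> (bracket (bracket w e) e) x = 0" if x: "x \<in> g" for x
      proof -
        have eex: "bracket e (bracket e x) \<in> g" "bracket e x \<in> g" using eg x bracket_closed by auto
        have "\<kappa> w (bracket e (bracket e x)) = 0"
          by (rule w(2)[OF sum_left[OF Q'(1) imageI[OF x]] eex(1)])
        then show ?thesis
          using R.form_invariant[OF w(1) eg eex(2)] R.form_invariant[OF bracket_closed[OF w(1) eg] eg x] by simp
      qed
      then have "bracket (bracket w e) e \<in> Q" using wee D_g orthogonal_D by blast
      then have op0: "R.op (bracket (bracket w e) e) = 0" by (rule op_Q)
      have comm: "R.op e * (R.op e * R.op w - R.op w * R.op e) = (R.op e * R.op w - R.op w * R.op e) * R.op e"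
      proof -
        have "R.op (bracket (bracket w e) e)
          = (R.op w * R.op e - R.op e * R.op w) * R.op e - R.op e * (R.op w * R.op e - R.op e * R.op w)"
          using R.op_bracket[OF bracket_closed[OF w(1) eg] eg] R.op_bracket[OF w(1) eg] by simp
        then show ?thesis using op0 by (simp add: algebra_simps)
      qed
      obtain k where k: "R.op e ^ k = 0" by (rule exE[OF cone_rep[OF ec R.lie_rep_axioms]])
      have "L.tr U (R.op e * R.op w) = 0"
        by (rule L.tr_0_if_commutator_commutes[OF U_fin R.op_Lin[OF eg] k R.op_Lin[OF w(1)] comm])
      then show "\<kappa> w e = 0" using R.form_commute[OF w(1) eg] by (simp add: R.form_def)
    qed
    then obtain s q where sq: "e = s + q" "s \<in> ?S" "q \<in> Q" by (elim CollectE exE conjE) (rule that)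
    from sq(2) obtain x where "x \<in> g" "s = bracket e (bracket e x)" by (rule imageE)
    then have "x \<in> g" "e - bracket e (bracket e x) = q" using sq(1) by simp_all
    then have "x \<in> g" "e - bracket e (bracket e x) \<in> Q" using sq(3) by simp_all
    then show ?thesis by (rule bexI[rotated])
  qed
  then obtain x0 where x0: "x0 \<in> g" "e - bracket e (bracket e x0) \<in> Q" by blast
  \<comment> \<open>The factor -2 turns e = [e, [e, x0]] modulo Q into [h0, e] = 2 e modulo
    Q.\<close>
  define f0 where "f0 = scale (-2) x0"
  define h0 where "h0 = bracket e f0"
  have f0g: "f0 \<in> g" unfolding f0_def by (rule subspace_scale[OF subspace_carrier x0(1)])
  have h0g: "h0 \<in> g" unfolding h0_def by (rule bracket_closed[OF eg f0g])
  have h0h: "h0 \<in> h" unfolding h0_def by (rule eyh[OF f0g])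
  have h0e: "bracket h0 e - scale 2 e \<in> Q"
  proof -
    have "bracket e h0 = scale (-2) (bracket e (bracket e x0))"
      unfolding h0_def f0_def
      using bracket_scale_right[OF eg x0(1), of "-2"] bracket_scale_right[OF eg bracket_closed[OF eg x0(1)], of "-2"]
      by simp
    then have "bracket h0 e = scale 2 (bracket e (bracket e x0))"
      using bracket_anti[OF h0g eg] by simp
    then have "bracket h0 e - scale 2 e = scale (-2) (e - bracket e (bracket e x0))"
      by (simp add: scale_right_diff_distrib)
    then show ?thesis using subspace_scale[OF Q'(1) x0(2), of "-2"] by (simp only:)
  qed
  \<comment> \<open>\<open>\<kappa> e\<close> is a nonzero functional on g / h, and it vanishes on
    the image of T = ad h0 + 2. So T is not surjective on g / h, hence not injective: some c outside
    h has weight -2 modulo h.\<close>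
  define T where "T c = bracket h0 c + scale 2 c" for c
  have Tg: "T c \<in> g" if "c \<in> g" for c
    unfolding T_def using that h0g bracket_closed subspace_add[OF subspace_carrier] subspace_scale[OF subspace_carrier]
    by simp
  have eT: "\<kappa> e (T x) = 0" if x: "x \<in> g" for x
  proof -
    have b: "bracket e h0 \<in> g" "scale 2 e \<in> g" "scale 2 x \<in> g" "bracket h0 x \<in> g"
      using eg h0g x bracket_closed subspace_scale[OF subspace_carrier] by auto
    have "\<kappa> e (T x) = \<kappa> e (bracket h0 x) + 2 * \<kappa> e x"
      unfolding T_def using form_add_right[OF b(4,3) eg] form_scale_right[OF x eg] by simp
    also have "\<kappa> e (bracket h0 x) = \<kappa> (bracket e h0) x" using R.form_invariant[OF eg h0g x] by simp
    also have "\<kappa> (bracket e h0) x + 2 * \<kappa> e x = \<kappa> (bracket e h0 + scale 2 e) x"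
      using R.form_add[OF b(1,2) x] R.form_scale[OF eg x] by simp
    also have "\<dots> = 0"
    proof (rule \<kappa>_Q(1)[OF _ x])
      show "bracket e h0 + scale 2 e \<in> Q"
        using subspace_neg[OF Q'(1) h0e] bracket_anti[OF h0g eg] by (simp add: add.commute)
    qed
    finally show ?thesis .
  qed
  have "\<exists>c\<in>g. T c \<in> h \<and> c \<notin> h"
  proof (rule ccontr)
    assume "\<not> (\<exists>c\<in>g. T c \<in> h \<and> c \<notin> h)"
    then have inj: "c \<in> h" if "c \<in> g" "T c \<in> h" for c using that by blast
    have Tlin: "L.lin_on g T"
      by (auto simp: L.lin_on_def T_def bracket_add_right bracket_scale_right h0g scale_right_distrib
        scale_left_commute algebra_simps)
    have Th: "T x \<in> h" if "x \<in> h" for x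
      unfolding T_def using subalgebraD(3)[OF subh h0h that] subspace_scale[OF sh that] subspace_add[OF sh] by blast
    have "\<kappa> e y = 0" if y: "y \<in> g" for y
    proof -
      obtain x where x: "x \<in> g" "y - T x \<in> h"
        using L.inj_imp_surj_mod[OF fin sh hg Tlin Tg Th inj y] by blast
      have "\<kappa> e (y - T x) = 0" using e(1) x(2) by (simp add: perp_def)
      then show ?thesis
        using form_add_right[OF Tg[OF x(1)] subsetD[OF hg x(2)] eg] eT[OF x(1)] by simp
    qed
    then have "e \<in> Q" using eg D_g orthogonal_D by blast
    then show False using e(2) by blast
  qed
  then obtain c where c: "c \<in> g" "T c \<in> h" "c \<notin> h" by blast
  \<comment> \<open>[h0, e] = 2 e holds only modulo Q, so for the actions on Q the relation holds
    modulo W = [Q, Q].\<close>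
  define W where "W = span {bracket x y | x y. x \<in> Q \<and> y \<in> Q}"
  have WQ: "W \<subseteq> Q" unfolding W_def using Q'(3) Qg by (intro span_minimal[OF _ Q'(1)]) blast
  have sW: "subspace W" unfolding W_def by (rule subspace_span)
  have Wb: "bracket x y \<in> W" if "x \<in> Q" "y \<in> Q" for x y
    unfolding W_def using that by (intro span_base) blast
  have Wstab: "w \<in> Q \<and> bracket x w \<in> W" if x: "x \<in> g" and w: "w \<in> W" for x w
    using w unfolding W_def
  proof (induction rule: span_induct_alt)
    case base
    then show ?case using bracket_0(1)[OF x] span_zero subspace_0[OF Q'(1)] by simp
  next
    case (step b y z)
    then obtain u v where uv: "u \<in> Q" "v \<in> Q" "y = bracket u v" by blast
    have yQ: "y \<in> Q" using uv Q'(3) Qg by blast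
    have "bracket x y = bracket (bracket x u) v + bracket u (bracket x v)"
      using jacobi_left[OF x Qg[OF uv(1)] Qg[OF uv(2)]] by (simp add: uv(3))
    moreover have "bracket (bracket x u) v \<in> W" "bracket u (bracket x v) \<in> W"
      using uv Q'(3)[OF x] by (auto intro: Wb)
    ultimately have xy: "bracket x y \<in> W" using subspace_add[OF sW] by simp
    have "bracket x (scale b y + z) = scale b (bracket x y) + bracket x z"
      using bracket_add_right[OF x, of "scale b y" z] bracket_scale_right[OF x Qg[OF yQ]]
        subspace_scale[OF subspace_carrier Qg[OF yQ]] step Qg by simp
    then show ?case
      using step xy subspace_add[OF sW subspace_scale[OF sW xy]] yQ
        subspace_add[OF Q'(1) subspace_scale[OF Q'(1) yQ]] by (simp add: W_def)
  qed
  have fQQ: "f (bracket x y) = 0" if "x \<in> Q" "y \<in> Q" for x y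
    using that Qh by (auto simp: hI)
  have fcW: "f (bracket c w) = 0" if w: "w \<in> W" for w
  proof -
    have "w \<in> Q \<and> f (bracket c w) = 0" using w unfolding W_def
    proof (induction rule: span_induct_alt)
      case base
      then show ?case using bracket_0(1)[OF c(1)] subspace_0[OF Q'(1)] by (simp add: fl)
    next
      case (step b y z)
      then obtain u v where uv: "u \<in> Q" "v \<in> Q" "y = bracket u v" by blast
      have yQ: "y \<in> Q" using uv Q'(3) Qg by blast
      have "f (bracket c y) = 0"
        using fjac[OF c(1) Qg[OF uv(1)] Qg[OF uv(2)]] fQQ Q'(3)[OF c(1)] uv by simp
      moreover have "bracket c (scale b y + z) = scale b (bracket c y) + bracket c z"
        using bracket_add_right[OF c(1), of "scale b y" z] bracket_scale_right[OF c(1) Qg[OF yQ]]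
          subspace_scale[OF subspace_carrier Qg[OF yQ]] step Qg by simp
      ultimately show ?case
        using step subspace_add[OF Q'(1) subspace_scale[OF Q'(1) yQ]] by (simp add: fl)
    qed
    then show ?thesis ..
  qed
  obtain k where k: "\<forall>y\<in>g. (bracket e ^^ k) y = 0" by (rule exE[OF cone_ad_nilpotent[OF ec]])
  \<comment> \<open>The functional f[c, _] on Q is killed by e, since e and [c, e] are in h. It has
    weight 2 under h0, since [c, h0] = 2 c - T c with T c in h. So it vanishes, which would put c
    into h.\<close>
  have "f (bracket c u) = 0" if u: "u \<in> Q" for u
  proof (rule L.sl2_functional_0[OF Q'(1) sW WQ, where E = "bracket e" and F = "bracket f0"
        and H = "bracket h0" and k = k and f = "\<lambda>u. f (bracket c u)"])
    show "L.lin_on Q (bracket e)" "L.lin_on Q (bracket f0)" "L.lin_on Q (bracket h0)"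
      using L.lin_on_subset[OF bl Q'(2)] eg f0g h0g by auto
    show "bracket e u \<in> Q" "bracket f0 u \<in> Q" "bracket h0 u \<in> Q" if "u \<in> Q" for u
      using that Q'(3) eg f0g h0g by auto
    show "bracket e u \<in> W" "bracket f0 u \<in> W" if "u \<in> W" for u
      using that Wstab eg f0g by auto
    show "bracket e (bracket f0 u) - bracket f0 (bracket e u) - bracket h0 u \<in> W" if "u \<in> Q" for u
      using jacobi_left[OF eg f0g Qg[OF that]] subspace_0[OF sW] by (simp add: h0_def)
    show "bracket h0 (bracket e u) - bracket e (bracket h0 u) - scale 2 (bracket e u) \<in> W" if "u \<in> Q" for u
    proof -
      have "bracket (bracket h0 e - scale 2 e) u = bracket (bracket h0 e) u - scale 2 (bracket e u)"
        using bracket_diff(1)[OF bracket_closed[OF h0g eg] _ Qg[OF that], of "scale 2 e"]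
          subspace_scale[OF subspace_carrier eg] bracket_scale_left[OF eg Qg[OF that]] by simp
      then show ?thesis
        using jacobi_left[OF h0g eg Qg[OF that]] Wb[OF h0e that] by simp
    qed
    show "f (bracket c (u + w)) = f (bracket c u) + f (bracket c w)" if "u \<in> Q" "w \<in> Q" for u w
      using bracket_add_right[OF c(1) Qg Qg, OF that] by (simp add: fl)
    show "f (bracket c (scale b u)) = b * f (bracket c u)" if "u \<in> Q" for b u
      using bracket_scale_right[OF c(1) Qg[OF that]] by (simp add: fl)
    show "f (bracket c w) = 0" if "w \<in> W" for w by (rule fcW[OF that])
    show "f (bracket c (bracket e u)) = 0" if u: "u \<in> Q" for u
    proof -
      have "bracket c e \<in> h" using bracket_anti[OF c(1) eg] subspace_neg[OF sh eyh[OF c(1)]] by simp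
      then have "f (bracket (bracket c e) u) = 0" using u by (simp add: hI)
      moreover have "f (bracket e (bracket c u)) = 0" using eh Q'(3)[OF c(1) u] by (simp add: hI)
      ultimately show ?thesis using fjac[OF c(1) eg Qg[OF u]] by simp
    qed
    show "f (bracket c (bracket h0 u)) = 2 * f (bracket c u)" if u: "u \<in> Q" for u
    proof -
      have "bracket c h0 = scale 2 c - T c" using bracket_anti[OF c(1) h0g] by (simp add: T_def)
      then have "bracket (bracket c h0) u = scale 2 (bracket c u) - bracket (T c) u"
        using bracket_diff(1)[OF _ Tg[OF c(1)] Qg[OF u], of "scale 2 c"] bracket_scale_left[OF c(1) Qg[OF u]]
          subspace_scale[OF subspace_carrier c(1)] by simp
      moreover have "f (bracket (T c) u) = 0" using c(2) u by (simp add: hI)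
      moreover have "f (bracket h0 (bracket c u)) = 0" using h0h Q'(3)[OF c(1) u] by (simp add: hI)
      ultimately show ?thesis using fjac[OF c(1) h0g Qg[OF u]] by (simp add: fl)
    qed
    show "(bracket e ^^ k) u \<in> W" if "u \<in> Q" for u using k Qg[OF that] subspace_0[OF sW] by simp
  qed (rule u)
  then have "c \<in> h" using c(1) by (simp add: hI)
  then show False using c(3) by blast
qed

text \<open>
  Here \<open>f\<close> restricted to brackets is a cocycle on the semisimple quotient \<open>g / Q\<close>. It comes from a
  derivation \<open>\<delta>\<close> through \<open>\<kappa>\<close>, and the trace form shows that \<open>\<delta>\<close> is inner, so \<open>f\<close> agrees on \<open>D\<close>
  with \<open>\<kappa> d\<close> for some \<open>d\<close>.
\<close>
lemma functional_kills_DQ: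
  assumes f: "L.functional f" and fQ: "\<And>a q. a \<in> g \<Longrightarrow> q \<in> Q \<Longrightarrow> f (bracket a q) = 0"
    and x: "x \<in> D" "x \<in> Q"
  shows "f x = 0"
proof -
  note fl = L.functionalD[OF f]
  have Ug: "u \<in> g" if "u \<in> U" for u using that U_g by blast
  \<comment> \<open>The bracket is linear on g only, whereas \<open>form_represents\<close> asks for
    a functional on the whole type.\<close>
  obtain Pg where "L.lin_on UNIV Pg \<and> range Pg \<subseteq> g \<and> (\<forall>w\<in>g. Pg w = w)"
    by (rule exE[OF L.ex_projection[OF subspace_carrier]])
  then have Pg: "Pg (v + w) = Pg v + Pg w" "Pg (scale c v) = scale c (Pg v)" "Pg v \<in> g"
    and Pgg: "z \<in> g \<Longrightarrow> Pg z = z" for v w c z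
    using L.lin_onD[of UNIV Pg] by auto
  \<comment> \<open>Values in U are unique, which makes the chosen \<open>\<delta>\<close>
    linear.\<close>
  have "\<exists>y. y \<in> U \<and> (\<forall>b\<in>g. \<kappa> y b = f (bracket a b))" if a: "a \<in> g" for a
  proof -
    have "L.functional (\<lambda>b. f (bracket a (Pg b)))"
      by (simp add: L.functional_def Pg bracket_add_right bracket_scale_right a fl)
    moreover have "f (bracket a (Pg q)) = 0" if "q \<in> Q" for q
      using fQ[OF a that] Pgg Q'(2) that by auto
    ultimately obtain y where y: "y \<in> g" "\<forall>b\<in>g. \<kappa> y b = f (bracket a (Pg b))"
      using form_represents by blast
    have "\<kappa> (\<pi> y) b = \<kappa> y b" if b: "b \<in> g" for b
      using form_diff[OF y(1) \<pi>_g[OF y(1)] b] \<kappa>_Q(1)[OF \<pi>_mod[of y] b] by simp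
    then show ?thesis using y Pgg \<pi>_U[OF y(1)] by (intro exI[of _ "\<pi> y"]) simp
  qed
  then have "\<forall>a\<in>g. \<exists>y. y \<in> U \<and> (\<forall>b\<in>g. \<kappa> y b = f (bracket a b))" by blast
  from bchoice[OF this] obtain \<delta> where
    \<delta>': "\<forall>a\<in>g. \<delta> a \<in> U \<and> (\<forall>b\<in>g. \<kappa> (\<delta> a) b = f (bracket a b))" by (rule exE)
  have \<delta>: "\<delta> a \<in> U" "\<delta> a \<in> g" "b \<in> g \<Longrightarrow> \<kappa> (\<delta> a) b = f (bracket a b)" if "a \<in> g" for a b
    using \<delta>' that Ug by auto
  have uniq: "u = v" if u: "u \<in> U" and v: "v \<in> U" and eq: "\<And>b. b \<in> g \<Longrightarrow> \<kappa> u b = \<kappa> v b" for u v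
  proof -
    have "\<kappa> (u - v) b = 0" if "b \<in> g" for b
      using form_diff[OF Ug[OF u] Ug[OF v] that] eq[OF that] by simp
    then have "u - v \<in> Q"
      using subspace_diff[OF subspace_carrier Ug[OF u] Ug[OF v]] D_g orthogonal_D by blast
    then have "\<pi> u = \<pi> v" by (rule \<pi>_eq)
    then show ?thesis using u v by (simp add: \<pi>_on_U)
  qed
  have \<delta>_add: "\<delta> (a + b) = \<delta> a + \<delta> b" if "a \<in> g" "b \<in> g" for a b
    by (rule uniq)
      (simp_all add: \<delta> that subspace_add[OF subspace_carrier] subspace_add[OF U_subspace]
        R.form_add bracket_add_left fl)
  have \<delta>_scale: "\<delta> (scale c a) = scale c (\<delta> a)" if "a \<in> g" for a c
    by (rule uniq)
      (simp_all add: \<delta> that subspace_scale[OF subspace_carrier] subspace_scale[OF U_subspace]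
        R.form_scale bracket_scale_left fl)
  have \<delta>_Q: "\<delta> q = 0" if q: "q \<in> Q" for q
  proof (rule uniq)
    have qg: "q \<in> g" using q Q'(2) by blast
    show "\<delta> q \<in> U" by (rule \<delta>(1)[OF qg])
    show "0 \<in> U" by (rule subspace_0[OF U_subspace])
    fix b assume b: "b \<in> g"
    show "\<kappa> (\<delta> q) b = \<kappa> 0 b"
      using \<delta>(3)[OF qg b] bracket_anti[OF qg b] fQ[OF b q] form_0(2)[OF b] by (simp add: fl)
  qed
  have \<delta>_\<pi>: "\<delta> (\<pi> y) = \<delta> y" if y: "y \<in> g" for y
    using \<delta>_add[OF \<pi>_g[OF y], of "y - \<pi> y"] \<delta>_Q[OF \<pi>_mod[of y]] Q'(2) \<pi>_mod[of y] by auto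
  have deriv: "\<delta> (\<pi> (bracket a w)) = \<pi> (bracket a (\<delta> w)) + \<pi> (bracket (\<delta> a) w)"
    if a: "a \<in> g" and w: "w \<in> g" for a w
  proof (rule uniq)
    have aw: "bracket a w \<in> g" by (rule bracket_closed[OF a w])
    have g1: "bracket a (\<delta> w) \<in> g" "bracket (\<delta> a) w \<in> g" using a w \<delta> bracket_closed by auto
    show "\<delta> (\<pi> (bracket a w)) \<in> U" by (rule \<delta>(1)[OF \<pi>_g[OF aw]])
    show "\<pi> (bracket a (\<delta> w)) + \<pi> (bracket (\<delta> a) w) \<in> U"
      using \<pi>_U g1 by (intro subspace_add[OF U_subspace])
    fix b assume b: "b \<in> g"
    have \<kappa>\<pi>: "\<kappa> (\<pi> y) b = \<kappa> y b" if "y \<in> g" for y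
      using form_diff[OF that \<pi>_g[OF that] b] \<kappa>_Q(1)[OF \<pi>_mod[of y] b] by simp
    have "\<kappa> (bracket a (\<delta> w)) b = - \<kappa> (bracket (\<delta> w) a) b"
      using bracket_anti[OF a \<delta>(2)[OF w]] R.form_scale[OF bracket_closed[OF \<delta>(2)[OF w] a] b, of "-1"] by simp
    also have "\<dots> = - f (bracket w (bracket a b))"
      using R.form_invariant[OF \<delta>(2)[OF w] a b] \<delta>(3)[OF w bracket_closed[OF a b]] by simp
    finally have 1: "\<kappa> (bracket a (\<delta> w)) b = - f (bracket w (bracket a b))" .
    have 2: "\<kappa> (bracket (\<delta> a) w) b = f (bracket a (bracket w b))"
      using R.form_invariant[OF \<delta>(2)[OF a] w b] \<delta>(3)[OF a bracket_closed[OF w b]] by simp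
    have "\<kappa> (\<delta> (\<pi> (bracket a w))) b = f (bracket (bracket a w) b)"
      using \<delta>_\<pi>[OF aw] \<delta>(3)[OF aw b] by simp
    also have "\<dots> = \<kappa> (bracket a (\<delta> w)) b + \<kappa> (bracket (\<delta> a) w) b"
      unfolding 1 2 jacobi_left[OF a w b] by (simp add: fl)
    also have "\<dots> = \<kappa> (\<pi> (bracket a (\<delta> w)) + \<pi> (bracket (\<delta> a) w)) b"
      using R.form_add[OF \<pi>_g[OF g1(1)] \<pi>_g[OF g1(2)] b] \<kappa>\<pi>[OF g1(1)] \<kappa>\<pi>[OF g1(2)] by simp
    finally show "\<kappa> (\<delta> (\<pi> (bracket a w))) b = \<kappa> (\<pi> (bracket a (\<delta> w)) + \<pi> (bracket (\<delta> a) w)) b" .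
  qed
  have prU: "R.proj v \<in> U" "R.proj v \<in> g" for v using R.proj(2) Ug by auto
  have prl: "R.proj (v + w) = R.proj v + R.proj w" "R.proj (scale c v) = scale c (R.proj v)" for v w c
    using L.lin_onD[OF R.proj(1)] by auto
  define \<Delta> where "\<Delta> = Abs_endo (\<lambda>v. \<delta> (R.proj v))"
  have app\<Delta>: "app \<Delta> v = \<delta> (R.proj v)" for v
    unfolding \<Delta>_def by (subst Abs_endo_inverse) (auto simp: prl \<delta>_add prU)
  have \<Delta>L: "\<Delta> \<in> L.Lin U"
    by (simp add: L.Lin_def app\<Delta> prl \<delta>_scale \<delta> prU)
  have comm: "\<Delta> * R.op a - R.op a * \<Delta> = R.op (\<delta> a)" if a: "a \<in> g" for a
  proof (rule endo_eqI)
    fix v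
    let ?w = "R.proj v"
    have "R.proj (\<pi> (bracket a ?w)) = \<pi> (bracket a ?w)"
      by (rule R.proj(3)[OF \<pi>_U[OF bracket_closed[OF a prU(2)]]])
    moreover have "R.proj (\<delta> ?w) = \<delta> ?w" by (rule R.proj(3)[OF \<delta>(1)[OF prU(2)]])
    ultimately show "app (\<Delta> * R.op a - R.op a * \<Delta>) v = app (R.op (\<delta> a)) v"
      by (simp add: app\<Delta> R.app_op[OF a] R.app_op[OF \<delta>(2)[OF a]] deriv[OF a prU(2)])
  qed
  have LU: "\<Delta> * R.op a \<in> L.Lin U" "R.op a \<in> L.Lin U" if "a \<in> g" for a
    using L.Lin_mult'[OF \<Delta>L R.op_Lin[OF that]] R.op_Lin[OF that] by auto
  \<comment> \<open>Let d represent y \<mapsto> tr(\<Delta> ad y). Since [\<Delta>, ad a] =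
    ad(\<delta> a), f[a, b] = tr([\<Delta>, ad a] ad b) = tr(\<Delta> ad [a, b]), which is the form
    of d with [a, b].\<close>
  have "L.functional (\<lambda>y. L.tr U (\<Delta> * R.op (Pg y)))"
    by (simp add: L.functional_def Pg R.op_add R.op_scale distrib_left L.tr_add[OF U_fin] LU
      L.Lin_escale_mult[OF \<Delta>L] L.tr_scale[OF U_fin])
  moreover have "L.tr U (\<Delta> * R.op (Pg q)) = 0" if "q \<in> Q" for q
    using that Q'(2) Pgg[of q] op_Q[OF that] L.tr_0[OF U_fin] by auto
  ultimately obtain d where d: "d \<in> g" "\<forall>y\<in>g. \<kappa> d y = L.tr U (\<Delta> * R.op (Pg y))"
    using form_represents by blast
  have fd: "f (bracket a b) = \<kappa> d (bracket a b)" if a: "a \<in> g" and b: "b \<in> g" for a b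
  proof -
    have "f (bracket a b) = \<kappa> (\<delta> a) b" using \<delta>(3)[OF a b] by simp
    also have "\<dots> = L.tr U ((\<Delta> * R.op a - R.op a * \<Delta>) * R.op b)" by (simp add: R.form_def comm[OF a])
    also have "\<dots> = L.tr U (\<Delta> * R.op a * R.op b) - L.tr U (R.op a * (\<Delta> * R.op b))"
      unfolding left_diff_distrib
      by (subst L.tr_diff[OF U_fin]) (simp_all add: mult.assoc L.Lin_mult' LU \<Delta>L a b)
    also have "L.tr U (R.op a * (\<Delta> * R.op b)) = L.tr U (\<Delta> * R.op b * R.op a)"
      by (rule L.tr_commute[OF U_fin]) (simp_all add: LU a b)
    also have "L.tr U (\<Delta> * R.op a * R.op b) - L.tr U (\<Delta> * R.op b * R.op a) = L.tr U (\<Delta> * R.op (bracket a b))"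
      unfolding R.op_bracket[OF a b] right_diff_distrib
      by (subst L.tr_diff[OF U_fin]) (simp_all add: mult.assoc L.Lin_mult' LU \<Delta>L a b)
    also have "\<dots> = \<kappa> d (bracket a b)" using d(2) bracket_closed[OF a b] Pgg by simp
    finally show ?thesis .
  qed
  have "x \<in> g \<and> f x = \<kappa> d x" using x(1) unfolding D_def
  proof (induction rule: span_induct_alt)
    case base
    then show ?case using subspace_0[OF subspace_carrier] form_0 d(1) by (simp add: fl)
  next
    case (step c y z)
    then obtain a b where ab: "a \<in> g" "b \<in> g" "y = bracket a b" by blast
    then have y: "y \<in> g" "scale c y \<in> g" using bracket_closed subspace_scale[OF subspace_carrier] by auto
    show ?case
      using step y fd[OF ab(1,2)] ab(3) subspace_add[OF subspace_carrier y(2)]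
      by (simp add: form_add_right form_scale_right d(1) fl)
  qed
  then show ?thesis using \<kappa>_Q(2)[OF x(2) d(1)] by simp
qed

end

subsection \<open>Nilpotent radicals of parabolic subalgebras\<close>

context lie_rad
begin

text \<open>nil(r) is a nil ideal of r, so \<open>form_nil\<close> makes it orthogonal to r. For the
  other inclusion, \<open>perp r\<close> is an ideal of r with ad-nilpotent elements, and
  \<open>cone_if_ad_nilpotent\<close> for r applies once it is known to lie in [r, r].\<close>

lemma nil_radical_parabolic:
  assumes r: "parabolic_over r m" shows "nil_radical scale bracket r = perp r"
proof -
  note rD = parabolicD[OF r]
  have rg: "x \<in> g" if "x \<in> r" for x using that rD(10) by blast
  interpret r: fd_lie scale bracket r
    by (rule subalgebra_fd_lie[OF rD(11,10) subalgebraD(3)[OF rD(1)]])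
  have rcone: "nilpotent_cone scale bracket r \<subseteq> cone"
    by (rule subalgebra_cone[OF rD(11,10) subalgebraD(3)[OF rD(1)]])
  note I = r.idealD[OF r.nilrad_ideal]
  show ?thesis
  proof
    have ns: "nilsub (nil_radical scale bracket r)"
      unfolding nilsub_def using I(1,2,3) r.nilrad_cone rcone by blast
    show "nil_radical scale bracket r \<subseteq> perp r"
    proof
      fix x assume x: "x \<in> nil_radical scale bracket r"
      have "\<kappa> x y = 0" if y: "y \<in> r" for y
        by (rule form_nil[OF ns x]) (use rg[OF y] I(3)[OF y] in \<open>simp add: normalizer_iff\<close>)
      moreover have "x \<in> D" using x nilsubD(3)[OF ns] cone_D by blast
      ultimately show "x \<in> perp r" by (simp add: perp_def)
    qed
    have DQr: "D \<inter> Q \<subseteq> r.D"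
    proof
      fix x assume x: "x \<in> D \<inter> Q"
      show "x \<in> r.D"
      proof (rule ccontr)
        assume "x \<notin> r.D"
        from L.ex_functional[OF r.D_subspace this] obtain f where
          f: "L.functional f \<and> (\<forall>w\<in>r.D. f w = 0) \<and> f x = 1" by (rule exE)
        have "f (bracket a b) = 0" if "a \<in> r" "b \<in> r" for a b using f r.D_bracket[OF that] by blast
        then have "f (bracket a q) = 0" if "a \<in> g" "q \<in> Q" for a q
          using functional_kills_g_Q[OF r conjunct1[OF f]] that by blast
        then have "f x = 0" using functional_kills_DQ[OF conjunct1[OF f]] x by blast
        then show False using f by simp
      qed
    qed
    have rDD: "r.D \<subseteq> D"
      unfolding r.D_def by (rule span_minimal[OF _ D_subspace]) (use rg D_bracket in blast)
    have rDg: "x \<in> g" if "x \<in> r.D" for x using that rDD D_g by blast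
    have shrD: "perp r \<subseteq> r.D"
    proof
      fix x assume x: "x \<in> perp r"
      have xD: "x \<in> D" and xg: "x \<in> g" using x D_g by (auto simp: perp_def)
      have "x \<in> {a + b | a b. a \<in> r.D \<and> b \<in> Q}"
      proof (rule separation[OF subspace_sums[OF r.D_subspace Q'(1)] _ xg])
        show "Q \<subseteq> {a + b | a b. a \<in> r.D \<and> b \<in> Q}" using sum_right[OF r.D_subspace] by (rule subsetI)
        fix w assume w: "w \<in> g"
          "\<And>y. y \<in> {a + b | a b. a \<in> r.D \<and> b \<in> Q} \<Longrightarrow> y \<in> g \<Longrightarrow> \<kappa> w y = 0"
        \<comment> \<open>If w is orthogonal to [r, r], it maps r into \<open>perp r\<close>, hence
          m into m, and so it lies in r. This gives x = a + b with a in [r, r] and b in Q; then b is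
          in \<open>D \<inter> Q\<close>, and \<open>DQr\<close> takes care of it.\<close>
        have wr: "bracket w a \<in> perp r" if a: "a \<in> r" for a
        proof -
          have "\<kappa> (bracket w a) b = 0" if b: "b \<in> r" for b
          proof -
            have ab: "bracket a b \<in> r.D" by (rule r.D_bracket[OF a b])
            show ?thesis
              using w(2)[OF sum_left[OF Q'(1) ab] rDg[OF ab]] R.form_invariant[OF w(1) rg[OF a] rg[OF b]] by simp
          qed
          then show ?thesis using D_bracket[OF w(1) rg[OF a]] by (simp add: perp_def)
        qed
        have "w \<in> normalizer m" using w(1) wr rD(3,5) unfolding normalizer_iff by blast
        then have "w \<in> r" using rD(6) by blast
        then show "\<kappa> w x = 0" using x R.form_commute[OF w(1) xg] by (simp add: perp_def)
      qed
      then obtain a b where ab: "x = a + b" "a \<in> r.D" "b \<in> Q" by (elim CollectE exE conjE) (rule that)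
      have "b = x - a" using ab(1) by simp
      then have "b \<in> D" using subspace_diff[OF D_subspace xD] ab(2) rDD by blast
      then have "b \<in> r.D" using ab(3) DQr by blast
      then show "x \<in> r.D" unfolding ab(1) by (rule subspace_add[OF r.D_subspace ab(2)])
    qed
    show "perp r \<subseteq> nil_radical scale bracket r"
    proof (rule r.nil_ideal_nilrad)
      show "r.ideal (perp r)"
        unfolding r.ideal_def using perp_subspace[OF rD(10)] rD(8) perp_ideal(1)[OF rD(1)] by blast
      show "perp r \<subseteq> nilpotent_cone scale bracket r"
      proof
        fix x assume x: "x \<in> perp r"
        obtain k where k: "\<forall>y\<in>g. (bracket x ^^ k) y = 0"
          by (rule exE[OF cone_ad_nilpotent[OF subsetD[OF rD(9) x]]])
        then have "\<forall>y\<in>r. (bracket x ^^ k) y = 0" using rg by simp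
        then show "x \<in> nilpotent_cone scale bracket r"
          using r.cone_if_ad_nilpotent[of x] shrD x by blast
      qed
    qed
  qed
qed

lemma composite_nil_radical:
  assumes p: "parabolic_over p m" and q: "parabolic_over q n"
  defines "r \<equiv> p \<inter> q + nil_radical scale bracket q"
  shows "\<exists>l. parabolic_over r l"
    and "nil_radical scale bracket r = nil_radical scale bracket p \<inter> q + nil_radical scale bracket q"
proof -
  have r: "r = composite p q"
    unfolding r_def composite_def[OF p q] nil_radical_parabolic[OF q] by (auto simp: set_plus_def)
  obtain l where l: "parabolic_over r l" unfolding r by (rule exE[OF ex_parabolic_composite[OF p q]])
  then show "\<exists>l. parabolic_over r l" by (rule exI)
  have "nil_radical scale bracket r = perp r" by (rule nil_radical_parabolic[OF l])
  also have "\<dots> = composite_nil p q" unfolding r by (rule perp_composite[OF p q])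
  also have "\<dots> = nil_radical scale bracket p \<inter> q + nil_radical scale bracket q"
    unfolding nil_radical_parabolic[OF p] nil_radical_parabolic[OF q] composite_nil_def[OF p q] by (auto simp: set_plus_def)
  finally show "nil_radical scale bracket r = nil_radical scale bracket p \<inter> q + nil_radical scale bracket q" .
qed

end

lemma (in fd_lie) ex_lie_rad: "\<exists>Q. lie_rad scale bracket g Q"
proof -
  define P where "P I \<longleftrightarrow> ideal I \<and> D \<inter> I \<subseteq> cone" for I
  have "P {0}"
    by (auto simp: P_def ideal_def subspace_single_0 subspace_0[OF subspace_carrier] bracket_0 cone_0)
  then have "\<exists>M. P M \<and> {0} \<subseteq> M \<and> (\<forall>N. P N \<longrightarrow> M \<subseteq> N \<longrightarrow> N = M)"
    by (rule L.ex_maximal_subspace[where P = P, OF fin]) (simp add: P_def ideal_def)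
  then obtain Q where Q: "P Q" "\<forall>N. P N \<longrightarrow> Q \<subseteq> N \<longrightarrow> N = Q" by (elim exE conjE) (rule that)
  have "lie_rad scale bracket g Q"
    by unfold_locales (use Q in \<open>auto simp: P_def\<close>)
  then show ?thesis by (rule exI)
qed

theorem proposition3p16:
  fixes scale :: "'k::field_char_0 \<Rightarrow> 'a::ab_group_add \<Rightarrow> 'a"
    and bracket :: "'a \<Rightarrow> 'a \<Rightarrow> 'a"
    and g p q r :: "'a set"
  assumes "lie_algebra scale bracket g"
    and "fin_dim scale g"
    and "parabolic_subalgebra scale bracket g p"
    and "parabolic_subalgebra scale bracket g q"
    and "r = p \<inter> q + nil_radical scale bracket q"
  shows "parabolic_subalgebra scale bracket g r \<and>
    nil_radical scale bracket r =
      nil_radical scale bracket p \<inter> q + nil_radical scale bracket q"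
proof -
  have "fd_lie scale bracket g" using assms(1,2) by (simp add: fd_lie_def fd_lie_axioms_def)
  then interpret G: fd_lie scale bracket g .
  obtain Q where "lie_rad scale bracket g Q" by (rule exE[OF G.ex_lie_rad])
  then interpret G: lie_rad scale bracket g Q .
  obtain m n where mn: "G.parabolic_over p m" "G.parabolic_over q n"
    using assms(3,4) unfolding G.parabolic_iff_over by (elim exE) (rule that)
  show ?thesis
    using G.composite_nil_radical[OF mn] unfolding assms(5) G.parabolic_iff_over by (rule conjI)
qed

end
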